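(* Let $A$ be a (not necessarily unital) C*-algebra, and let $\alpha \colon G \to \mathrm{Aut}(A)$ be an action of a finite group $G$ on $A$. Then $$\mathrm{tsr}(A \rtimes_{\alpha} G) \leq \mathrm{tsr}(A) + \mathrm{card}(G) - 1.$$
   Context: For a unital C*-algebra $A$, the topological stable rank $\mathrm{tsr}(A)$ is the least integer $n \ge 1$ such that the set of $n$-tuples $(a_1,\dots,a_n) \in A^n$ which generate $A$ as a left ideal is dense in $A^n$ ($\infty$ if there is no such $n$). The topological stable rank of a nonunital C*-algebra is defined to be that of its smallest unitization. $A\rtimes_\alpha G$ denotes the C*-algebra crossed product. *)

theory Defs
  imports
    "HOL-Analysis.Analysis"
    "HOL-Library.Extended_Nat"
    "HOL-Algebra.FiniteProduct"
    "HOL-Algebra.Bij"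
begin

section \<open>C*-algebras with explicit carriers\<close>

text \<open>
  The C*-algebra \<open>A \<rtimes>\<^sub>\<alpha> G\<close> depends on the action, so it cannot be a type; hence algebras are records
  with a carrier. No unit is part of the signature, and the zero algebra is allowed.
\<close>

record 'a normed_star_alg = "'a partial_object" +
  alg_add :: "'a \<Rightarrow> 'a \<Rightarrow> 'a"  (infixl \<open>\<boxplus>\<index>\<close> 65)
  alg_zero :: 'a
  alg_mult :: "'a \<Rightarrow> 'a \<Rightarrow> 'a"  (infixl \<open>\<boxtimes>\<index>\<close> 70)
  alg_scale :: "complex \<Rightarrow> 'a \<Rightarrow> 'a"  (infixr \<open>\<odot>\<index>\<close> 75)
  alg_adj :: "'a \<Rightarrow> 'a"
  alg_norm :: "'a \<Rightarrow> real"

definition add_group :: "('a, 'm) normed_star_alg_scheme \<Rightarrow> 'a monoid" where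
  "add_group A = \<lparr>carrier = carrier A, mult = alg_add A, one = alg_zero A\<rparr>"

definition alg_sum :: "('a, 'm) normed_star_alg_scheme \<Rightarrow> ('i \<Rightarrow> 'a) \<Rightarrow> 'i set \<Rightarrow> 'a" where
  "alg_sum A f I = finprod (add_group A) f I"

definition alg_dist :: "('a, 'm) normed_star_alg_scheme \<Rightarrow> 'a \<Rightarrow> 'a \<Rightarrow> real" where
  "alg_dist A x y = alg_norm A (alg_add A x (alg_scale A (-1) y))"

locale star_algebra =
  fixes A :: "('a, 'm) normed_star_alg_scheme" (structure)
  assumes add_comm_group: "comm_group (add_group A)"
    and scale_closed: "x \<in> carrier A \<Longrightarrow> c \<odot> x \<in> carrier A"
    and mult_closed: "\<lbrakk>x \<in> carrier A; y \<in> carrier A\<rbrakk> \<Longrightarrow> x \<boxtimes> y \<in> carrier A"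
    and adj_closed: "x \<in> carrier A \<Longrightarrow> alg_adj A x \<in> carrier A"
    and scale_one: "x \<in> carrier A \<Longrightarrow> 1 \<odot> x = x"
    and scale_scale: "x \<in> carrier A \<Longrightarrow> c \<odot> (d \<odot> x) = (c * d) \<odot> x"
    and scale_add_left: "x \<in> carrier A \<Longrightarrow> (c + d) \<odot> x = c \<odot> x \<boxplus> d \<odot> x"
    and scale_add_right:
      "\<lbrakk>x \<in> carrier A; y \<in> carrier A\<rbrakk> \<Longrightarrow> c \<odot> (x \<boxplus> y) = c \<odot> x \<boxplus> c \<odot> y"
    and mult_assoc:
      "\<lbrakk>x \<in> carrier A; y \<in> carrier A; z \<in> carrier A\<rbrakk> \<Longrightarrow> (x \<boxtimes> y) \<boxtimes> z = x \<boxtimes> (y \<boxtimes> z)"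
    and mult_add_left:
      "\<lbrakk>x \<in> carrier A; y \<in> carrier A; z \<in> carrier A\<rbrakk>
        \<Longrightarrow> (x \<boxplus> y) \<boxtimes> z = x \<boxtimes> z \<boxplus> y \<boxtimes> z"
    and mult_add_right:
      "\<lbrakk>x \<in> carrier A; y \<in> carrier A; z \<in> carrier A\<rbrakk>
        \<Longrightarrow> x \<boxtimes> (y \<boxplus> z) = x \<boxtimes> y \<boxplus> x \<boxtimes> z"
    and mult_scale_left:
      "\<lbrakk>x \<in> carrier A; y \<in> carrier A\<rbrakk> \<Longrightarrow> (c \<odot> x) \<boxtimes> y = c \<odot> (x \<boxtimes> y)"
    and mult_scale_right:
      "\<lbrakk>x \<in> carrier A; y \<in> carrier A\<rbrakk> \<Longrightarrow> x \<boxtimes> (c \<odot> y) = c \<odot> (x \<boxtimes> y)"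
    and adj_adj: "x \<in> carrier A \<Longrightarrow> alg_adj A (alg_adj A x) = x"
    and adj_add:
      "\<lbrakk>x \<in> carrier A; y \<in> carrier A\<rbrakk> \<Longrightarrow> alg_adj A (x \<boxplus> y) = alg_adj A x \<boxplus> alg_adj A y"
    and adj_scale: "x \<in> carrier A \<Longrightarrow> alg_adj A (c \<odot> x) = cnj c \<odot> alg_adj A x"
    and adj_mult:
      "\<lbrakk>x \<in> carrier A; y \<in> carrier A\<rbrakk> \<Longrightarrow> alg_adj A (x \<boxtimes> y) = alg_adj A y \<boxtimes> alg_adj A x"

definition cstar_seminorm :: "('a, 'm) normed_star_alg_scheme \<Rightarrow> ('a \<Rightarrow> real) \<Rightarrow> bool" where
  "cstar_seminorm A p \<longleftrightarrow>
     (\<forall>x\<in>carrier A. 0 \<le> p x) \<and>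
     (\<forall>x\<in>carrier A. \<forall>y\<in>carrier A. p (alg_add A x y) \<le> p x + p y) \<and>
     (\<forall>x\<in>carrier A. \<forall>c. p (alg_scale A c x) = cmod c * p x) \<and>
     (\<forall>x\<in>carrier A. \<forall>y\<in>carrier A. p (alg_mult A x y) \<le> p x * p y) \<and>
     (\<forall>x\<in>carrier A. p (alg_mult A (alg_adj A x) x) = (p x)\<^sup>2)"

locale cstar_algebra = star_algebra A
  for A :: "('a, 'm) normed_star_alg_scheme" (structure) +
  assumes norm_cstar: "cstar_seminorm A (alg_norm A)"
    and norm_eq_zero: "\<lbrakk>x \<in> carrier A; alg_norm A x = 0\<rbrakk> \<Longrightarrow> x = alg_zero A"
    and norm_complete: "Metric_space.mcomplete (carrier A) (alg_dist A)"


section \<open>Unitization and topological stable rank\<close>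

definition unital :: "('a, 'm) normed_star_alg_scheme \<Rightarrow> bool" where
  "unital A \<longleftrightarrow> (\<exists>e\<in>carrier A. \<forall>x\<in>carrier A. alg_mult A e x = x \<and> alg_mult A x e = x)"

text \<open>
  The unitization \<open>A + \<complex>1\<close>, to be used for nonunital \<open>A\<close> only: \<open>(a, c)\<close> stands for \<open>a + c1\<close>, and its
  C*-norm is the norm of \<open>x \<mapsto> a x + c x\<close> as an operator on \<open>A\<close>.
\<close>

definition unitization :: "'a normed_star_alg \<Rightarrow> ('a \<times> complex) normed_star_alg" where
  "unitization A =
    \<lparr>carrier = carrier A \<times> UNIV,
     alg_add = (\<lambda>(a, c) (b, d). (alg_add A a b, c + d)),
     alg_zero = (alg_zero A, 0),
     alg_mult = (\<lambda>(a, c) (b, d).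
        (alg_add A (alg_mult A a b) (alg_add A (alg_scale A c b) (alg_scale A d a)), c * d)),
     alg_scale = (\<lambda>z (a, c). (alg_scale A z a, z * c)),
     alg_adj = (\<lambda>(a, c). (alg_adj A a, cnj c)),
     alg_norm = (\<lambda>(a, c). SUP x\<in>{x \<in> carrier A. alg_norm A x \<le> 1}.
        alg_norm A (alg_add A (alg_mult A a x) (alg_scale A c x)))\<rparr>"

definition left_ideal :: "('a, 'm) normed_star_alg_scheme \<Rightarrow> 'a set \<Rightarrow> bool" where
  "left_ideal A I \<longleftrightarrow>
     subgroup I (add_group A) \<and> (\<forall>a\<in>carrier A. \<forall>x\<in>I. alg_mult A a x \<in> I)"

text \<open>The \<open>n\<close>-tuples over \<open>A\<close> are the elements of \<open>{..<n} \<rightarrow>\<^sub>E carrier A\<close>.\<close>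

definition left_generating_tuples ::
    "('a, 'm) normed_star_alg_scheme \<Rightarrow> nat \<Rightarrow> (nat \<Rightarrow> 'a) set" where
  "left_generating_tuples A n =
     {a \<in> {..<n} \<rightarrow>\<^sub>E carrier A. left_ideal A hull (a ` {..<n}) = carrier A}"

definition dense_tuples ::
    "('a, 'm) normed_star_alg_scheme \<Rightarrow> nat \<Rightarrow> (nat \<Rightarrow> 'a) set \<Rightarrow> bool" where
  "dense_tuples A n D \<longleftrightarrow>
     (\<forall>a \<in> {..<n} \<rightarrow>\<^sub>E carrier A. \<forall>\<epsilon>>0. \<exists>b\<in>D. \<forall>i<n. alg_dist A (a i) (b i) < \<epsilon>)"

text \<open>Below, the infimum of the empty set of extended naturals is \<open>\<infinity>\<close>.\<close>

definition tsr_unital :: "('a, 'm) normed_star_alg_scheme \<Rightarrow> enat" where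
  "tsr_unital A = (INF n\<in>{n. 1 \<le> n \<and> dense_tuples A n (left_generating_tuples A n)}. enat n)"

definition tsr :: "'a normed_star_alg \<Rightarrow> enat" where
  "tsr A = (if unital A then tsr_unital A else tsr_unital (unitization A))"


section \<open>Actions of finite groups and crossed products\<close>

text \<open>As for \<^const>\<open>BijGroup\<close>, automorphisms are extensional functions on the carrier.\<close>

definition star_auts :: "('a, 'm) normed_star_alg_scheme \<Rightarrow> ('a \<Rightarrow> 'a) set" where
  "star_auts A = {f \<in> Bij (carrier A).
     (\<forall>x\<in>carrier A. \<forall>y\<in>carrier A. f (alg_add A x y) = alg_add A (f x) (f y)) \<and>
     (\<forall>x\<in>carrier A. \<forall>c. f (alg_scale A c x) = alg_scale A c (f x)) \<and>
     (\<forall>x\<in>carrier A. \<forall>y\<in>carrier A. f (alg_mult A x y) = alg_mult A (f x) (f y)) \<and>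
     (\<forall>x\<in>carrier A. f (alg_adj A x) = alg_adj A (f x))}"

definition star_Aut :: "('a, 'm) normed_star_alg_scheme \<Rightarrow> ('a \<Rightarrow> 'a) monoid" where
  "star_Aut A = BijGroup (carrier A) \<lparr>carrier := star_auts A\<rparr>"

text \<open>
  For a finite group \<open>G\<close>, the Banach *-algebra \<open>L\<^sup>1(G, A)\<close> (with counting measure) consists of all
  functions \<open>f : G \<rightarrow> A\<close>, where \<open>f\<close> stands for the sum of the \<open>f(g) u\<^sub>g\<close> with
  \<open>u\<^sub>g a = \<alpha>\<^sub>g(a) u\<^sub>g\<close>.
\<close>

definition L1_algebra ::
    "('g, 'm) monoid_scheme \<Rightarrow> 'a normed_star_alg \<Rightarrow> ('g \<Rightarrow> 'a \<Rightarrow> 'a) \<Rightarrow> ('g \<Rightarrow> 'a) normed_star_alg"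
  where
  "L1_algebra G A \<alpha> =
    \<lparr>carrier = carrier G \<rightarrow>\<^sub>E carrier A,
     alg_add = (\<lambda>f h. \<lambda>s\<in>carrier G. alg_add A (f s) (h s)),
     alg_zero = (\<lambda>s\<in>carrier G. alg_zero A),
     alg_mult = (\<lambda>f h. \<lambda>s\<in>carrier G.
        alg_sum A (\<lambda>t. alg_mult A (f t) (\<alpha> t (h (inv\<^bsub>G\<^esub> t \<otimes>\<^bsub>G\<^esub> s)))) (carrier G)),
     alg_scale = (\<lambda>c f. \<lambda>s\<in>carrier G. alg_scale A c (f s)),
     alg_adj = (\<lambda>f. \<lambda>s\<in>carrier G. \<alpha> s (alg_adj A (f (inv\<^bsub>G\<^esub> s)))),
     alg_norm = (\<lambda>f. \<Sum>s\<in>carrier G. alg_norm A (f s))\<rparr>"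

text \<open>
  The norm of the enveloping C*-algebra of a Banach *-algebra: C*-seminorms are exactly the functions
  \<open>x \<mapsto> \<parallel>\<pi>(x)\<parallel>\<close> for *-representations \<open>\<pi>\<close>.
\<close>

definition enveloping_norm :: "('a, 'm) normed_star_alg_scheme \<Rightarrow> 'a \<Rightarrow> real" where
  "enveloping_norm L x =
     (SUP p\<in>{p. cstar_seminorm L p \<and> (\<forall>y\<in>carrier L. p y \<le> alg_norm L y)}. p x)"

text \<open>
  The crossed product is the enveloping C*-algebra of \<open>L\<^sup>1(G, A)\<close>. As \<open>G\<close> is finite, the universal
  C*-seminorm is a norm equivalent to the \<open>L\<^sup>1\<close>-norm, so that neither a quotient nor a completion has
  to be taken.
\<close>

definition crossed_product ::
    "('g, 'm) monoid_scheme \<Rightarrow> 'a normed_star_alg \<Rightarrow> ('g \<Rightarrow> 'a \<Rightarrow> 'a) \<Rightarrow> ('g \<Rightarrow> 'a) normed_star_alg"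
  where
  "crossed_product G A \<alpha> =
     L1_algebra G A \<alpha> \<lparr>alg_norm := enveloping_norm (L1_algebra G A \<alpha>)\<rparr>"

end

(* Writing the elements of the crossed product B as sums of a(g) u(g), an m-tuple over B is an m x n matrix
   over A with n = card G. If m >= tsr A + n - 1, column-by-column perturbation and row operations make
   the rows of the matrix span A^n as a left module, so that the tuple generates B as a left ideal.

   If A has no unit, this gives a nearby unimodular tuple over the skew group ring D of the unitization
   of A. It has to be moved into the unitization of B, that is, its scalar parts, which are elements of
   the group algebra, have to be made scalar. If the scalars are bounded by the norm of the unitization,
   then the first scalar part is close to a nonzero scalar, hence invertible, and row operations do the
   rest. Otherwise every scalar has lifts of arbitrarily small norm, and elementary row operations can
   be chosen close to the identity. For a complete A the second case does not occur, but completeness is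
   stated in terms of Metric_space, whose definitional facts are available for metrics on the whole type
   only, and alg_dist need not be one outside the carrier. *)

theory Submission
  imports Defs "HOL-Algebra.Ring"
begin

section \<open>Left modules spanned by the rows of a matrix\<close>

text \<open>The summand \<open>card G - 1\<close> is the price of the columns. One column becomes
  left invertible with \<open>tsr A\<close> rows; every further column takes one more row, since the
  row that serves as its pivot is lost to the other columns. An element of A at the identity of G
  multiplies coefficients one by one from the left, so spanning rows give a left inverse whose
  multipliers do not involve the group. Their scalar parts are therefore complex numbers, and show
  which combination of the entries has its scalar part at the identity only. Coefficientwise
  closeness is enough because the enveloping norm is at most the \<open>L1\<close> norm. In the
  nonunital case the skew group ring D is too large: its quotient by B is the group algebra, while
  the unitization of B adds only multiples of 1. Both scalar corrections rest on a pivot with a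
  nonzero scalar. If lifts of scalars can be small, that pivot corrects every entry but itself, and
  a second entry must correct it. A single entry occurs only for the trivial group, where B is a
  copy of A.\<close>

lemma (in abelian_monoid) finsum_swap:
  assumes "finite I" "finite J" "\<And>i j. \<lbrakk>i \<in> I; j \<in> J\<rbrakk> \<Longrightarrow> f i j \<in> carrier G"
  shows "(\<Oplus>i\<in>I. \<Oplus>j\<in>J. f i j) = (\<Oplus>j\<in>J. \<Oplus>i\<in>I. f i j)"
  using assms(1,3)
proof (induction I rule: finite_induct)
  case empty
  then show ?case by simp
next
  case (insert i I)
  have cl: "(\<lambda>j. f i j) \<in> J \<rightarrow> carrier G" "(\<lambda>j. \<Oplus>i\<in>I. f i j) \<in> J \<rightarrow> carrier G"
    using insert.prems by (auto intro!: finsum_closed)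
  have "(\<Oplus>i\<in>insert i I. \<Oplus>j\<in>J. f i j) = (\<Oplus>j\<in>J. f i j) \<oplus> (\<Oplus>i\<in>I. \<Oplus>j\<in>J. f i j)"
    using insert by (intro finsum_insert) (auto intro!: finsum_closed)
  also have "\<dots> = (\<Oplus>j\<in>J. f i j) \<oplus> (\<Oplus>j\<in>J. \<Oplus>i\<in>I. f i j)"
    using insert by simp
  also have "\<dots> = (\<Oplus>j\<in>J. f i j \<oplus> (\<Oplus>i\<in>I. f i j))"
    using cl by (intro finsum_addf[symmetric])
  also have "\<dots> = (\<Oplus>j\<in>J. \<Oplus>i\<in>insert i I. f i j)"
  proof (rule finsum_cong')
    fix j assume "j \<in> J"
    then show "f i j \<oplus> (\<Oplus>i\<in>I. f i j) = (\<Oplus>i\<in>insert i I. f i j)"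
      using insert by (intro finsum_insert[symmetric]) auto
  qed (use insert.prems in \<open>auto intro!: finsum_closed\<close>)
  finally show ?case .
qed

lemma (in abelian_monoid) finsum_eq_single:
  assumes "finite I" "i \<in> I" "f i \<in> carrier G" "\<And>j. \<lbrakk>j \<in> I; j \<noteq> i\<rbrakk> \<Longrightarrow> f j = \<zero>"
  shows "finsum G f I = f i"
proof -
  have "finsum G f I = (\<Oplus>j\<in>I. if i = j then f i else \<zero>)"
    using assms by (intro finsum_cong') auto
  also have "\<dots> = f i"
    using assms by (intro finsum_singleton) auto
  finally show ?thesis .
qed

text \<open>Left translation by \<open>u\<close> permutes the group. This substitution is what makes
  convolution associative.\<close>

lemma (in abelian_monoid) finsum_translate:
  assumes "group H" "u \<in> carrier H" "f \<in> carrier H \<rightarrow> carrier G"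
  shows "(\<Oplus>t\<in>carrier H. f t) = (\<Oplus>v\<in>carrier H. f (u \<otimes>\<^bsub>H\<^esub> v))"
proof -
  interpret H: group H by fact
  have inj: "inj_on ((\<otimes>\<^bsub>H\<^esub>) u) (carrier H)" using assms(2) by (auto simp: inj_on_def)
  have "(\<otimes>\<^bsub>H\<^esub>) u ` carrier H = carrier H"
    using H.surj_const_mult[OF assms(2)] .
  then show ?thesis
    using finsum_reindex[OF _ inj, of f] assms(3) by simp
qed

lemma (in abelian_monoid) finsum_lessThan_one: "f 0 \<in> carrier G \<Longrightarrow> finsum G f {..<1::nat} = f 0"
  using finsum_eq_single[of "{..<1}" 0 f] by simp

section \<open>Perturbing a matrix over a seminormed ring until its rows span the free
  module\<close>

definition (in ring) rows_span :: "'j set \<Rightarrow> nat \<Rightarrow> (nat \<Rightarrow> 'j \<Rightarrow> 'a) \<Rightarrow> bool" where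
  "rows_span J m Y \<longleftrightarrow>
     (\<forall>y\<in>J \<rightarrow> carrier R. \<exists>r\<in>{..<m} \<rightarrow> carrier R. \<forall>j\<in>J. y j = (\<Oplus>i\<in>{..<m}. r i \<otimes> Y i j))"

text \<open>The two instances are a unital C*-algebra with its own norm and the unitization with its
  operator norm. An abstract ring covers both and keeps the matrix argument free of scalars.\<close>

locale submult_normed_ring = ring R for R (structure) +
  fixes N :: "'a \<Rightarrow> real"
  assumes N_nonneg: "x \<in> carrier R \<Longrightarrow> 0 \<le> N x"
    and N_zero: "N \<zero> = 0"
    and N_neg: "x \<in> carrier R \<Longrightarrow> N (\<ominus> x) = N x"
    and N_add: "\<lbrakk>x \<in> carrier R; y \<in> carrier R\<rbrakk> \<Longrightarrow> N (x \<oplus> y) \<le> N x + N y"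
    and N_mult: "\<lbrakk>x \<in> carrier R; y \<in> carrier R\<rbrakk> \<Longrightarrow> N (x \<otimes> y) \<le> N x * N y"
begin

lemma N_finsum:
  assumes "finite I" "f \<in> I \<rightarrow> carrier R"
  shows "N (finsum R f I) \<le> (\<Sum>i\<in>I. N (f i))"
  using assms
proof (induction I)
  case empty
  then show ?case by (simp add: N_zero)
next
  case (insert i I)
  then have "N (f i \<oplus> finsum R f I) \<le> N (f i) + N (finsum R f I)"
    by (intro N_add finsum_closed) auto
  with insert show ?case by (simp add: Pi_iff)
qed

lemma r_distr_minus:
  "\<lbrakk>x \<in> carrier R; y \<in> carrier R; z \<in> carrier R\<rbrakk> \<Longrightarrow> x \<otimes> (y \<ominus> z) = x \<otimes> y \<ominus> x \<otimes> z"
  by algebra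

lemma minus_add_minus:
  "\<lbrakk>x \<in> carrier R; y \<in> carrier R; z \<in> carrier R\<rbrakk> \<Longrightarrow> x \<ominus> ((x \<oplus> y) \<ominus> z) = \<ominus> (y \<ominus> z)"
  by algebra

lemma N_minus_add:
  assumes "x \<in> carrier R" "y \<in> carrier R" "p \<in> carrier R"
  shows "N (x \<ominus> (y \<oplus> p)) \<le> N (x \<ominus> y) + N p"
proof -
  have "x \<ominus> (y \<oplus> p) = (x \<ominus> y) \<oplus> \<ominus> p" using assms by algebra
  then show ?thesis using N_add[of "x \<ominus> y" "\<ominus> p"] assms by (simp add: N_neg)
qed

text \<open>The left inverse \<open>l\<close> is stated explicitly, rather than a generated ideal,
  because the row operations below use its entries as coefficients.\<close>

definition unimodular_dense :: "nat \<Rightarrow> bool" where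
  "unimodular_dense m \<longleftrightarrow>
     (\<forall>a\<in>{..<m} \<rightarrow> carrier R. \<forall>\<epsilon>>0. \<exists>b\<in>{..<m} \<rightarrow> carrier R. \<exists>l\<in>{..<m} \<rightarrow> carrier R.
        (\<forall>i<m. N (a i \<ominus> b i) < \<epsilon>) \<and> (\<Oplus>i\<in>{..<m}. l i \<otimes> b i) = \<one>)"

lemma finsum_minus:
  assumes "f \<in> I \<rightarrow> carrier R" "g \<in> I \<rightarrow> carrier R" "finite I"
  shows "finsum R (\<lambda>i. f i \<ominus> g i) I = finsum R f I \<ominus> finsum R g I"
  using assms(3,1,2)
proof (induction I)
  case (insert i I)
  then have cl: "f i \<in> carrier R" "g i \<in> carrier R" "finsum R f I \<in> carrier R"
    "finsum R g I \<in> carrier R"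
    by (auto intro!: finsum_closed)
  have "finsum R (\<lambda>i. f i \<ominus> g i) (insert i I) = (f i \<ominus> g i) \<oplus> (finsum R f I \<ominus> finsum R g I)"
    using insert by (subst finsum_insert) (auto simp: Pi_iff)
  also have "\<dots> = (f i \<oplus> finsum R f I) \<ominus> (g i \<oplus> finsum R g I)"
    using cl by algebra
  finally show ?case using insert by (simp add: Pi_iff)
qed (simp add: a_minus_def)

text \<open>For one column, a left inverse \<open>l\<close> of the perturbed entries
  \<open>b\<close> writes any \<open>y\<close> as the combination with coefficients
  \<open>y \<otimes> l i\<close>.\<close>

lemma rows_span_perturb_single:
  assumes "unimodular_dense m" and X: "X \<in> {..<m} \<rightarrow> {j} \<rightarrow> carrier R" and "\<epsilon> > 0"
  shows "\<exists>Y\<in>{..<m} \<rightarrow> {j} \<rightarrow> carrier R.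
    (\<forall>i<m. \<forall>k\<in>{j}. N (X i k \<ominus> Y i k) < \<epsilon>) \<and> rows_span {j} m Y"
proof -
  have "(\<lambda>i. X i j) \<in> {..<m} \<rightarrow> carrier R" using X by auto
  from assms(1)[unfolded unimodular_dense_def, rule_format, OF this \<open>\<epsilon> > 0\<close>]
  obtain b l where b: "b \<in> {..<m} \<rightarrow> carrier R" and l: "l \<in> {..<m} \<rightarrow> carrier R"
    and close: "\<forall>i<m. N (X i j \<ominus> b i) < \<epsilon>" and one: "(\<Oplus>i\<in>{..<m}. l i \<otimes> b i) = \<one>"
    by auto
  have "\<exists>r\<in>{..<m} \<rightarrow> carrier R. y j = (\<Oplus>i\<in>{..<m}. r i \<otimes> b i)" if "y j \<in> carrier R" for y
  proof (rule bexI)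
    have "(\<Oplus>i\<in>{..<m}. (y j \<otimes> l i) \<otimes> b i) = (\<Oplus>i\<in>{..<m}. y j \<otimes> (l i \<otimes> b i))"
      using that l b by (intro finsum_cong') (auto simp: m_assoc Pi_iff)
    also have "\<dots> = y j \<otimes> (\<Oplus>i\<in>{..<m}. l i \<otimes> b i)"
      using that l b by (subst finsum_rdistr) (auto simp: Pi_iff)
    finally show "y j = (\<Oplus>i\<in>{..<m}. (y j \<otimes> l i) \<otimes> b i)" using one that by simp
    show "(\<lambda>i. y j \<otimes> l i) \<in> {..<m} \<rightarrow> carrier R" using that l by auto
  qed
  then show ?thesis
    using b close by (intro bexI[of _ "\<lambda>i k. b i"]) (auto simp: rows_span_def)
qed

text \<open>The left-invertible column of the first \<open>m\<close> rows lets row operations turn the last row into a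
  pivot with entry \<open>1\<close> in column \<open>j0\<close>; clearing that column leaves an \<open>m \<times> J\<close> matrix.\<close>

lemma rows_span_perturb_insert:
  assumes J: "finite J" "j0 \<notin> J" and dense: "unimodular_dense m"
    and IH: "\<And>X \<epsilon>. \<lbrakk>X \<in> {..<m} \<rightarrow> J \<rightarrow> carrier R; \<epsilon> > 0\<rbrakk> \<Longrightarrow>
      \<exists>Y\<in>{..<m} \<rightarrow> J \<rightarrow> carrier R. (\<forall>i<m. \<forall>j\<in>J. N (X i j \<ominus> Y i j) < \<epsilon>) \<and> rows_span J m Y"
    and X: "X \<in> {..<Suc m} \<rightarrow> insert j0 J \<rightarrow> carrier R" and "\<epsilon> > 0"
  shows "\<exists>Y\<in>{..<Suc m} \<rightarrow> insert j0 J \<rightarrow> carrier R.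
    (\<forall>i<Suc m. \<forall>j\<in>insert j0 J. N (X i j \<ominus> Y i j) < \<epsilon>) \<and> rows_span (insert j0 J) (Suc m) Y"
proof -
  have X': "X i j \<in> carrier R" if "i \<le> m" "j \<in> insert j0 J" for i j
    using X that by (auto simp: Pi_iff less_Suc_eq_le)
  have "(\<lambda>i. X i j0) \<in> {..<m} \<rightarrow> carrier R" by (auto intro: X')
  from dense[unfolded unimodular_dense_def, rule_format, OF this \<open>\<epsilon> > 0\<close>]
  obtain a l where a: "a \<in> {..<m} \<rightarrow> carrier R" and l: "l \<in> {..<m} \<rightarrow> carrier R"
    and close_a: "\<forall>i<m. N (X i j0 \<ominus> a i) < \<epsilon>" and one: "(\<Oplus>i\<in>{..<m}. l i \<otimes> a i) = \<one>"
    by auto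
  define p where "p = X m j0"
  \<comment> \<open>The last row has entry \<open>p\<close> in column \<open>j0\<close>. Once the
    entries above it are \<open>a\<close>, adding \<open>c \<otimes> l i\<close> times row
    \<open>i\<close> for all \<open>i\<close> turns this entry into
    \<open>p \<oplus> c = \<one>\<close>.\<close>
  define c where "c = \<one> \<ominus> p"
  have p: "p \<in> carrier R" and c: "c \<in> carrier R" by (auto simp: p_def c_def intro: X')
  \<comment> \<open>\<open>q\<close> is the last row after this operation, on the columns of
    \<open>J\<close>. It is computed from \<open>X\<close> and remains the pivot row to the
    end.\<close>
  define q where "q j = X m j \<oplus> (\<Oplus>i\<in>{..<m}. (c \<otimes> l i) \<otimes> X i j)" for j
  have q: "q j \<in> carrier R" if "j \<in> J" for j
    unfolding q_def using that X' c l by (intro a_closed finsum_closed) (auto simp: Pi_iff)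
  \<comment> \<open>Subtracting \<open>a i\<close> times the pivot row from row \<open>i\<close>
    clears column \<open>j0\<close> and leaves \<open>Z\<close>, which has one row and one column
    less.\<close>
  define Z where "Z i j = X i j \<ominus> a i \<otimes> q j" for i j
  define K where "K = (\<Sum>i<m. N (c \<otimes> l i))"
  have K: "K \<ge> 0" unfolding K_def using c l by (intro sum_nonneg N_nonneg) auto
  \<comment> \<open>The last row changes by the combination of the other changes with coefficients
    \<open>c \<otimes> l i\<close>, hence by at most \<open>K * \<eta>\<close>. The
    \<open>+ 1\<close> covers \<open>K = 0\<close> and makes this strictly smaller than
    \<open>\<epsilon>\<close>.\<close>
  define \<eta> where "\<eta> = \<epsilon> / (K + 1)"
  have \<eta>: "\<eta> > 0" "\<eta> \<le> \<epsilon>" "K * \<eta> < \<epsilon>"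
    using K \<open>\<epsilon> > 0\<close> by (auto simp: \<eta>_def field_simps)
  have Z: "Z \<in> {..<m} \<rightarrow> J \<rightarrow> carrier R"
    using X' a q by (auto simp: Z_def Pi_iff)
  from IH[OF Z \<open>\<eta> > 0\<close>] obtain W where W: "W \<in> {..<m} \<rightarrow> J \<rightarrow> carrier R"
    and close_W: "\<forall>i<m. \<forall>j\<in>J. N (Z i j \<ominus> W i j) < \<eta>" and span: "rows_span J m W" by auto
  \<comment> \<open>The operations are undone, starting from \<open>W\<close>. The last row of
    \<open>Y\<close> subtracts the combination of the rows of \<open>V\<close>, not of
    \<open>X\<close>, so that the same row operation applied to \<open>Y\<close> returns exactly the
    pivot row \<open>q\<close>.\<close>
  define V where "V i j = (if j = j0 then a i else W i j \<oplus> a i \<otimes> q j)" for i j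
  define Y where "Y i j = (if i < m then V i j else if j = j0 then p
      else q j \<ominus> (\<Oplus>i\<in>{..<m}. (c \<otimes> l i) \<otimes> V i j))" for i j
  have V: "V i j \<in> carrier R" if "i < m" "j \<in> insert j0 J" for i j
    using that W a q by (auto simp: V_def Pi_iff)
  have cl: "c \<otimes> l i \<in> carrier R" if "i < m" for i using that c l by auto
  have clX: "(\<lambda>i. (c \<otimes> l i) \<otimes> X i j) \<in> {..<m} \<rightarrow> carrier R" if "j \<in> J" for j
    using that cl X' by auto
  have clV: "(\<lambda>i. (c \<otimes> l i) \<otimes> V i j) \<in> {..<m} \<rightarrow> carrier R" if "j \<in> insert j0 J" for j
    using that cl V by (auto simp del: insert_iff)
  have Y: "Y i j \<in> carrier R" if "j \<in> insert j0 J" for i j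
    using that V p q clV by (auto simp: Y_def Pi_iff intro!: minus_closed finsum_closed)
  have VX: "X i j \<ominus> V i j = Z i j \<ominus> W i j" if "i < m" "j \<in> J" for i j
  proof -
    have "X i j \<in> carrier R" "a i \<in> carrier R" "q j \<in> carrier R" "W i j \<in> carrier R"
      using that X' a q W by auto
    moreover have "j \<noteq> j0" using that J by auto
    ultimately show ?thesis unfolding V_def Z_def by (simp, algebra)
  qed
  have "N (X i j \<ominus> Y i j) < \<epsilon>" if i: "i < Suc m" and j: "j \<in> insert j0 J" for i j
  proof (cases "i < m")
    case True
    show ?thesis
    proof (cases "j = j0")
      case True
      then show ?thesis using \<open>i < m\<close> close_a by (simp add: Y_def V_def)
    next
      case False
      then have "j \<in> J" using j by simp
      then have "N (X i j \<ominus> Y i j) < \<eta>" using True VX close_W by (simp add: Y_def)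
      then show ?thesis using \<eta> by simp
    qed
  next
    case False
    then have i: "i = m" using i by simp
    show ?thesis
    proof (cases "j = j0")
      case True
      then show ?thesis using i \<open>\<epsilon> > 0\<close> p by (simp add: Y_def p_def r_neg a_minus_def N_zero)
    next
      case False
      then have j: "j \<in> J" using j by simp
      let ?SX = "\<Oplus>i\<in>{..<m}. (c \<otimes> l i) \<otimes> X i j" and ?SV = "\<Oplus>i\<in>{..<m}. (c \<otimes> l i) \<otimes> V i j"
      have S: "?SX \<in> carrier R" "?SV \<in> carrier R" "X m j \<in> carrier R"
        using clX[OF j] clV j X' by (auto intro!: finsum_closed)
      have "X i j \<ominus> Y i j = X m j \<ominus> ((X m j \<oplus> ?SX) \<ominus> ?SV)"
        using False i by (simp add: Y_def q_def)
      also have "\<dots> = \<ominus> (?SX \<ominus> ?SV)"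
        using minus_add_minus[OF S(3,1,2)] .
      also have "?SX \<ominus> ?SV = (\<Oplus>i\<in>{..<m}. (c \<otimes> l i) \<otimes> X i j \<ominus> (c \<otimes> l i) \<otimes> V i j)"
        using clX[OF j] clV[of j] j by (intro finsum_minus[symmetric]) auto
      finally have "N (X i j \<ominus> Y i j) = N (\<Oplus>i\<in>{..<m}. (c \<otimes> l i) \<otimes> X i j \<ominus> (c \<otimes> l i) \<otimes> V i j)"
        using clX[OF j] clV[of j] j by (simp only:, subst N_neg) (auto intro!: finsum_closed simp: Pi_iff)
      also have "\<dots> \<le> (\<Sum>i<m. N ((c \<otimes> l i) \<otimes> X i j \<ominus> (c \<otimes> l i) \<otimes> V i j))"
        using clX[OF j] clV[of j] j by (intro N_finsum) (auto simp: Pi_iff)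
      also have "\<dots> \<le> (\<Sum>i<m. N (c \<otimes> l i) * \<eta>)"
      proof (rule sum_mono)
        fix k assume "k \<in> {..<m}"
        then have k: "k < m" by simp
        have cr: "X k j \<in> carrier R" "V k j \<in> carrier R" "c \<otimes> l k \<in> carrier R"
          using k j X' V cl by auto
        then have "(c \<otimes> l k) \<otimes> X k j \<ominus> (c \<otimes> l k) \<otimes> V k j = (c \<otimes> l k) \<otimes> (X k j \<ominus> V k j)"
          by (simp only: r_distr_minus)
        then have "N ((c \<otimes> l k) \<otimes> X k j \<ominus> (c \<otimes> l k) \<otimes> V k j) \<le> N (c \<otimes> l k) * N (X k j \<ominus> V k j)"
          using cr by (simp add: N_mult)
        also have "\<dots> \<le> N (c \<otimes> l k) * \<eta>"
          using k j close_W cr by (intro mult_left_mono N_nonneg) (auto simp: VX less_imp_le)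
        finally show "N ((c \<otimes> l k) \<otimes> X k j \<ominus> (c \<otimes> l k) \<otimes> V k j) \<le> N (c \<otimes> l k) * \<eta>" .
      qed
      also have "\<dots> = K * \<eta>" by (simp add: K_def sum_distrib_right)
      finally show ?thesis using \<eta> by simp
    qed
  qed
  moreover have "rows_span (insert j0 J) (Suc m) Y"
    unfolding rows_span_def
  proof
    fix y assume y: "y \<in> insert j0 J \<rightarrow> carrier R"
    have yJ: "y j \<in> carrier R" if "j \<in> insert j0 J" for j using y that by auto
    \<comment> \<open>The row \<open>y\<close> minus \<open>y j0\<close> times the pivot row
      vanishes in column \<open>j0\<close>, so only the columns of \<open>J\<close> remain to be
      matched, by the rows of \<open>W\<close>.\<close>
    have "(\<lambda>j. y j \<ominus> y j0 \<otimes> q j) \<in> J \<rightarrow> carrier R" using yJ q by auto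
    from span[unfolded rows_span_def, rule_format, OF this]
    obtain s where s: "s \<in> {..<m} \<rightarrow> carrier R"
      and sW: "\<And>j. j \<in> J \<Longrightarrow> y j \<ominus> y j0 \<otimes> q j = (\<Oplus>i\<in>{..<m}. s i \<otimes> W i j)" by auto
    define sa where "sa = (\<Oplus>i\<in>{..<m}. s i \<otimes> a i)"
    have sa: "sa \<in> carrier R" unfolding sa_def using s a by (auto intro!: finsum_closed)
    \<comment> \<open>The upper rows with coefficients \<open>s\<close> contribute \<open>sa\<close>
      to column \<open>j0\<close>, so the pivot row has to be taken \<open>d\<close> times. The
      pivot row is the last row plus \<open>c \<otimes> l i\<close> times row \<open>i\<close>;
      accordingly \<open>r\<close> spreads \<open>d\<close> over all rows.\<close>
    define d where "d = y j0 \<ominus> sa"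
    have d: "d \<in> carrier R" using sa yJ by (auto simp: d_def)
    define r where "r i = (if i < m then s i \<oplus> d \<otimes> (c \<otimes> l i) else d)" for i
    have r: "r \<in> {..<Suc m} \<rightarrow> carrier R" using s d cl by (auto simp: r_def Pi_iff)
    have sum: "(\<Oplus>i\<in>{..<Suc m}. r i \<otimes> Y i j) = d \<otimes> Y m j \<oplus> ((\<Oplus>i\<in>{..<m}. s i \<otimes> V i j) \<oplus>
       d \<otimes> (\<Oplus>i\<in>{..<m}. (c \<otimes> l i) \<otimes> V i j))" if j: "j \<in> insert j0 J" for j
    proof -
      have "(\<Oplus>i\<in>{..<Suc m}. r i \<otimes> Y i j) = r m \<otimes> Y m j \<oplus> (\<Oplus>i\<in>{..<m}. r i \<otimes> Y i j)"
        using r Y[OF j] by (auto simp: lessThan_Suc finsum_insert Pi_iff)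
      also have "(\<Oplus>i\<in>{..<m}. r i \<otimes> Y i j) =
          (\<Oplus>i\<in>{..<m}. s i \<otimes> V i j \<oplus> d \<otimes> ((c \<otimes> l i) \<otimes> V i j))"
      proof (rule finsum_cong')
        fix i assume "i \<in> {..<m}"
        then have "i < m" "s i \<in> carrier R" "V i j \<in> carrier R" "l i \<in> carrier R"
          using s j V l by auto
        then show "r i \<otimes> Y i j = s i \<otimes> V i j \<oplus> d \<otimes> ((c \<otimes> l i) \<otimes> V i j)"
          using d c by (simp add: r_def Y_def, algebra)
      qed (use s j V l d c in \<open>auto simp: Pi_iff\<close>)
      also have "\<dots> = (\<Oplus>i\<in>{..<m}. s i \<otimes> V i j) \<oplus> (\<Oplus>i\<in>{..<m}. d \<otimes> ((c \<otimes> l i) \<otimes> V i j))"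
        using s V clV[OF j] d j by (intro finsum_addf) (auto simp: Pi_iff)
      also have "(\<Oplus>i\<in>{..<m}. d \<otimes> ((c \<otimes> l i) \<otimes> V i j)) = d \<otimes> (\<Oplus>i\<in>{..<m}. (c \<otimes> l i) \<otimes> V i j)"
        using clV[OF j] d by (intro finsum_rdistr[symmetric]) auto
      finally show ?thesis by (simp add: r_def)
    qed
    have "y j = (\<Oplus>i\<in>{..<Suc m}. r i \<otimes> Y i j)" if j: "j \<in> insert j0 J" for j
    proof (cases "j = j0")
      case True
      have "(\<Oplus>i\<in>{..<m}. (c \<otimes> l i) \<otimes> V i j) = (\<Oplus>i\<in>{..<m}. c \<otimes> (l i \<otimes> a i))"
        using True c l a by (intro finsum_cong') (auto simp: V_def m_assoc Pi_iff)
      also have "\<dots> = c \<otimes> \<one>"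
        unfolding one[symmetric] using c l a by (intro finsum_rdistr[symmetric]) auto
      finally have "(\<Oplus>i\<in>{..<m}. (c \<otimes> l i) \<otimes> V i j) = c" using c by simp
      moreover have "(\<Oplus>i\<in>{..<m}. s i \<otimes> V i j) = sa" using True by (simp add: V_def sa_def)
      ultimately have "(\<Oplus>i\<in>{..<Suc m}. r i \<otimes> Y i j) = d \<otimes> p \<oplus> (sa \<oplus> d \<otimes> c)"
        using sum[OF j] True by (simp add: Y_def)
      also have "\<dots> = y j"
        using True p sa yJ[OF j] by (simp add: d_def c_def, algebra, simp add: r_neg2)
      finally show ?thesis by simp
    next
      case False
      then have jJ: "j \<in> J" using j by simp
      define S where "S = (\<Oplus>i\<in>{..<m}. (c \<otimes> l i) \<otimes> V i j)"
      have S: "S \<in> carrier R" unfolding S_def using clV[OF j] by (intro finsum_closed) auto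
      have "(\<Oplus>i\<in>{..<m}. s i \<otimes> V i j) = (\<Oplus>i\<in>{..<m}. s i \<otimes> W i j \<oplus> (s i \<otimes> a i) \<otimes> q j)"
      proof (rule finsum_cong')
        fix i assume "i \<in> {..<m}"
        then have "s i \<in> carrier R" "W i j \<in> carrier R" "a i \<in> carrier R" "q j \<in> carrier R"
          using s W a q jJ by auto
        then show "s i \<otimes> V i j = s i \<otimes> W i j \<oplus> (s i \<otimes> a i) \<otimes> q j"
          using False by (simp add: V_def r_distr m_assoc)
      qed (use s W a q jJ in \<open>auto simp: Pi_iff\<close>)
      also have "\<dots> = (\<Oplus>i\<in>{..<m}. s i \<otimes> W i j) \<oplus> (\<Oplus>i\<in>{..<m}. (s i \<otimes> a i) \<otimes> q j)"
        using s W a q jJ by (intro finsum_addf) (auto simp: Pi_iff)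
      also have "(\<Oplus>i\<in>{..<m}. (s i \<otimes> a i) \<otimes> q j) = sa \<otimes> q j"
        unfolding sa_def using s a q jJ by (intro finsum_ldistr[symmetric]) auto
      finally have "(\<Oplus>i\<in>{..<m}. s i \<otimes> V i j) = (y j \<ominus> y j0 \<otimes> q j) \<oplus> sa \<otimes> q j"
        using sW[OF jJ] by simp
      then have "(\<Oplus>i\<in>{..<Suc m}. r i \<otimes> Y i j) =
          d \<otimes> (q j \<ominus> S) \<oplus> (((y j \<ominus> y j0 \<otimes> q j) \<oplus> sa \<otimes> q j) \<oplus> d \<otimes> S)"
        using sum[OF j] False by (simp add: Y_def S_def)
      also have "\<dots> = y j"
        using S q[OF jJ] sa yJ[of j] yJ[of j0] j unfolding d_def by (simp, algebra)
      finally show ?thesis by simp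
    qed
    then show "\<exists>r\<in>{..<Suc m} \<rightarrow> carrier R.
        \<forall>j\<in>insert j0 J. y j = (\<Oplus>i\<in>{..<Suc m}. r i \<otimes> Y i j)" using r by blast
  qed
  ultimately show ?thesis using Y by (intro bexI[of _ Y]) auto
qed

text \<open>Induction on the number of columns, each of which consumes a row: the inequality
  \<open>t + card J \<le> m + 1\<close> survives the removal of one row together with one column.
  Density is assumed for all \<open>k \<ge> t\<close>, since the column treated at each stage may be
  taller than \<open>t\<close>.\<close>

proposition rows_span_perturb:
  assumes "finite J" "J \<noteq> {}" and dense: "\<And>k. t \<le> k \<Longrightarrow> unimodular_dense k"
    and "t + card J \<le> m + 1"
    and "X \<in> {..<m} \<rightarrow> J \<rightarrow> carrier R" and "\<epsilon> > 0"
  shows "\<exists>Y\<in>{..<m} \<rightarrow> J \<rightarrow> carrier R.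
    (\<forall>i<m. \<forall>j\<in>J. N (X i j \<ominus> Y i j) < \<epsilon>) \<and> rows_span J m Y"
  using assms(1,2,4-)
proof (induction J arbitrary: m X \<epsilon> rule: finite_ne_induct)
  case (singleton j)
  then show ?case using dense by (intro rows_span_perturb_single) auto
next
  case (insert j0 J)
  have "card J > 0" using insert.hyps by (simp add: card_gt_0_iff)
  then obtain m' where m: "m = Suc m'" using insert.prems insert.hyps by (cases m) auto
  have le: "t + card J \<le> m' + 1" using insert.prems insert.hyps m by simp
  then have "unimodular_dense m'" using \<open>card J > 0\<close> by (intro dense) simp
  from rows_span_perturb_insert[OF insert.hyps(1,3) this insert.IH[OF le]] insert.prems
  show ?case unfolding m by blast
qed

end

section \<open>Elementary operations on unimodular tuples\<close>

context ring
begin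

definition unimodular :: "nat \<Rightarrow> (nat \<Rightarrow> 'a) \<Rightarrow> bool" where
  "unimodular m Y \<longleftrightarrow> (\<exists>r\<in>{..<m} \<rightarrow> carrier R. (\<Oplus>i\<in>{..<m}. r i \<otimes> Y i) = \<one>)"

lemma finsum_remove_index:
  assumes "k < m" "f \<in> {..<m::nat} \<rightarrow> carrier R"
  shows "finsum R f {..<m} = f k \<oplus> finsum R f ({..<m} - {k})"
proof -
  have "insert k ({..<m} - {k}) = {..<m}" using assms by auto
  then show ?thesis
    using finsum_insert[of "{..<m} - {k}" k f] assms by (auto simp: Pi_iff)
qed

lemma unimodular_cong:
  assumes "unimodular m Y" "\<And>i. i < m \<Longrightarrow> Y i \<in> carrier R" "\<And>i. i < m \<Longrightarrow> Z i = Y i"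
  shows "unimodular m Z"
proof -
  obtain r where r: "r \<in> {..<m} \<rightarrow> carrier R" "(\<Oplus>i\<in>{..<m}. r i \<otimes> Y i) = \<one>"
    using assms(1) by (auto simp: unimodular_def)
  have "(\<Oplus>i\<in>{..<m}. r i \<otimes> Z i) = (\<Oplus>i\<in>{..<m}. r i \<otimes> Y i)"
    using r assms by (intro finsum_cong') auto
  then show ?thesis using r by (auto simp: unimodular_def)
qed

text \<open>The multipliers \<open>V \<otimes> r i\<close> produce
  \<open>V \<otimes> \<one> \<otimes> W\<close>, so a left inverse \<open>V\<close> of
  \<open>W\<close> is what this asks for.\<close>

lemma unimodular_right_mult:
  assumes "unimodular m Y" and Y: "Y \<in> {..<m} \<rightarrow> carrier R"
    and V: "V \<in> carrier R" and W: "W \<in> carrier R" and VW: "V \<otimes> W = \<one>"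
  shows "unimodular m (\<lambda>i. Y i \<otimes> W)"
proof -
  obtain r where r: "r \<in> {..<m} \<rightarrow> carrier R" and one: "(\<Oplus>i\<in>{..<m}. r i \<otimes> Y i) = \<one>"
    using assms(1) by (auto simp: unimodular_def)
  have "(\<Oplus>i\<in>{..<m}. (V \<otimes> r i) \<otimes> (Y i \<otimes> W)) = (\<Oplus>i\<in>{..<m}. V \<otimes> ((r i \<otimes> Y i) \<otimes> W))"
    using r Y V W by (intro finsum_cong') (auto simp: m_assoc Pi_iff)
  also have "\<dots> = V \<otimes> ((\<Oplus>i\<in>{..<m}. r i \<otimes> Y i) \<otimes> W)"
    using r Y V W by (simp add: finsum_rdistr finsum_ldistr Pi_iff)
  finally show ?thesis
    using one V W VW r unfolding unimodular_def
    by (intro bexI[of _ "\<lambda>i. V \<otimes> r i"]) auto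
qed

text \<open>What the multiples of \<open>Y k\<close> add in total, namely
  \<open>q \<otimes> Y k\<close>, is taken back from the multiplier of \<open>Y k\<close>.\<close>

lemma unimodular_pivot:
  assumes "unimodular m Y" and Y: "Y \<in> {..<m} \<rightarrow> carrier R"
    and k: "k < m" and \<tau>: "\<tau> \<in> {..<m} \<rightarrow> carrier R"
  shows "unimodular m (\<lambda>i. if i = k then Y k else Y i \<oplus> \<tau> i \<otimes> Y k)"
proof -
  obtain r where r: "r \<in> {..<m} \<rightarrow> carrier R" and one: "(\<Oplus>i\<in>{..<m}. r i \<otimes> Y i) = \<one>"
    using assms(1) by (auto simp: unimodular_def)
  let ?K = "{..<m} - {k}"
  let ?Z = "\<lambda>i. if i = k then Y k else Y i \<oplus> \<tau> i \<otimes> Y k"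
  define q where "q = (\<Oplus>i\<in>?K. r i \<otimes> \<tau> i)"
  define p where "p = (\<Oplus>i\<in>?K. r i \<otimes> Y i)"
  have cl: "r i \<in> carrier R" "\<tau> i \<in> carrier R" "Y i \<in> carrier R" if "i < m" for i
    using that r \<tau> Y by auto
  have q: "q \<in> carrier R" and p: "p \<in> carrier R"
    unfolding q_def p_def by (auto intro!: finsum_closed simp: cl)
  define r' where "r' i = (if i = k then r k \<ominus> q else r i)" for i
  have r': "r' \<in> {..<m} \<rightarrow> carrier R" using q by (auto simp: r'_def cl)
  have "(\<Oplus>i\<in>?K. r' i \<otimes> ?Z i) = (\<Oplus>i\<in>?K. r i \<otimes> Y i \<oplus> (r i \<otimes> \<tau> i) \<otimes> Y k)"
    using k by (intro finsum_cong') (auto simp: r'_def cl r_distr m_assoc)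
  also have "\<dots> = p \<oplus> (\<Oplus>i\<in>?K. (r i \<otimes> \<tau> i) \<otimes> Y k)"
    unfolding p_def using k by (intro finsum_addf) (auto simp: cl)
  also have "(\<Oplus>i\<in>?K. (r i \<otimes> \<tau> i) \<otimes> Y k) = q \<otimes> Y k"
    unfolding q_def using k by (intro finsum_ldistr[symmetric]) (auto simp: cl)
  finally have "(\<Oplus>i\<in>{..<m}. r' i \<otimes> ?Z i) = (r k \<ominus> q) \<otimes> Y k \<oplus> (p \<oplus> q \<otimes> Y k)"
    using k r' by (subst finsum_remove_index[OF k]) (auto simp: cl Pi_iff r'_def)
  also have "\<dots> = r k \<otimes> Y k \<oplus> p"
    using p q cl[OF k] by algebra
  also have "\<dots> = \<one>"
    unfolding p_def using k one by (subst (asm) finsum_remove_index[OF k]) (auto simp: cl)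
  finally show ?thesis using r' by (auto simp: unimodular_def)
qed

text \<open>The opposite operation: entry \<open>k\<close> receives multiples of all the others, and
  each multiplier \<open>r i\<close> gives back \<open>r k \<otimes> \<rho> i\<close>.\<close>

lemma unimodular_collect:
  assumes "unimodular m Y" and Y: "Y \<in> {..<m} \<rightarrow> carrier R"
    and k: "k < m" and \<rho>: "\<rho> \<in> {..<m} \<rightarrow> carrier R"
  shows "unimodular m (\<lambda>i. if i = k then Y k \<oplus> (\<Oplus>i\<in>{..<m} - {k}. \<rho> i \<otimes> Y i) else Y i)"
proof -
  obtain r where r: "r \<in> {..<m} \<rightarrow> carrier R" and one: "(\<Oplus>i\<in>{..<m}. r i \<otimes> Y i) = \<one>"
    using assms(1) by (auto simp: unimodular_def)
  let ?K = "{..<m} - {k}"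
  define p where "p = (\<Oplus>i\<in>?K. \<rho> i \<otimes> Y i)"
  let ?Z = "\<lambda>i. if i = k then Y k \<oplus> p else Y i"
  define q where "q = (\<Oplus>i\<in>?K. r i \<otimes> Y i)"
  have cl: "r i \<in> carrier R" "\<rho> i \<in> carrier R" "Y i \<in> carrier R" if "i < m" for i
    using that r \<rho> Y by auto
  have q: "q \<in> carrier R" and p: "p \<in> carrier R"
    unfolding q_def p_def by (auto intro!: finsum_closed simp: cl)
  define r' where "r' i = (if i = k then r k else r i \<ominus> r k \<otimes> \<rho> i)" for i
  have r': "r' \<in> {..<m} \<rightarrow> carrier R" using k by (auto simp: r'_def cl)
  have Z: "?Z \<in> {..<m} \<rightarrow> carrier R" using p k by (auto simp: cl)
  have "(\<Oplus>i\<in>?K. r' i \<otimes> ?Z i) = (\<Oplus>i\<in>?K. r i \<otimes> Y i \<ominus> r k \<otimes> (\<rho> i \<otimes> Y i))"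
  proof (rule finsum_cong')
    fix i assume i: "i \<in> ?K"
    then have "r i \<in> carrier R" "r k \<in> carrier R" "\<rho> i \<in> carrier R" "Y i \<in> carrier R"
      using k by (auto simp: cl)
    then have "(r i \<ominus> r k \<otimes> \<rho> i) \<otimes> Y i = r i \<otimes> Y i \<ominus> r k \<otimes> (\<rho> i \<otimes> Y i)" by algebra
    then show "r' i \<otimes> ?Z i = r i \<otimes> Y i \<ominus> r k \<otimes> (\<rho> i \<otimes> Y i)" using i by (simp add: r'_def)
  qed (use k in \<open>auto simp: cl\<close>)
  also have "\<dots> = q \<ominus> r k \<otimes> p"
  proof -
    have "(\<Oplus>i\<in>?K. r i \<otimes> Y i \<ominus> r k \<otimes> (\<rho> i \<otimes> Y i)) =
        (\<Oplus>i\<in>?K. r i \<otimes> Y i \<oplus> (\<ominus> r k) \<otimes> (\<rho> i \<otimes> Y i))"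
      using k by (intro finsum_cong') (auto simp: cl minus_eq l_minus)
    also have "\<dots> = q \<oplus> (\<Oplus>i\<in>?K. (\<ominus> r k) \<otimes> (\<rho> i \<otimes> Y i))"
      unfolding q_def using k by (intro finsum_addf) (auto simp: cl)
    also have "(\<Oplus>i\<in>?K. (\<ominus> r k) \<otimes> (\<rho> i \<otimes> Y i)) = (\<ominus> r k) \<otimes> p"
      unfolding p_def using k by (intro finsum_rdistr[symmetric]) (auto simp: cl)
    finally show ?thesis using k p by (simp add: cl minus_eq l_minus)
  qed
  finally have "(\<Oplus>i\<in>{..<m}. r' i \<otimes> ?Z i) = r k \<otimes> (Y k \<oplus> p) \<oplus> (q \<ominus> r k \<otimes> p)"
    using k r' Z by (subst finsum_remove_index[OF k]) (auto simp: Pi_iff r'_def)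
  also have "\<dots> = r k \<otimes> Y k \<oplus> q"
    using p q cl[OF k] by algebra
  also have "\<dots> = \<one>"
    unfolding q_def using k one by (subst (asm) finsum_remove_index[OF k]) (auto simp: cl)
  finally have "unimodular m ?Z" using r' by (auto simp: unimodular_def)
  then show ?thesis unfolding p_def .
qed

end

section \<open>Star algebras, left ideals and stable rank\<close>

text \<open>The records of algebras carry no unit, so the one of the ring is a parameter. For
  statements about addition alone any \<open>e\<close> will do, such as zero below.\<close>

definition alg_ring :: "('a, 'm) normed_star_alg_scheme \<Rightarrow> 'a \<Rightarrow> 'a ring" where
  "alg_ring A e =
    \<lparr>carrier = carrier A, mult = alg_mult A, one = e, zero = alg_zero A, add = alg_add A\<rparr>"

lemma alg_ring_simps [simp]:
  "carrier (alg_ring A e) = carrier A" "mult (alg_ring A e) = alg_mult A"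
  "one (alg_ring A e) = e" "zero (alg_ring A e) = alg_zero A" "add (alg_ring A e) = alg_add A"
  by (simp_all add: alg_ring_def)

lemma add_group_simps [simp]:
  "carrier (add_group A) = carrier A" "mult (add_group A) = alg_add A"
  "one (add_group A) = alg_zero A"
  by (simp_all add: add_group_def)

lemma add_monoid_alg_ring: "add_monoid (alg_ring A e) = add_group A"
  by (simp add: add_group_def)

lemma finsum_alg_ring [simp]: "finsum (alg_ring A e) = alg_sum A"
  by (intro ext) (simp only: finsum_def alg_sum_def add_monoid_alg_ring)

sublocale star_algebra \<subseteq> ab: abelian_group "alg_ring A (alg_zero A)"
  rewrites "carrier (alg_ring A (alg_zero A)) = carrier A"
    and "add (alg_ring A (alg_zero A)) = alg_add A"
    and "zero (alg_ring A (alg_zero A)) = alg_zero A"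
    and "finsum (alg_ring A (alg_zero A)) = alg_sum A"
proof -
  show "abelian_group (alg_ring A (alg_zero A))"
    using add_comm_group by (intro comm_group_abelian_groupI) (simp only: add_monoid_alg_ring)
qed simp_all

context star_algebra
begin

lemma zero_closed: "alg_zero A \<in> carrier A"
  and add_closed: "\<lbrakk>x \<in> carrier A; y \<in> carrier A\<rbrakk> \<Longrightarrow> x \<boxplus> y \<in> carrier A"
  by auto

lemma sum_closed: "f \<in> I \<rightarrow> carrier A \<Longrightarrow> alg_sum A f I \<in> carrier A"
  by (rule ab.finsum_closed)

lemma add_right_eq_self: "\<lbrakk>x \<in> carrier A; y \<in> carrier A; x \<boxplus> y = x\<rbrakk> \<Longrightarrow> y = alg_zero A"
  by simp

lemma scale_zero_left: "x \<in> carrier A \<Longrightarrow> 0 \<odot> x = alg_zero A"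
  using scale_add_left[of x 0 0] scale_closed by (intro add_right_eq_self[of "0 \<odot> x"]) auto

lemma scale_zero_right: "c \<odot> alg_zero A = alg_zero A"
  using scale_add_right[of "alg_zero A" "alg_zero A" c] scale_closed
  by (intro add_right_eq_self[of "c \<odot> alg_zero A"]) auto

lemma mult_zero_left: "x \<in> carrier A \<Longrightarrow> alg_zero A \<boxtimes> x = alg_zero A"
  using mult_add_left[of "alg_zero A" "alg_zero A" x] mult_closed
  by (intro add_right_eq_self[of "alg_zero A \<boxtimes> x"]) auto

lemma mult_zero_right: "x \<in> carrier A \<Longrightarrow> x \<boxtimes> alg_zero A = alg_zero A"
  using mult_add_right[of x "alg_zero A" "alg_zero A"] mult_closed
  by (intro add_right_eq_self[of "x \<boxtimes> alg_zero A"]) auto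

lemma add_neg: "x \<in> carrier A \<Longrightarrow> x \<boxplus> (-1) \<odot> x = alg_zero A"
  using scale_add_left[of x 1 "-1"] by (simp add: scale_one scale_zero_left)

lemma neg_add: "x \<in> carrier A \<Longrightarrow> (-1) \<odot> x \<boxplus> x = alg_zero A"
  using add_neg scale_closed by (simp add: ab.a_comm)

lemma a_inv_eq: "x \<in> carrier A \<Longrightarrow> a_inv (alg_ring A e) x = (-1) \<odot> x"
proof -
  assume x: "x \<in> carrier A"
  have "a_inv (alg_ring A e) x = a_inv (alg_ring A (alg_zero A)) x"
    by (simp only: a_inv_def add_monoid_alg_ring)
  also have "\<dots> = (-1) \<odot> x"
    using x scale_closed neg_add by (intro ab.minus_equality) auto
  finally show ?thesis .
qed

lemma a_minus_eq: "y \<in> carrier A \<Longrightarrow> x \<ominus>\<^bsub>alg_ring A e\<^esub> y = x \<boxplus> (-1) \<odot> y"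
  by (simp add: a_minus_def a_inv_eq)

lemma sum_insert:
  "\<lbrakk>finite I; i \<notin> I; f \<in> insert i I \<rightarrow> carrier A\<rbrakk> \<Longrightarrow>
    alg_sum A f (insert i I) = f i \<boxplus> alg_sum A f I"
  by (intro ab.finsum_insert) auto

lemma alg_ring_ring:
  assumes "e \<in> carrier A" "\<And>x. x \<in> carrier A \<Longrightarrow> e \<boxtimes> x = x \<and> x \<boxtimes> e = x"
  shows "ring (alg_ring A e)"
proof (rule ringI)
  show "abelian_group (alg_ring A e)"
    using add_comm_group by (intro comm_group_abelian_groupI) (simp only: add_monoid_alg_ring)
  show "Group.monoid (alg_ring A e)"
    using assms by unfold_locales (auto simp: mult_closed mult_assoc)
qed (auto simp: mult_add_left mult_add_right)

end

text \<open>In a unital ring the combinations of the \<open>b i\<close> form a left ideal that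
  contains every \<open>b i\<close>. The hull lies in it, so the unit is a combination.\<close>

lemma left_generating_tuple_unimodular:
  assumes "ring (alg_ring L e)" and b: "b \<in> left_generating_tuples L m"
  shows "\<exists>l\<in>{..<m} \<rightarrow> carrier L. alg_sum L (\<lambda>i. alg_mult L (l i) (b i)) {..<m} = e"
proof -
  interpret ring "alg_ring L e" by fact
  let ?R = "alg_ring L e"
  have b_closed: "b i \<in> carrier L" if "i < m" for i
    using b that by (auto simp: left_generating_tuples_def PiE_iff)
  define comb where "comb l = (\<Oplus>\<^bsub>?R\<^esub>i\<in>{..<m}. l i \<otimes>\<^bsub>?R\<^esub> b i)" for l
  define I where "I = comb ` ({..<m} \<rightarrow> carrier L)"
  have comb_closed: "comb l \<in> carrier L" if "l \<in> {..<m} \<rightarrow> carrier L" for l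
    using that b_closed m_closed finsum_closed[of "\<lambda>i. l i \<otimes>\<^bsub>?R\<^esub> b i" "{..<m}"]
    by (auto simp: comb_def Pi_iff)
  have comb_add: "comb l \<oplus>\<^bsub>?R\<^esub> comb k = comb (\<lambda>i. l i \<oplus>\<^bsub>?R\<^esub> k i)"
    if "l \<in> {..<m} \<rightarrow> carrier L" "k \<in> {..<m} \<rightarrow> carrier L" for l k
  proof -
    have "comb (\<lambda>i. l i \<oplus>\<^bsub>?R\<^esub> k i) = (\<Oplus>\<^bsub>?R\<^esub>i\<in>{..<m}. l i \<otimes>\<^bsub>?R\<^esub> b i \<oplus>\<^bsub>?R\<^esub> k i \<otimes>\<^bsub>?R\<^esub> b i)"
      unfolding comb_def using that b_closed a_closed m_closed
      by (intro finsum_cong') (auto simp: l_distr Pi_iff simp del: alg_ring_simps(2,5) finsum_alg_ring)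
    also have "\<dots> = comb l \<oplus>\<^bsub>?R\<^esub> comb k"
      unfolding comb_def using that b_closed m_closed
      by (intro finsum_addf) (auto simp: Pi_iff simp del: alg_ring_simps(2,5) finsum_alg_ring)
    finally show ?thesis by simp
  qed
  have comb_mult: "x \<otimes>\<^bsub>?R\<^esub> comb l = comb (\<lambda>i. x \<otimes>\<^bsub>?R\<^esub> l i)"
    if "l \<in> {..<m} \<rightarrow> carrier L" "x \<in> carrier L" for l x
  proof -
    have "x \<otimes>\<^bsub>?R\<^esub> comb l = (\<Oplus>\<^bsub>?R\<^esub>i\<in>{..<m}. x \<otimes>\<^bsub>?R\<^esub> (l i \<otimes>\<^bsub>?R\<^esub> b i))"
      unfolding comb_def using that b_closed m_closed
      by (intro finsum_rdistr) (auto simp: Pi_iff simp del: alg_ring_simps(2,5) finsum_alg_ring)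
    also have "\<dots> = comb (\<lambda>i. x \<otimes>\<^bsub>?R\<^esub> l i)"
      unfolding comb_def using that b_closed m_closed
      by (intro finsum_cong') (auto simp: m_assoc Pi_iff simp del: alg_ring_simps(2,5) finsum_alg_ring)
    finally show ?thesis .
  qed
  have mult_I: "x \<otimes>\<^bsub>?R\<^esub> y \<in> I" if "x \<in> carrier L" "y \<in> I" for x y
  proof -
    from that obtain l where l: "l \<in> {..<m} \<rightarrow> carrier L" "y = comb l" by (auto simp: I_def)
    have "(\<lambda>i. x \<otimes>\<^bsub>?R\<^esub> l i) \<in> {..<m} \<rightarrow> carrier L"
      using l that m_closed by (auto simp: Pi_iff)
    then show ?thesis unfolding I_def l(2) comb_mult[OF l(1) that(1)] by (rule imageI)
  qed
  have add_I: "x \<oplus>\<^bsub>?R\<^esub> y \<in> I" if "x \<in> I" "y \<in> I" for x y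
  proof -
    from that obtain l k where l: "l \<in> {..<m} \<rightarrow> carrier L" "x = comb l"
      and k: "k \<in> {..<m} \<rightarrow> carrier L" "y = comb k" by (auto simp: I_def)
    have "(\<lambda>i. l i \<oplus>\<^bsub>?R\<^esub> k i) \<in> {..<m} \<rightarrow> carrier L"
      using l k a_closed by (auto simp: Pi_iff)
    then show ?thesis unfolding I_def l(2) k(2) comb_add[OF l(1) k(1)] by (rule imageI)
  qed
  have sub: "I \<subseteq> carrier L" using comb_closed by (auto simp: I_def)
  have b_I: "b i \<in> I" if "i < m" for i
  proof -
    let ?l = "\<lambda>j. if j = i then \<one>\<^bsub>?R\<^esub> else \<zero>\<^bsub>?R\<^esub>"
    have "comb ?l = (\<Oplus>\<^bsub>?R\<^esub>j\<in>{..<m}. if i = j then b j else \<zero>\<^bsub>?R\<^esub>)"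
      unfolding comb_def using b_closed that zero_closed one_closed m_closed l_one l_null
      by (intro finsum_cong') (auto simp: Pi_iff)
    also have "\<dots> = b i" using b_closed that by (intro finsum_singleton) auto
    finally have "comb ?l = b i" .
    moreover have "?l \<in> {..<m} \<rightarrow> carrier L" using zero_closed one_closed by auto
    ultimately show ?thesis unfolding I_def by (metis imageI)
  qed
  have "comb (\<lambda>_. \<zero>\<^bsub>?R\<^esub>) \<in> I" unfolding I_def using zero_closed by (intro imageI) auto
  moreover have "a_inv ?R y \<in> I" if "y \<in> I" for y
  proof -
    have "a_inv ?R y = a_inv ?R \<one>\<^bsub>?R\<^esub> \<otimes>\<^bsub>?R\<^esub> y"
      using that sub l_minus[of "\<one>\<^bsub>?R\<^esub>" y] l_one one_closed by auto
    then show ?thesis using mult_I that a_inv_closed[of "\<one>\<^bsub>?R\<^esub>"] one_closed by auto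
  qed
  ultimately have "subgroup I (add_monoid ?R)"
    using sub add_I by (intro add.subgroupI) auto
  then have "left_ideal L I"
    using mult_I unfolding left_ideal_def add_monoid_alg_ring by simp
  moreover have "b ` {..<m} \<subseteq> I" using b_I by auto
  ultimately have "carrier L \<subseteq> I"
    using b unfolding left_generating_tuples_def hull_def by blast
  then have "\<one>\<^bsub>?R\<^esub> \<in> I" using one_closed by auto
  then show ?thesis by (auto simp: I_def comb_def)
qed

text \<open>A tuple longer than \<open>t\<close> is changed in its first \<open>t\<close> entries
  only, and the others get multiplier zero. The constant \<open>K\<close> compares the seminorm of a
  ring difference with \<open>alg_dist\<close>, which is built from scaling by -1.\<close>

lemma unimodular_dense_if_dense_tuples:
  assumes "submult_normed_ring (alg_ring L e) N"
    and dense: "dense_tuples L t (left_generating_tuples L t)" and "t \<le> m"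
    and K: "K > 0" and le: "\<And>x y. \<lbrakk>x \<in> carrier L; y \<in> carrier L\<rbrakk> \<Longrightarrow>
      N (x \<ominus>\<^bsub>alg_ring L e\<^esub> y) \<le> K * alg_dist L x y"
  shows "submult_normed_ring.unimodular_dense (alg_ring L e) N m"
proof -
  interpret submult_normed_ring "alg_ring L e" N by fact
  let ?R = "alg_ring L e"
  show ?thesis
    unfolding unimodular_dense_def
  proof (intro ballI allI impI)
    fix a and \<epsilon> :: real assume a: "a \<in> {..<m} \<rightarrow> carrier ?R" and "\<epsilon> > 0"
    have "restrict a {..<t} \<in> {..<t} \<rightarrow>\<^sub>E carrier L" "\<epsilon> / K > 0"
      using a \<open>t \<le> m\<close> \<open>\<epsilon> > 0\<close> K by auto
    with dense obtain b where b: "b \<in> left_generating_tuples L t"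
      and close: "\<And>i. i < t \<Longrightarrow> alg_dist L (restrict a {..<t} i) (b i) < \<epsilon> / K"
      unfolding dense_tuples_def by blast
    from left_generating_tuple_unimodular[OF ring_axioms b]
    obtain l where l: "l \<in> {..<t} \<rightarrow> carrier L"
      and one: "(\<Oplus>\<^bsub>?R\<^esub>i\<in>{..<t}. l i \<otimes>\<^bsub>?R\<^esub> b i) = e"
      by auto
    have b_closed: "b i \<in> carrier L" if "i < t" for i
      using b that by (auto simp: left_generating_tuples_def PiE_iff)
    define b' where "b' i = (if i < t then b i else a i)" for i
    define l' where "l' i = (if i < t then l i else \<zero>\<^bsub>?R\<^esub>)" for i
    have b': "b' \<in> {..<m} \<rightarrow> carrier ?R" and l': "l' \<in> {..<m} \<rightarrow> carrier ?R"
      using a b_closed l zero_closed by (auto simp: b'_def l'_def Pi_iff)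
    have "N (a i \<ominus>\<^bsub>?R\<^esub> b' i) < \<epsilon>" if "i < m" for i
    proof (cases "i < t")
      case True
      then have "a i \<in> carrier L" using a \<open>i < m\<close> by auto
      then have "N (a i \<ominus>\<^bsub>?R\<^esub> b i) \<le> K * alg_dist L (a i) (b i)"
        using True b_closed by (intro le) auto
      also have "\<dots> < \<epsilon>" using close[of i] True K by (simp add: field_simps)
      finally show ?thesis using True by (simp add: b'_def)
    next
      case False
      then show ?thesis using a \<open>i < m\<close> \<open>\<epsilon> > 0\<close> r_neg N_zero
        by (auto simp: b'_def a_minus_def Pi_iff)
    qed
    moreover have "(\<Oplus>\<^bsub>?R\<^esub>i\<in>{..<m}. l' i \<otimes>\<^bsub>?R\<^esub> b' i) = (\<Oplus>\<^bsub>?R\<^esub>i\<in>{..<t}. l i \<otimes>\<^bsub>?R\<^esub> b i)"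
      using \<open>t \<le> m\<close> l b_closed a m_closed l_null zero_closed
      by (intro add.finprod_mono_neutral_cong_right) (auto simp: l'_def b'_def Pi_iff)
    ultimately show "\<exists>b\<in>{..<m} \<rightarrow> carrier ?R. \<exists>l\<in>{..<m} \<rightarrow> carrier ?R.
        (\<forall>i<m. N (a i \<ominus>\<^bsub>?R\<^esub> b i) < \<epsilon>) \<and> (\<Oplus>\<^bsub>?R\<^esub>i\<in>{..<m}. l i \<otimes>\<^bsub>?R\<^esub> b i) = \<one>\<^bsub>?R\<^esub>"
      using b' l' one by (intro bexI[of _ b'] bexI[of _ l']) auto
  qed
qed

text \<open>The whole carrier is a left ideal, so the hull stays inside it. The hypotheses are kept
  to addition and closure so that the rule applies to the unitization of the crossed product, of
  which just that is shown.\<close>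

lemma left_generating_tuplesI:
  assumes "abelian_group (alg_ring L e)"
    and mult: "\<And>x y. \<lbrakk>x \<in> carrier L; y \<in> carrier L\<rbrakk> \<Longrightarrow> alg_mult L x y \<in> carrier L"
    and z: "z \<in> {..<m} \<rightarrow>\<^sub>E carrier L"
    and gen: "\<And>I. \<lbrakk>left_ideal L I; \<And>i. i < m \<Longrightarrow> z i \<in> I\<rbrakk> \<Longrightarrow> carrier L \<subseteq> I"
  shows "z \<in> left_generating_tuples L m"
proof -
  interpret abelian_group "alg_ring L e" by fact
  have "left_ideal L (carrier L)"
    using mult add.subgroup_self unfolding left_ideal_def add_monoid_alg_ring by simp
  then have "left_ideal L hull (z ` {..<m}) \<subseteq> carrier L"
    using z unfolding hull_def by (intro Inter_lower) auto
  moreover have "carrier L \<subseteq> left_ideal L hull (z ` {..<m})"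
    unfolding hull_def using gen by (intro Inter_greatest) (auto simp: image_subset_iff)
  ultimately show ?thesis using z by (simp add: left_generating_tuples_def)
qed

lemma left_idealD:
  assumes "left_ideal L I"
  shows "I \<subseteq> carrier L" "alg_zero L \<in> I" "\<lbrakk>x \<in> I; y \<in> I\<rbrakk> \<Longrightarrow> alg_add L x y \<in> I"
    "\<lbrakk>a \<in> carrier L; x \<in> I\<rbrakk> \<Longrightarrow> alg_mult L a x \<in> I"
  using assms subgroup.subset[of I "add_group L"] subgroup.one_closed[of I "add_group L"]
    subgroup.m_closed[of I "add_group L" x y]
  by (auto simp: left_ideal_def)

lemma left_ideal_sum:
  assumes "abelian_group (alg_ring L e)" and I: "left_ideal L I" and "finite S" "f \<in> S \<rightarrow> I"
  shows "alg_sum L f S \<in> I"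
proof -
  interpret abelian_group "alg_ring L e" by fact
  have fin: "alg_sum L = finsum (alg_ring L e)" by simp
  show ?thesis
    using assms(3,4)
  proof (induction S rule: finite_induct)
    case empty
    then show ?case unfolding fin using left_idealD(2)[OF I] finsum_empty[of f] by simp
  next
    case (insert i S)
    have "f \<in> S \<rightarrow> carrier L" "f i \<in> carrier L"
      using insert.prems left_idealD(1)[OF I] by auto
    then have "alg_sum L f (insert i S) = alg_add L (f i) (alg_sum L f S)"
      unfolding fin using insert.hyps finsum_insert[of S i f] by simp
    then show ?case using insert left_idealD(3)[OF I] by auto
  qed
qed

text \<open>Any left ideal that contains the entries contains the unit as their combination, hence
  everything.\<close>

lemma left_generating_tuple_if_unimodular:
  assumes "ring (alg_ring L e)" and z: "z \<in> {..<m} \<rightarrow>\<^sub>E carrier L"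
    and "ring.unimodular (alg_ring L e) m z"
  shows "z \<in> left_generating_tuples L m"
proof -
  interpret ring "alg_ring L e" by fact
  obtain r where r: "r \<in> {..<m} \<rightarrow> carrier L"
    and one: "(\<Oplus>\<^bsub>alg_ring L e\<^esub>i\<in>{..<m}. r i \<otimes>\<^bsub>alg_ring L e\<^esub> z i) = \<one>\<^bsub>alg_ring L e\<^esub>"
    using assms(3) by (auto simp: unimodular_def)
  have zc: "z i \<in> carrier L" if "i < m" for i using z that by auto
  show ?thesis
  proof (rule left_generating_tuplesI[OF is_abelian_group _ z])
    show "alg_mult L x y \<in> carrier L" if "x \<in> carrier L" "y \<in> carrier L" for x y
      using m_closed[of x y] that by simp
    fix I assume I: "left_ideal L I" and zI: "\<And>i. i < m \<Longrightarrow> z i \<in> I"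
    have "alg_sum L (\<lambda>i. alg_mult L (r i) (z i)) {..<m} \<in> I"
      using r zI left_idealD(4)[OF I] by (intro left_ideal_sum[OF is_abelian_group I]) auto
    then have e: "e \<in> I" using one by simp
    show "carrier L \<subseteq> I"
    proof
      fix x assume "x \<in> carrier L"
      then show "x \<in> I" using left_idealD(4)[OF I _ e, of x] r_one[of x] by simp
    qed
  qed
qed

lemma tsr_unital_le:
  "\<lbrakk>1 \<le> m; dense_tuples L m (left_generating_tuples L m)\<rbrakk> \<Longrightarrow> tsr_unital L \<le> enat m"
  unfolding tsr_unital_def by (rule INF_lower) simp

text \<open>The infimum of a nonempty set of extended naturals is a minimum by well-ordering, and
  that of the empty set would be infinite.\<close>

lemma tsr_unital_attained:
  assumes "tsr_unital L = enat t"
  shows "1 \<le> t" "dense_tuples L t (left_generating_tuples L t)"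
proof -
  let ?S = "enat ` {n. 1 \<le> n \<and> dense_tuples L n (left_generating_tuples L n)}"
  have "?S \<noteq> {}"
    using assms unfolding tsr_unital_def by (metis enat.distinct(1) Inf_enat_def)
  then have "Inf ?S \<in> ?S" by (meson ex_in_conv wellorder_InfI)
  then have "enat t \<in> ?S" using assms by (simp add: tsr_unital_def)
  then show "1 \<le> t" "dense_tuples L t (left_generating_tuples L t)" by auto
qed

section \<open>The norm of the unitization\<close>

context cstar_algebra
begin

lemma norm_nonneg: "x \<in> carrier A \<Longrightarrow> 0 \<le> alg_norm A x"
  and norm_triangle:
    "\<lbrakk>x \<in> carrier A; y \<in> carrier A\<rbrakk> \<Longrightarrow> alg_norm A (x \<boxplus> y) \<le> alg_norm A x + alg_norm A y"
  and norm_scale: "x \<in> carrier A \<Longrightarrow> alg_norm A (c \<odot> x) = cmod c * alg_norm A x"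
  and norm_mult:
    "\<lbrakk>x \<in> carrier A; y \<in> carrier A\<rbrakk> \<Longrightarrow> alg_norm A (x \<boxtimes> y) \<le> alg_norm A x * alg_norm A y"
  and norm_star: "x \<in> carrier A \<Longrightarrow> alg_norm A (alg_adj A x \<boxtimes> x) = (alg_norm A x)\<^sup>2"
  using norm_cstar by (auto simp: cstar_seminorm_def)

lemma norm_zero: "alg_norm A (alg_zero A) = 0"
  using norm_scale[of "alg_zero A" 0] by (simp add: scale_zero_right)

lemma norm_sum:
  "\<lbrakk>finite I; f \<in> I \<rightarrow> carrier A\<rbrakk> \<Longrightarrow> alg_norm A (alg_sum A f I) \<le> (\<Sum>i\<in>I. alg_norm A (f i))"
proof (induction I rule: finite_induct)
  case (insert i I)
  then have "alg_norm A (f i \<boxplus> alg_sum A f I) \<le> alg_norm A (f i) + alg_norm A (alg_sum A f I)"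
    by (intro norm_triangle sum_closed) auto
  with insert show ?case by (simp add: sum_insert Pi_iff)
qed (simp add: norm_zero)

text \<open>The C*-identity and submultiplicativity bound the square of the norm of \<open>x\<close>
  by the norm of its adjoint times the norm of \<open>x\<close>. The other inequality is the same
  one for the adjoint.\<close>

lemma norm_adj: "x \<in> carrier A \<Longrightarrow> alg_norm A (alg_adj A x) = alg_norm A x"
proof -
  have le: "alg_norm A x \<le> alg_norm A (alg_adj A x)" if x: "x \<in> carrier A" for x
  proof (cases "alg_norm A x = 0")
    case False
    then have pos: "alg_norm A x > 0" using norm_nonneg[OF x] by simp
    have "(alg_norm A x)\<^sup>2 \<le> alg_norm A (alg_adj A x) * alg_norm A x"
      using norm_mult[of "alg_adj A x" x] x adj_closed by (simp add: norm_star)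
    with pos show ?thesis by (simp add: power2_eq_square)
  qed (use x norm_nonneg adj_closed in simp)
  assume x: "x \<in> carrier A"
  then show ?thesis using le[of x] le[of "alg_adj A x"] adj_closed by (simp add: adj_adj)
qed

lemma submult_normed_ring_unit:
  assumes "e \<in> carrier A" "\<And>x. x \<in> carrier A \<Longrightarrow> e \<boxtimes> x = x \<and> x \<boxtimes> e = x"
  shows "submult_normed_ring (alg_ring A e) (alg_norm A)"
proof -
  interpret ring "alg_ring A e" using assms by (rule alg_ring_ring)
  show ?thesis
    by unfold_locales
      (auto simp: norm_nonneg norm_zero a_inv_eq norm_scale intro: norm_triangle norm_mult)
qed

end

lemma unitization_simps [simp]:
  "carrier (unitization A) = carrier A \<times> UNIV"
  "alg_add (unitization A) (a, c) (b, d) = (alg_add A a b, c + d)"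
  "alg_zero (unitization A) = (alg_zero A, 0)"
  "alg_mult (unitization A) (a, c) (b, d) =
    (alg_add A (alg_mult A a b) (alg_add A (alg_scale A c b) (alg_scale A d a)), c * d)"
  "alg_scale (unitization A) z (a, c) = (alg_scale A z a, z * c)"
  by (simp_all add: unitization_def)

lemma unitization_norm: "alg_norm (unitization A) (a, c) =
  (SUP x\<in>{x \<in> carrier A. alg_norm A x \<le> 1}.
    alg_norm A (alg_add A (alg_mult A a x) (alg_scale A c x)))"
  by (simp add: unitization_def)

lemma unitization_proj [simp]:
  "fst (alg_add (unitization A) x y) = alg_add A (fst x) (fst y)"
  "snd (alg_add (unitization A) x y) = snd x + snd y"
  "fst (alg_mult (unitization A) x y) =
    alg_add A (alg_mult A (fst x) (fst y)) (alg_add A (alg_scale A (snd x) (fst y)) (alg_scale A (snd y) (fst x)))"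
  "snd (alg_mult (unitization A) x y) = snd x * snd y"
  by (simp_all add: unitization_def case_prod_beta)

text \<open>\<^const>\<open>unitization\<close> takes no record extensions, which fixes the type of \<open>A\<close>.\<close>

locale plain_cstar_algebra = cstar_algebra A for A :: "'a normed_star_alg" (structure)
begin

abbreviation "NU \<equiv> alg_norm (unitization A)"

lemma unitization_ring: "ring (alg_ring (unitization A) (alg_zero A, 1))"
proof (rule ringI)
  show "abelian_group (alg_ring (unitization A) (alg_zero A, 1))"
  proof (rule abelian_groupI)
    fix x assume "x \<in> carrier (alg_ring (unitization A) (alg_zero A, 1))"
    then show "\<exists>y\<in>carrier (alg_ring (unitization A) (alg_zero A, 1)).
        y \<oplus>\<^bsub>alg_ring (unitization A) (alg_zero A, 1)\<^esub> x = \<zero>\<^bsub>alg_ring (unitization A) (alg_zero A, 1)\<^esub>"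
      by (intro bexI[of _ "((-1) \<odot> fst x, - snd x)"]) (auto simp: neg_add scale_closed)
  qed (auto simp: ab.a_ac)
  show "Group.monoid (alg_ring (unitization A) (alg_zero A, 1))"
    by unfold_locales
      (auto simp: mult_add_left mult_add_right scale_add_right mult_scale_left mult_scale_right
        scale_scale mult_assoc mult_closed scale_closed ab.a_ac mult_zero_left mult_zero_right
        scale_zero_left scale_zero_right scale_one mult_ac)
qed (auto simp: mult_add_left mult_add_right scale_add_right scale_add_left mult_closed
    scale_closed ab.a_ac ring_distribs)

lemma unitization_a_inv:
  assumes "x \<in> carrier (unitization A)"
  shows "a_inv (alg_ring (unitization A) (alg_zero A, 1)) x = alg_scale (unitization A) (-1) x"
proof -
  interpret ring "alg_ring (unitization A) (alg_zero A, 1)" by (rule unitization_ring)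
  show ?thesis
    using assms by (intro minus_equality) (auto simp: neg_add scale_closed)
qed

lemma unitization_a_minus:
  "y \<in> carrier (unitization A) \<Longrightarrow> x \<ominus>\<^bsub>alg_ring (unitization A) (alg_zero A, 1)\<^esub> y =
    alg_add (unitization A) x (alg_scale (unitization A) (-1) y)"
  unfolding a_minus_def by (simp only: unitization_a_inv alg_ring_simps)

lemma unitization_norm_bdd:
  assumes "a \<in> carrier A"
  shows "bdd_above ((\<lambda>x. alg_norm A (a \<boxtimes> x \<boxplus> c \<odot> x)) ` {x \<in> carrier A. alg_norm A x \<le> 1})"
    and "NU (a, c) \<le> alg_norm A a + cmod c"
proof -
  have le: "alg_norm A (a \<boxtimes> x \<boxplus> c \<odot> x) \<le> alg_norm A a + cmod c"
    if x: "x \<in> carrier A" "alg_norm A x \<le> 1" for x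
  proof -
    have "alg_norm A (a \<boxtimes> x \<boxplus> c \<odot> x) \<le> alg_norm A a * alg_norm A x + cmod c * alg_norm A x"
      using norm_triangle[of "a \<boxtimes> x" "c \<odot> x"] norm_mult[of a x] norm_scale[of x c] assms x
      by (simp add: mult_closed scale_closed)
    also have "\<dots> \<le> alg_norm A a * 1 + cmod c * 1"
      using x assms norm_nonneg by (intro add_mono mult_left_mono) auto
    finally show ?thesis by simp
  qed
  then show "bdd_above ((\<lambda>x. alg_norm A (a \<boxtimes> x \<boxplus> c \<odot> x)) ` {x \<in> carrier A. alg_norm A x \<le> 1})"
    by (intro bdd_aboveI2) auto
  have "alg_zero A \<in> {x \<in> carrier A. alg_norm A x \<le> 1}" by (simp add: norm_zero)
  then show "NU (a, c) \<le> alg_norm A a + cmod c"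
    unfolding unitization_norm using le by (intro cSUP_least) auto
qed

lemma unitization_norm_upper:
  "\<lbrakk>a \<in> carrier A; x \<in> carrier A; alg_norm A x \<le> 1\<rbrakk> \<Longrightarrow>
    alg_norm A (a \<boxtimes> x \<boxplus> c \<odot> x) \<le> NU (a, c)"
  unfolding unitization_norm using unitization_norm_bdd(1) by (intro cSUP_upper) auto

text \<open>The supremum runs over the unit ball, so \<open>x\<close> is divided by its norm. An
  element of norm zero is zero by definiteness of the norm of A.\<close>

lemma unitization_norm_ge:
  assumes a: "a \<in> carrier A" and x: "x \<in> carrier A"
  shows "alg_norm A (a \<boxtimes> x \<boxplus> c \<odot> x) \<le> NU (a, c) * alg_norm A x"
proof (cases "alg_norm A x = 0")
  case True
  then have "x = alg_zero A" using norm_eq_zero x by blast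
  then show ?thesis using a by (simp add: mult_zero_right scale_zero_right norm_zero)
next
  case False
  define n where "n = alg_norm A x"
  have n: "n > 0" using False norm_nonneg[OF x] by (simp add: n_def)
  define y where "y = complex_of_real (1 / n) \<odot> x"
  have y: "y \<in> carrier A" using x by (simp add: y_def scale_closed)
  have "alg_norm A y = 1" using n x by (simp add: y_def norm_scale n_def[symmetric] norm_divide)
  then have "alg_norm A (a \<boxtimes> y \<boxplus> c \<odot> y) \<le> NU (a, c)"
    using a y by (intro unitization_norm_upper) auto
  moreover have "a \<boxtimes> y \<boxplus> c \<odot> y = complex_of_real (1 / n) \<odot> (a \<boxtimes> x \<boxplus> c \<odot> x)"
    using a x by (simp add: y_def mult_scale_right scale_add_right scale_scale scale_closed
        mult_closed mult_ac)
  ultimately have "alg_norm A (a \<boxtimes> x \<boxplus> c \<odot> x) / n \<le> NU (a, c)"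
    using n a x by (simp add: norm_scale scale_closed mult_closed norm_divide)
  then show ?thesis using n by (simp add: n_def[symmetric] field_simps)
qed

lemma unitization_norm_le:
  assumes "a \<in> carrier A"
    and "\<And>x. \<lbrakk>x \<in> carrier A; alg_norm A x \<le> 1\<rbrakk> \<Longrightarrow> alg_norm A (a \<boxtimes> x \<boxplus> c \<odot> x) \<le> S"
  shows "NU (a, c) \<le> S"
proof -
  have "alg_zero A \<in> {x \<in> carrier A. alg_norm A x \<le> 1}" by (simp add: norm_zero)
  then show ?thesis unfolding unitization_norm using assms(2) by (intro cSUP_least) auto
qed

lemma unitization_norm_nonneg:
  assumes a: "a \<in> carrier A"
  shows "0 \<le> NU (a, c)"
proof -
  have "alg_norm A (a \<boxtimes> alg_zero A \<boxplus> c \<odot> alg_zero A) \<le> NU (a, c)"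
    using a by (intro unitization_norm_upper) (auto simp: norm_zero)
  then show ?thesis using a by (simp add: mult_zero_right scale_zero_right norm_zero)
qed

text \<open>One inequality for all scalars carries the other, by scaling back; negation is treated
  in this way in the next lemma.\<close>

lemma unitization_norm_scale:
  assumes a: "a \<in> carrier A"
  shows "NU (d \<odot> a, d * c) \<le> cmod d * NU (a, c)"
proof (rule unitization_norm_le)
  fix x assume x: "x \<in> carrier A" "alg_norm A x \<le> 1"
  have "(d \<odot> a) \<boxtimes> x \<boxplus> (d * c) \<odot> x = d \<odot> (a \<boxtimes> x \<boxplus> c \<odot> x)"
    using a x by (simp add: mult_scale_left scale_add_right scale_scale mult_closed scale_closed)
  then have "alg_norm A ((d \<odot> a) \<boxtimes> x \<boxplus> (d * c) \<odot> x) = cmod d * alg_norm A (a \<boxtimes> x \<boxplus> c \<odot> x)"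
    using a x by (simp add: norm_scale mult_closed scale_closed)
  also have "\<dots> \<le> cmod d * NU (a, c)"
    using a x by (intro mult_left_mono unitization_norm_upper) auto
  finally show "alg_norm A ((d \<odot> a) \<boxtimes> x \<boxplus> (d * c) \<odot> x) \<le>
    cmod d * NU (a, c)" .
qed (use a in \<open>simp add: scale_closed\<close>)

text \<open>The pair \<open>(a, c)\<close> acts on A as left multiplication by \<open>a\<close> plus
  \<open>c\<close> times the identity. Sums and products of pairs act as sums and compositions of
  these maps, so the bounds are those of operator norms.\<close>

lemma unitization_normed_ring:
  "submult_normed_ring (alg_ring (unitization A) (alg_zero A, 1)) (NU)"
proof -
  let ?U = "alg_ring (unitization A) (alg_zero A, 1)" and ?N = NU
  interpret ring ?U by (rule unitization_ring)
  show ?thesis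
  proof unfold_locales
    fix x y assume "x \<in> carrier ?U" "y \<in> carrier ?U"
    then obtain a c b d where xy: "x = (a, c)" "y = (b, d)" and a: "a \<in> carrier A"
      and b: "b \<in> carrier A" by auto
    have "?N (a \<boxplus> b, c + d) \<le> ?N (a, c) + ?N (b, d)"
    proof (rule unitization_norm_le)
      fix z assume z: "z \<in> carrier A" "alg_norm A z \<le> 1"
      have "(a \<boxplus> b) \<boxtimes> z \<boxplus> (c + d) \<odot> z = (a \<boxtimes> z \<boxplus> c \<odot> z) \<boxplus> (b \<boxtimes> z \<boxplus> d \<odot> z)"
        using a b z
        by (simp add: mult_add_left scale_add_left mult_closed scale_closed ab.a_ac)
      then have "alg_norm A ((a \<boxplus> b) \<boxtimes> z \<boxplus> (c + d) \<odot> z) \<le>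
          alg_norm A (a \<boxtimes> z \<boxplus> c \<odot> z) + alg_norm A (b \<boxtimes> z \<boxplus> d \<odot> z)"
        using a b z by (simp add: norm_triangle mult_closed scale_closed)
      also have "\<dots> \<le> ?N (a, c) + ?N (b, d)"
        using a b z by (intro add_mono unitization_norm_upper)
      finally show "alg_norm A ((a \<boxplus> b) \<boxtimes> z \<boxplus> (c + d) \<odot> z) \<le> ?N (a, c) + ?N (b, d)" .
    qed (use a b in simp)
    then show "?N (x \<oplus>\<^bsub>?U\<^esub> y) \<le> ?N x + ?N y" using xy by simp
    have "?N (a \<boxtimes> b \<boxplus> (c \<odot> b \<boxplus> d \<odot> a), c * d) \<le> ?N (a, c) * ?N (b, d)"
    proof (rule unitization_norm_le)
      fix z assume z: "z \<in> carrier A" "alg_norm A z \<le> 1"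
      have bz: "b \<boxtimes> z \<boxplus> d \<odot> z \<in> carrier A" using b z by (simp add: mult_closed scale_closed)
      have "(a \<boxtimes> b \<boxplus> (c \<odot> b \<boxplus> d \<odot> a)) \<boxtimes> z \<boxplus> (c * d) \<odot> z =
          a \<boxtimes> (b \<boxtimes> z \<boxplus> d \<odot> z) \<boxplus> c \<odot> (b \<boxtimes> z \<boxplus> d \<odot> z)"
        using a b z
        by (simp add: mult_add_left mult_add_right scale_add_right mult_scale_left
            mult_scale_right scale_scale mult_assoc mult_closed scale_closed ab.a_ac)
      then have "alg_norm A ((a \<boxtimes> b \<boxplus> (c \<odot> b \<boxplus> d \<odot> a)) \<boxtimes> z \<boxplus> (c * d) \<odot> z) \<le>
          ?N (a, c) * alg_norm A (b \<boxtimes> z \<boxplus> d \<odot> z)"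
        using unitization_norm_ge[OF a bz, of c] by simp
      also have "\<dots> \<le> ?N (a, c) * (?N (b, d) * alg_norm A z)"
        by (intro mult_left_mono unitization_norm_ge unitization_norm_nonneg a b z)
      also have "\<dots> \<le> ?N (a, c) * (?N (b, d) * 1)"
        by (intro mult_left_mono unitization_norm_nonneg a b z)
      finally show "alg_norm A ((a \<boxtimes> b \<boxplus> (c \<odot> b \<boxplus> d \<odot> a)) \<boxtimes> z \<boxplus> (c * d) \<odot> z) \<le>
        ?N (a, c) * ?N (b, d)" by simp
    qed (use a b in \<open>simp add: mult_closed scale_closed\<close>)
    then show "?N (x \<otimes>\<^bsub>?U\<^esub> y) \<le> ?N x * ?N y" using xy by simp
  next
    fix x assume "x \<in> carrier ?U"
    then obtain a c where x: "x = (a, c)" and a: "a \<in> carrier A" by auto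
    have "a = (-1) \<odot> ((-1) \<odot> a)" using a by (simp add: scale_scale scale_one)
    then have "?N (a, c) \<le> ?N ((-1) \<odot> a, - c)"
      using unitization_norm_scale[of "(-1) \<odot> a" "-1" "-c"] a by (simp add: scale_closed)
    then show "?N (\<ominus>\<^bsub>?U\<^esub> x) = ?N x"
      using unitization_norm_scale[OF a, of "-1" c] x a
      by (simp add: unitization_a_inv)
    show "0 \<le> ?N x" using unitization_norm_nonneg a x by simp
  next
    have "?N (alg_zero A, 0) \<le> 0"
      by (rule unitization_norm_le) (auto simp: mult_zero_left scale_zero_left norm_zero)
    then show "?N \<zero>\<^bsub>?U\<^esub> = 0" using unitization_norm_nonneg[of "alg_zero A" 0] by simp
  qed
qed

text \<open>The operator is tested on the adjoint of \<open>a\<close>: by the C*-identity,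
  \<open>a\<close> times its adjoint has as norm the square of the norm of \<open>a\<close>.\<close>

lemma norm_le_unitization_norm:
  assumes a: "a \<in> carrier A"
  shows "alg_norm A a \<le> NU (a, 0)"
proof (cases "alg_norm A a = 0")
  case False
  define x where "x = alg_adj A a"
  have x: "x \<in> carrier A" and nx: "alg_norm A x = alg_norm A a"
    using a by (auto simp: x_def adj_closed norm_adj)
  have "alg_norm A a * alg_norm A a = alg_norm A (a \<boxtimes> x \<boxplus> 0 \<odot> x)"
    using norm_star[OF x] a x nx
    by (simp add: x_def adj_adj scale_zero_left power2_eq_square mult_closed)
  also have "\<dots> \<le> NU (a, 0) * alg_norm A a"
    using unitization_norm_ge[OF a x] nx by metis
  finally show ?thesis using False norm_nonneg[OF a] by (simp add: mult_le_cancel_right)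
qed (use unitization_norm_nonneg[OF a] in simp)

end

section \<open>Skew group rings\<close>

text \<open>The multiplication of \<open>L1_algebra\<close>, over an arbitrary ring. Over a unital A
  this ring is the crossed product itself; over the unitization of A it is an overring of the
  unitized crossed product.\<close>

definition skew_ring :: "('a, 'm) ring_scheme \<Rightarrow> ('g, 'n) monoid_scheme \<Rightarrow> ('g \<Rightarrow> 'a \<Rightarrow> 'a) \<Rightarrow> ('g \<Rightarrow> 'a) ring"
  where
  "skew_ring R G \<alpha> =
    \<lparr>carrier = carrier G \<rightarrow>\<^sub>E carrier R,
     mult = (\<lambda>f h. \<lambda>s\<in>carrier G. \<Oplus>\<^bsub>R\<^esub>t\<in>carrier G. f t \<otimes>\<^bsub>R\<^esub> \<alpha> t (h (inv\<^bsub>G\<^esub> t \<otimes>\<^bsub>G\<^esub> s))),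
     one = (\<lambda>s\<in>carrier G. if s = \<one>\<^bsub>G\<^esub> then \<one>\<^bsub>R\<^esub> else \<zero>\<^bsub>R\<^esub>),
     zero = (\<lambda>s\<in>carrier G. \<zero>\<^bsub>R\<^esub>),
     add = (\<lambda>f h. \<lambda>s\<in>carrier G. f s \<oplus>\<^bsub>R\<^esub> h s)\<rparr>"

lemma skew_ring_simps:
  "carrier (skew_ring R G \<alpha>) = carrier G \<rightarrow>\<^sub>E carrier R"
  "mult (skew_ring R G \<alpha>) = (\<lambda>f h. \<lambda>s\<in>carrier G. \<Oplus>\<^bsub>R\<^esub>t\<in>carrier G. f t \<otimes>\<^bsub>R\<^esub> \<alpha> t (h (inv\<^bsub>G\<^esub> t \<otimes>\<^bsub>G\<^esub> s)))"
  "one (skew_ring R G \<alpha>) = (\<lambda>s\<in>carrier G. if s = \<one>\<^bsub>G\<^esub> then \<one>\<^bsub>R\<^esub> else \<zero>\<^bsub>R\<^esub>)"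
  "zero (skew_ring R G \<alpha>) = (\<lambda>s\<in>carrier G. \<zero>\<^bsub>R\<^esub>)"
  "add (skew_ring R G \<alpha>) = (\<lambda>f h. \<lambda>s\<in>carrier G. f s \<oplus>\<^bsub>R\<^esub> h s)"
  by (simp_all add: skew_ring_def)

locale skew_group_ring = ring R + G: group G
  for R :: "('a, 'm) ring_scheme" (structure) and G :: "('g, 'n) monoid_scheme" +
  fixes \<alpha> :: "'g \<Rightarrow> 'a \<Rightarrow> 'a"
  assumes finite_group: "finite (carrier G)"
    and act_closed: "\<lbrakk>g \<in> carrier G; x \<in> carrier R\<rbrakk> \<Longrightarrow> \<alpha> g x \<in> carrier R"
    and act_add: "\<lbrakk>g \<in> carrier G; x \<in> carrier R; y \<in> carrier R\<rbrakk> \<Longrightarrow> \<alpha> g (x \<oplus> y) = \<alpha> g x \<oplus> \<alpha> g y"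
    and act_mult:
      "\<lbrakk>g \<in> carrier G; x \<in> carrier R; y \<in> carrier R\<rbrakk> \<Longrightarrow> \<alpha> g (x \<otimes> y) = \<alpha> g x \<otimes> \<alpha> g y"
    and act_comp:
      "\<lbrakk>g \<in> carrier G; h \<in> carrier G; x \<in> carrier R\<rbrakk> \<Longrightarrow> \<alpha> (g \<otimes>\<^bsub>G\<^esub> h) x = \<alpha> g (\<alpha> h x)"
    and act_id: "x \<in> carrier R \<Longrightarrow> \<alpha> \<one>\<^bsub>G\<^esub> x = x"
    and act_one: "g \<in> carrier G \<Longrightarrow> \<alpha> g \<one> = \<one>"
begin

abbreviation "D \<equiv> skew_ring R G \<alpha>"

lemma act_zero: "g \<in> carrier G \<Longrightarrow> \<alpha> g \<zero> = \<zero>"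
  using act_add[of g \<zero> \<zero>] act_closed[of g \<zero>]
  by (metis add.l_cancel_one' l_zero zero_closed)

lemma act_finsum:
  "\<lbrakk>g \<in> carrier G; finite I; f \<in> I \<rightarrow> carrier R\<rbrakk> \<Longrightarrow>
    \<alpha> g (finsum R f I) = (\<Oplus>i\<in>I. \<alpha> g (f i))"
proof (induction I rule: infinite_finite_induct)
  case (insert i I)
  then have "f i \<in> carrier R" "f \<in> I \<rightarrow> carrier R" by auto
  with insert show ?case
    by (subst (1 2) finsum_insert) (auto simp: act_add act_closed Pi_iff intro!: finsum_closed)
qed (auto simp: act_zero)

lemma skew_mult_apply:
  "s \<in> carrier G \<Longrightarrow> (f \<otimes>\<^bsub>D\<^esub> h) s = (\<Oplus>t\<in>carrier G. f t \<otimes> \<alpha> t (h (inv\<^bsub>G\<^esub> t \<otimes>\<^bsub>G\<^esub> s)))"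
  by (simp add: skew_ring_simps)

lemma skew_term_closed:
  "\<lbrakk>f \<in> carrier D; h \<in> carrier D; s \<in> carrier G; t \<in> carrier G\<rbrakk> \<Longrightarrow>
    f t \<otimes> \<alpha> t (h (inv\<^bsub>G\<^esub> t \<otimes>\<^bsub>G\<^esub> s)) \<in> carrier R"
  by (intro m_closed act_closed) (auto simp: skew_ring_simps PiE_iff)

lemma skew_mult_closed:
  assumes "f \<in> carrier D" "h \<in> carrier D"
  shows "f \<otimes>\<^bsub>D\<^esub> h \<in> carrier D"
proof -
  have "(f \<otimes>\<^bsub>D\<^esub> h) s \<in> carrier R" if "s \<in> carrier G" for s
    unfolding skew_mult_apply[OF that] using assms that
    by (intro finsum_closed) (auto intro: skew_term_closed)
  then show ?thesis by (auto simp: skew_ring_simps)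
qed

text \<open>Both sides are sums over the factorizations of \<open>s\<close> into three group
  elements. After the two sums are exchanged, the substitution \<open>t = u v\<close> and
  \<open>act_comp\<close> identify the terms.\<close>

lemma skew_mult_assoc:
  assumes f: "f \<in> carrier D" and h: "h \<in> carrier D" and k: "k \<in> carrier D"
  shows "(f \<otimes>\<^bsub>D\<^esub> h) \<otimes>\<^bsub>D\<^esub> k = f \<otimes>\<^bsub>D\<^esub> (h \<otimes>\<^bsub>D\<^esub> k)"
proof
  fix s
  show "((f \<otimes>\<^bsub>D\<^esub> h) \<otimes>\<^bsub>D\<^esub> k) s = (f \<otimes>\<^bsub>D\<^esub> (h \<otimes>\<^bsub>D\<^esub> k)) s"
  proof (cases "s \<in> carrier G")
    case s: True
    have app: "f t \<in> carrier R" "h t \<in> carrier R" "k t \<in> carrier R" if "t \<in> carrier G" for t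
      using f h k that by (auto simp: skew_ring_simps)
    let ?P = "\<lambda>u t. (f u \<otimes> \<alpha> u (h (inv\<^bsub>G\<^esub> u \<otimes>\<^bsub>G\<^esub> t))) \<otimes> \<alpha> t (k (inv\<^bsub>G\<^esub> t \<otimes>\<^bsub>G\<^esub> s))"
    have P: "?P u t \<in> carrier R" if "u \<in> carrier G" "t \<in> carrier G" for u t
      using that s app by (simp add: act_closed)
    have "((f \<otimes>\<^bsub>D\<^esub> h) \<otimes>\<^bsub>D\<^esub> k) s = (\<Oplus>t\<in>carrier G. \<Oplus>u\<in>carrier G. ?P u t)"
      unfolding skew_mult_apply[OF s]
    proof (rule finsum_cong')
      fix t assume t: "t \<in> carrier G"
      show "(f \<otimes>\<^bsub>D\<^esub> h) t \<otimes> \<alpha> t (k (inv\<^bsub>G\<^esub> t \<otimes>\<^bsub>G\<^esub> s)) = (\<Oplus>u\<in>carrier G. ?P u t)"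
        unfolding skew_mult_apply[OF t]
        using t s app by (intro finsum_ldistr finite_group) (auto simp: act_closed)
    qed (auto intro!: finsum_closed P)
    also have "\<dots> = (\<Oplus>u\<in>carrier G. \<Oplus>t\<in>carrier G. ?P u t)"
      by (intro finsum_swap finite_group P)
    also have "\<dots> = (\<Oplus>u\<in>carrier G. f u \<otimes> \<alpha> u ((h \<otimes>\<^bsub>D\<^esub> k) (inv\<^bsub>G\<^esub> u \<otimes>\<^bsub>G\<^esub> s)))"
    proof (rule finsum_cong')
      fix u assume u: "u \<in> carrier G"
      have us: "inv\<^bsub>G\<^esub> u \<otimes>\<^bsub>G\<^esub> s \<in> carrier G" using u s by simp
      have "(\<Oplus>t\<in>carrier G. ?P u t) = (\<Oplus>v\<in>carrier G. ?P u (u \<otimes>\<^bsub>G\<^esub> v))"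
        using u P by (intro finsum_translate) (auto intro: G.is_group)
      also have "\<dots> = (\<Oplus>v\<in>carrier G. f u \<otimes>
          \<alpha> u (h v \<otimes> \<alpha> v (k (inv\<^bsub>G\<^esub> v \<otimes>\<^bsub>G\<^esub> (inv\<^bsub>G\<^esub> u \<otimes>\<^bsub>G\<^esub> s)))))"
      proof (rule finsum_cong')
        fix v assume v: "v \<in> carrier G"
        have 1: "inv\<^bsub>G\<^esub> u \<otimes>\<^bsub>G\<^esub> (u \<otimes>\<^bsub>G\<^esub> v) = v"
          using u v by (simp add: G.m_assoc[symmetric])
        have 2: "inv\<^bsub>G\<^esub> (u \<otimes>\<^bsub>G\<^esub> v) \<otimes>\<^bsub>G\<^esub> s = inv\<^bsub>G\<^esub> v \<otimes>\<^bsub>G\<^esub> (inv\<^bsub>G\<^esub> u \<otimes>\<^bsub>G\<^esub> s)"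
          using u v s by (simp add: G.inv_mult_group G.m_assoc)
        show "?P u (u \<otimes>\<^bsub>G\<^esub> v) = f u \<otimes>
            \<alpha> u (h v \<otimes> \<alpha> v (k (inv\<^bsub>G\<^esub> v \<otimes>\<^bsub>G\<^esub> (inv\<^bsub>G\<^esub> u \<otimes>\<^bsub>G\<^esub> s))))"
          unfolding 1 2 using u v us app by (simp add: act_comp act_mult act_closed m_assoc)
      qed (use u s app in \<open>auto simp: act_closed\<close>)
      also have "\<dots> = f u \<otimes> (\<Oplus>v\<in>carrier G.
          \<alpha> u (h v \<otimes> \<alpha> v (k (inv\<^bsub>G\<^esub> v \<otimes>\<^bsub>G\<^esub> (inv\<^bsub>G\<^esub> u \<otimes>\<^bsub>G\<^esub> s)))))"
        using u s app by (intro finsum_rdistr[symmetric] finite_group) (auto simp: act_closed)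
      also have "\<dots> = f u \<otimes> \<alpha> u ((h \<otimes>\<^bsub>D\<^esub> k) (inv\<^bsub>G\<^esub> u \<otimes>\<^bsub>G\<^esub> s))"
        unfolding skew_mult_apply[OF us] using u s app
        by (subst act_finsum[OF _ finite_group]) (auto simp: act_closed)
      finally show "(\<Oplus>t\<in>carrier G. ?P u t) =
          f u \<otimes> \<alpha> u ((h \<otimes>\<^bsub>D\<^esub> k) (inv\<^bsub>G\<^esub> u \<otimes>\<^bsub>G\<^esub> s))" .
    qed (use s app skew_mult_closed[OF h k] in \<open>auto simp: skew_ring_simps PiE_iff act_closed\<close>)
    also have "\<dots> = (f \<otimes>\<^bsub>D\<^esub> (h \<otimes>\<^bsub>D\<^esub> k)) s" by (simp add: skew_mult_apply[OF s])
    finally show ?thesis .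
  qed (simp add: skew_ring_simps)
qed

text \<open>An element of \<open>R\<close> placed at the identity multiplies from the left
  coefficient by coefficient, without the action. This is why a tuple over the skew ring can be
  treated as a matrix over \<open>R\<close>.\<close>

lemma skew_const_mult:
  assumes "r \<in> carrier R" "h \<in> carrier D" "s \<in> carrier G"
  shows "((\<lambda>t\<in>carrier G. if t = \<one>\<^bsub>G\<^esub> then r else \<zero>) \<otimes>\<^bsub>D\<^esub> h) s = r \<otimes> h s"
proof -
  have hs: "h t \<in> carrier R" if "t \<in> carrier G" for t
    using assms that by (auto simp: skew_ring_simps)
  show ?thesis
    unfolding skew_mult_apply[OF assms(3)]
    using assms hs finite_group
    by (subst finsum_eq_single[of _ "\<one>\<^bsub>G\<^esub>"]) (auto simp: act_id act_closed)
qed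

lemma skew_mult_const:
  assumes "r \<in> carrier R" "h \<in> carrier D" "s \<in> carrier G"
  shows "(h \<otimes>\<^bsub>D\<^esub> (\<lambda>t\<in>carrier G. if t = \<one>\<^bsub>G\<^esub> then r else \<zero>)) s = h s \<otimes> \<alpha> s r"
proof -
  have hs: "h t \<in> carrier R" if "t \<in> carrier G" for t
    using assms that by (auto simp: skew_ring_simps)
  have "inv\<^bsub>G\<^esub> t \<otimes>\<^bsub>G\<^esub> s = \<one>\<^bsub>G\<^esub> \<longleftrightarrow> t = s" if "t \<in> carrier G" for t
    using that assms by (metis G.inv_closed G.inv_comm G.inv_equality G.inv_inv G.l_inv)
  then show ?thesis
    unfolding skew_mult_apply[OF assms(3)]
    using assms hs finite_group
    by (subst finsum_eq_single[of _ s]) (auto simp: act_zero act_closed)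
qed

sublocale skew: ring D
proof (rule ringI)
  show "abelian_group D"
  proof (rule abelian_groupI)
    fix f assume f: "f \<in> carrier D"
    then have "(\<lambda>s\<in>carrier G. \<ominus> f s) \<oplus>\<^bsub>D\<^esub> f = \<zero>\<^bsub>D\<^esub>"
      by (auto simp: skew_ring_simps PiE_iff l_neg)
    then show "\<exists>h\<in>carrier D. h \<oplus>\<^bsub>D\<^esub> f = \<zero>\<^bsub>D\<^esub>"
      using f by (intro bexI[of _ "\<lambda>s\<in>carrier G. \<ominus> f s"]) (auto simp: skew_ring_simps)
  qed (auto simp: skew_ring_simps PiE_iff a_ac extensional_def fun_eq_iff)
  show "Group.monoid D"
  proof unfold_locales
    show "\<one>\<^bsub>D\<^esub> \<in> carrier D" by (auto simp: skew_ring_simps)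
    fix f assume f: "f \<in> carrier D"
    have "(\<one>\<^bsub>D\<^esub> \<otimes>\<^bsub>D\<^esub> f) s = f s" if "s \<in> carrier G" for s
      using skew_const_mult[OF one_closed f that] f that by (auto simp: skew_ring_simps PiE_iff)
    moreover have "(f \<otimes>\<^bsub>D\<^esub> \<one>\<^bsub>D\<^esub>) s = f s" if "s \<in> carrier G" for s
      using skew_mult_const[OF one_closed f that] f that by (auto simp: skew_ring_simps PiE_iff act_one)
    moreover have "f s = undefined" "(\<one>\<^bsub>D\<^esub> \<otimes>\<^bsub>D\<^esub> f) s = undefined" "(f \<otimes>\<^bsub>D\<^esub> \<one>\<^bsub>D\<^esub>) s = undefined"
      if "s \<notin> carrier G" for s
      using that f by (auto simp: skew_ring_simps)
    ultimately show "\<one>\<^bsub>D\<^esub> \<otimes>\<^bsub>D\<^esub> f = f" "f \<otimes>\<^bsub>D\<^esub> \<one>\<^bsub>D\<^esub> = f"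
      by (rule_tac ext, metis)+
  qed (auto intro: skew_mult_closed skew_mult_assoc)
next
  fix f h k assume fhk: "f \<in> carrier D" "h \<in> carrier D" "k \<in> carrier D"
  have app: "f t \<in> carrier R" "h t \<in> carrier R" "k t \<in> carrier R" if "t \<in> carrier G" for t
    using fhk that by (auto simp: skew_ring_simps)
  have "((f \<oplus>\<^bsub>D\<^esub> h) \<otimes>\<^bsub>D\<^esub> k) s = ((f \<otimes>\<^bsub>D\<^esub> k) \<oplus>\<^bsub>D\<^esub> (h \<otimes>\<^bsub>D\<^esub> k)) s" if s: "s \<in> carrier G" for s
  proof -
    have "((f \<oplus>\<^bsub>D\<^esub> h) \<otimes>\<^bsub>D\<^esub> k) s = (\<Oplus>t\<in>carrier G. f t \<otimes> \<alpha> t (k (inv\<^bsub>G\<^esub> t \<otimes>\<^bsub>G\<^esub> s)) \<oplus>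
        h t \<otimes> \<alpha> t (k (inv\<^bsub>G\<^esub> t \<otimes>\<^bsub>G\<^esub> s)))"
      unfolding skew_mult_apply[OF s] using s app
      by (intro finsum_cong') (auto simp: skew_ring_simps l_distr act_closed)
    also have "\<dots> = ((f \<otimes>\<^bsub>D\<^esub> k) \<oplus>\<^bsub>D\<^esub> (h \<otimes>\<^bsub>D\<^esub> k)) s"
      using s app by (subst finsum_addf) (auto simp: skew_ring_simps act_closed)
    finally show ?thesis .
  qed
  then show "(f \<oplus>\<^bsub>D\<^esub> h) \<otimes>\<^bsub>D\<^esub> k = f \<otimes>\<^bsub>D\<^esub> k \<oplus>\<^bsub>D\<^esub> h \<otimes>\<^bsub>D\<^esub> k"
    by (intro ext) (auto simp: skew_ring_simps restrict_def)
  have "(k \<otimes>\<^bsub>D\<^esub> (f \<oplus>\<^bsub>D\<^esub> h)) s = ((k \<otimes>\<^bsub>D\<^esub> f) \<oplus>\<^bsub>D\<^esub> (k \<otimes>\<^bsub>D\<^esub> h)) s" if s: "s \<in> carrier G" for s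
  proof -
    have "(k \<otimes>\<^bsub>D\<^esub> (f \<oplus>\<^bsub>D\<^esub> h)) s = (\<Oplus>t\<in>carrier G. k t \<otimes> \<alpha> t (f (inv\<^bsub>G\<^esub> t \<otimes>\<^bsub>G\<^esub> s)) \<oplus>
        k t \<otimes> \<alpha> t (h (inv\<^bsub>G\<^esub> t \<otimes>\<^bsub>G\<^esub> s)))"
      unfolding skew_mult_apply[OF s] using s app
      by (intro finsum_cong') (auto simp: skew_ring_simps r_distr act_closed act_add)
    also have "\<dots> = ((k \<otimes>\<^bsub>D\<^esub> f) \<oplus>\<^bsub>D\<^esub> (k \<otimes>\<^bsub>D\<^esub> h)) s"
      using s app by (subst finsum_addf) (auto simp: skew_ring_simps act_closed)
    finally show ?thesis .
  qed
  then show "k \<otimes>\<^bsub>D\<^esub> (f \<oplus>\<^bsub>D\<^esub> h) = k \<otimes>\<^bsub>D\<^esub> f \<oplus>\<^bsub>D\<^esub> k \<otimes>\<^bsub>D\<^esub> h"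
    by (intro ext) (auto simp: skew_ring_simps restrict_def)
qed

lemma skew_apply_closed: "\<lbrakk>f \<in> carrier D; s \<in> carrier G\<rbrakk> \<Longrightarrow> f s \<in> carrier R"
  by (auto simp: skew_ring_simps)

lemma skew_finsum_apply:
  assumes "finite I" "F \<in> I \<rightarrow> carrier D" "s \<in> carrier G"
  shows "(finsum D F I) s = (\<Oplus>i\<in>I. F i s)"
  using assms(1,2)
proof (induction I rule: finite_induct)
  case empty
  then show ?case using assms by (simp add: skew.finsum_empty) (simp add: skew_ring_simps)
next
  case (insert i I)
  then have cl: "F i \<in> carrier D" "F \<in> I \<rightarrow> carrier D" by auto
  have "(finsum D F (insert i I)) s = (F i \<oplus>\<^bsub>D\<^esub> finsum D F I) s"
    using insert cl by (subst skew.finsum_insert) auto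
  also have "\<dots> = F i s \<oplus> (\<Oplus>i\<in>I. F i s)"
    using insert.IH[OF cl(2)] assms(3) by (simp add: skew_ring_simps)
  also have "\<dots> = (\<Oplus>i\<in>insert i I. F i s)"
    using insert.hyps cl assms(3) by (subst finsum_insert) (auto intro: skew_apply_closed)
  finally show ?case .
qed

text \<open>The unit of the skew ring is one of the rows that are spanned. Its coefficients
  \<open>r i\<close> in \<open>R\<close>, placed at the identity, are the multipliers.\<close>

lemma unimodular_skew_if_rows_span:
  assumes Y: "Y \<in> {..<m} \<rightarrow> carrier G \<rightarrow> carrier R" and span: "rows_span (carrier G) m Y"
  shows "skew.unimodular m (\<lambda>i. restrict (Y i) (carrier G))"
proof -
  have "\<one>\<^bsub>D\<^esub> \<in> carrier G \<rightarrow> carrier R" using skew.one_closed by (auto simp: skew_ring_simps)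
  with span obtain r where r: "r \<in> {..<m} \<rightarrow> carrier R"
    and one: "\<And>s. s \<in> carrier G \<Longrightarrow> \<one>\<^bsub>D\<^esub> s = (\<Oplus>i\<in>{..<m}. r i \<otimes> Y i s)"
    unfolding rows_span_def by blast
  let ?r = "\<lambda>i. \<lambda>t\<in>carrier G. if t = \<one>\<^bsub>G\<^esub> then r i else \<zero>"
    and ?Y = "\<lambda>i. restrict (Y i) (carrier G)"
  have cl: "?r i \<in> carrier D" "?Y i \<in> carrier D" if "i < m" for i
    using that r Y by (auto simp: skew_ring_simps)
  have "(\<Oplus>\<^bsub>D\<^esub>i\<in>{..<m}. ?r i \<otimes>\<^bsub>D\<^esub> ?Y i) s = \<one>\<^bsub>D\<^esub> s" if s: "s \<in> carrier G" for s
  proof -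
    have "(\<Oplus>\<^bsub>D\<^esub>i\<in>{..<m}. ?r i \<otimes>\<^bsub>D\<^esub> ?Y i) s = (\<Oplus>i\<in>{..<m}. (?r i \<otimes>\<^bsub>D\<^esub> ?Y i) s)"
      using s cl by (intro skew_finsum_apply) (auto intro: skew.m_closed)
    also have "\<dots> = (\<Oplus>i\<in>{..<m}. r i \<otimes> Y i s)"
    proof (rule finsum_cong')
      fix i assume i: "i \<in> {..<m}"
      then show "(?r i \<otimes>\<^bsub>D\<^esub> ?Y i) s = r i \<otimes> Y i s"
        using skew_const_mult[of "r i" "?Y i" s] r s cl by auto
    qed (use r Y s in \<open>auto simp: Pi_iff\<close>)
    finally show ?thesis using one[OF s] by simp
  qed
  moreover have "(\<Oplus>\<^bsub>D\<^esub>i\<in>{..<m}. ?r i \<otimes>\<^bsub>D\<^esub> ?Y i) \<in> carrier D"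
    using cl by (intro skew.finsum_closed) (auto intro: skew.m_closed)
  ultimately have "(\<Oplus>\<^bsub>D\<^esub>i\<in>{..<m}. ?r i \<otimes>\<^bsub>D\<^esub> ?Y i) = \<one>\<^bsub>D\<^esub>"
    using skew.one_closed by (intro extensionalityI[of _ "carrier G"]) (auto simp: skew_ring_simps PiE_iff)
  then show ?thesis
    using cl by (auto simp: skew.unimodular_def intro!: bexI[of _ ?r])
qed

end

section \<open>Crossed products by finite groups\<close>

locale cstar_action = plain_cstar_algebra A + G: group G
  for A :: "'a normed_star_alg" (structure) and G :: "('g, 'm) monoid_scheme" +
  fixes \<alpha> :: "'g \<Rightarrow> 'a \<Rightarrow> 'a"
  assumes finite_group: "finite (carrier G)"
    and act_hom: "\<alpha> \<in> hom G (star_Aut A)"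
begin

abbreviation "B \<equiv> crossed_product G A \<alpha>"

lemma act_star_aut: "g \<in> carrier G \<Longrightarrow> \<alpha> g \<in> star_auts A"
  using act_hom by (auto simp: hom_def star_Aut_def)

lemma act_bij: "g \<in> carrier G \<Longrightarrow> bij_betw (\<alpha> g) (carrier A) (carrier A)"
  using act_star_aut by (auto simp: star_auts_def Bij_def)

lemma act_closed: "\<lbrakk>g \<in> carrier G; x \<in> carrier A\<rbrakk> \<Longrightarrow> \<alpha> g x \<in> carrier A"
  using act_bij by (auto simp: bij_betw_def)

lemma act_add:
  "\<lbrakk>g \<in> carrier G; x \<in> carrier A; y \<in> carrier A\<rbrakk> \<Longrightarrow> \<alpha> g (x \<boxplus> y) = \<alpha> g x \<boxplus> \<alpha> g y"
  and act_scale: "\<lbrakk>g \<in> carrier G; x \<in> carrier A\<rbrakk> \<Longrightarrow> \<alpha> g (c \<odot> x) = c \<odot> \<alpha> g x"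
  and act_mult:
  "\<lbrakk>g \<in> carrier G; x \<in> carrier A; y \<in> carrier A\<rbrakk> \<Longrightarrow> \<alpha> g (x \<boxtimes> y) = \<alpha> g x \<boxtimes> \<alpha> g y"
  and act_adj: "\<lbrakk>g \<in> carrier G; x \<in> carrier A\<rbrakk> \<Longrightarrow> \<alpha> g (alg_adj A x) = alg_adj A (\<alpha> g x)"
  using act_star_aut by (auto simp: star_auts_def)

lemma act_comp:
  "\<lbrakk>g \<in> carrier G; h \<in> carrier G; x \<in> carrier A\<rbrakk> \<Longrightarrow> \<alpha> (g \<otimes>\<^bsub>G\<^esub> h) x = \<alpha> g (\<alpha> h x)"
  using act_hom act_star_aut[of g] act_star_aut[of h]
  by (auto simp: hom_def star_Aut_def BijGroup_def star_auts_def compose_def)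

text \<open>The identity of the group acts as an idempotent map by \<open>act_comp\<close>, and an
  injective idempotent map is the identity.\<close>

lemma act_id: "x \<in> carrier A \<Longrightarrow> \<alpha> \<one>\<^bsub>G\<^esub> x = x"
  using act_comp[of "\<one>\<^bsub>G\<^esub>" "\<one>\<^bsub>G\<^esub>" x] act_bij[of "\<one>\<^bsub>G\<^esub>"] act_closed[of "\<one>\<^bsub>G\<^esub>" x]
  by (auto simp: bij_betw_def inj_on_def)

lemma act_zero: "g \<in> carrier G \<Longrightarrow> \<alpha> g (alg_zero A) = alg_zero A"
  using act_scale[of g "alg_zero A" 0] act_closed[of g "alg_zero A"]
  by (simp add: scale_zero_right scale_zero_left)

lemma act_surj: "\<lbrakk>g \<in> carrier G; y \<in> carrier A\<rbrakk> \<Longrightarrow> \<exists>x\<in>carrier A. y = \<alpha> g x"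
  using act_bij[of g] by (auto simp: bij_betw_def)

lemma crossed_product_simps:
  "carrier B = carrier G \<rightarrow>\<^sub>E carrier A"
  "alg_add B = (\<lambda>f h. \<lambda>s\<in>carrier G. f s \<boxplus> h s)"
  "alg_zero B = (\<lambda>s\<in>carrier G. alg_zero A)"
  "alg_mult B = (\<lambda>f h. \<lambda>s\<in>carrier G.
     alg_sum A (\<lambda>t. f t \<boxtimes> \<alpha> t (h (inv\<^bsub>G\<^esub> t \<otimes>\<^bsub>G\<^esub> s))) (carrier G))"
  "alg_scale B = (\<lambda>c f. \<lambda>s\<in>carrier G. c \<odot> f s)"
  "alg_adj B = (\<lambda>f. \<lambda>s\<in>carrier G. \<alpha> s (alg_adj A (f (inv\<^bsub>G\<^esub> s))))"
  "alg_norm B = enveloping_norm (L1_algebra G A \<alpha>)"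
  by (simp_all add: crossed_product_def L1_algebra_def)

lemma L1_algebra_simps:
  "carrier (L1_algebra G A \<alpha>) = carrier B" "alg_add (L1_algebra G A \<alpha>) = alg_add B"
  "alg_zero (L1_algebra G A \<alpha>) = alg_zero B" "alg_mult (L1_algebra G A \<alpha>) = alg_mult B"
  "alg_scale (L1_algebra G A \<alpha>) = alg_scale B" "alg_adj (L1_algebra G A \<alpha>) = alg_adj B"
  "alg_norm (L1_algebra G A \<alpha>) = (\<lambda>f. \<Sum>s\<in>carrier G. alg_norm A (f s))"
  by (simp_all add: crossed_product_def L1_algebra_def)

lemma cp_apply_closed: "\<lbrakk>f \<in> carrier B; s \<in> carrier G\<rbrakk> \<Longrightarrow> f s \<in> carrier A"
  by (auto simp: crossed_product_simps)

lemma cp_ext: "\<lbrakk>f \<in> carrier B; h \<in> carrier B; \<And>s. s \<in> carrier G \<Longrightarrow> f s = h s\<rbrakk> \<Longrightarrow> f = h"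
  unfolding crossed_product_simps by (rule extensionalityI[of _ "carrier G"]) (auto simp: PiE_iff)

lemma cp_closed:
  "\<lbrakk>f \<in> carrier B; h \<in> carrier B\<rbrakk> \<Longrightarrow> alg_add B f h \<in> carrier B"
  "\<lbrakk>f \<in> carrier B; h \<in> carrier B\<rbrakk> \<Longrightarrow> alg_mult B f h \<in> carrier B"
  "f \<in> carrier B \<Longrightarrow> alg_scale B c f \<in> carrier B"
  "f \<in> carrier B \<Longrightarrow> alg_adj B f \<in> carrier B"
  "alg_zero B \<in> carrier B"
  unfolding crossed_product_simps
  by (auto intro!: sum_closed mult_closed act_closed scale_closed adj_closed simp: PiE_mem)

lemma cp_abelian_group: "abelian_group (alg_ring B e)"
proof (rule abelian_groupI)
  fix f assume f: "f \<in> carrier (alg_ring B e)"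
  then have "alg_add B (alg_scale B (-1) f) f = alg_zero B"
    by (auto simp: crossed_product_simps PiE_iff neg_add)
  then show "\<exists>h\<in>carrier (alg_ring B e). h \<oplus>\<^bsub>alg_ring B e\<^esub> f = \<zero>\<^bsub>alg_ring B e\<^esub>"
    using f cp_closed(3) by (intro bexI[of _ "alg_scale B (-1) f"]) auto
qed (auto simp: crossed_product_simps PiE_iff ab.a_ac extensional_def fun_eq_iff)

subsection \<open>The enveloping norm\<close>

abbreviation "seminorms \<equiv> {p. cstar_seminorm (L1_algebra G A \<alpha>) p \<and>
  (\<forall>y\<in>carrier B. p y \<le> (\<Sum>s\<in>carrier G. alg_norm A (y s)))}"

lemma seminormD:
  assumes "p \<in> seminorms"
  shows "x \<in> carrier B \<Longrightarrow> 0 \<le> p x"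
    and "\<lbrakk>x \<in> carrier B; y \<in> carrier B\<rbrakk> \<Longrightarrow> p (alg_add B x y) \<le> p x + p y"
    and "x \<in> carrier B \<Longrightarrow> p (alg_scale B c x) = cmod c * p x"
    and "\<lbrakk>x \<in> carrier B; y \<in> carrier B\<rbrakk> \<Longrightarrow> p (alg_mult B x y) \<le> p x * p y"
    and "x \<in> carrier B \<Longrightarrow> p (alg_mult B (alg_adj B x) x) = (p x)\<^sup>2"
    and "x \<in> carrier B \<Longrightarrow> p x \<le> (\<Sum>s\<in>carrier G. alg_norm A (x s))"
  using assms by (simp_all add: cstar_seminorm_def L1_algebra_simps)

lemma cp_norm_def: "alg_norm B x = (SUP p\<in>seminorms. p x)"
  by (simp add: crossed_product_simps(7) enveloping_norm_def L1_algebra_simps)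

text \<open>This makes the set of seminorms nonempty, so that a common bound for its members bounds
  the supremum. It also shows that the supremum is nonnegative.\<close>

lemma zero_seminorm: "(\<lambda>_. 0) \<in> seminorms"
  by (auto simp: cstar_seminorm_def intro!: sum_nonneg norm_nonneg cp_apply_closed)

lemma seminorm_le_cp_norm: "\<lbrakk>p \<in> seminorms; x \<in> carrier B\<rbrakk> \<Longrightarrow> p x \<le> alg_norm B x"
  unfolding cp_norm_def
  by (rule cSUP_upper) (auto intro!: bdd_aboveI2 seminormD(6))

lemma cp_norm_le: "(\<And>p. p \<in> seminorms \<Longrightarrow> p x \<le> S) \<Longrightarrow> alg_norm B x \<le> S"
  unfolding cp_norm_def using zero_seminorm by (intro cSUP_least) auto

lemma cp_norm_nonneg: "x \<in> carrier B \<Longrightarrow> 0 \<le> alg_norm B x"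
  using seminorm_le_cp_norm[OF zero_seminorm] .

lemma cp_norm_le_L1:
  assumes "x \<in> carrier B"
  shows "alg_norm B x \<le> (\<Sum>s\<in>carrier G. alg_norm A (x s))"
proof (rule cp_norm_le)
  fix p assume "p \<in> seminorms"
  then show "p x \<le> (\<Sum>s\<in>carrier G. alg_norm A (x s))" using assms by (rule seminormD(6))
qed

lemma cp_norm_triangle:
  assumes "x \<in> carrier B" "y \<in> carrier B"
  shows "alg_norm B (alg_add B x y) \<le> alg_norm B x + alg_norm B y"
proof (rule cp_norm_le)
  fix p assume p: "p \<in> seminorms"
  show "p (alg_add B x y) \<le> alg_norm B x + alg_norm B y"
    using seminormD(2)[OF p assms] seminorm_le_cp_norm[OF p assms(1)]
      seminorm_le_cp_norm[OF p assms(2)] by linarith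
qed

lemma cp_norm_scale:
  assumes "x \<in> carrier B"
  shows "alg_norm B (alg_scale B c x) \<le> cmod c * alg_norm B x"
proof (rule cp_norm_le)
  fix p assume p: "p \<in> seminorms"
  show "p (alg_scale B c x) \<le> cmod c * alg_norm B x"
    unfolding seminormD(3)[OF p assms]
    using seminorm_le_cp_norm[OF p assms] by (rule mult_left_mono) simp
qed

lemma cp_norm_mult:
  assumes "x \<in> carrier B" "y \<in> carrier B"
  shows "alg_norm B (alg_mult B x y) \<le> alg_norm B x * alg_norm B y"
proof (rule cp_norm_le)
  fix p assume p: "p \<in> seminorms"
  have "p x * p y \<le> alg_norm B x * alg_norm B y"
    using seminorm_le_cp_norm[OF p] seminormD(1)[OF p] cp_norm_nonneg assms
    by (metis mult_mono)
  then show "p (alg_mult B x y) \<le> alg_norm B x * alg_norm B y"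
    using seminormD(4)[OF p assms] by linarith
qed

text \<open>This is the product \<open>u\<^sub>g y\<close>: moving \<open>u\<^sub>g\<close> past the
  coefficient at \<open>t\<close> applies \<open>\<alpha> g\<close> to it, and the result sits at
  the product of \<open>g\<close> and \<open>t\<close>.\<close>

definition shift :: "'g \<Rightarrow> ('g \<Rightarrow> 'a) \<Rightarrow> 'g \<Rightarrow> 'a" where
  "shift g y = (\<lambda>s\<in>carrier G. \<alpha> g (y (inv\<^bsub>G\<^esub> g \<otimes>\<^bsub>G\<^esub> s)))"

lemma shift_closed: "\<lbrakk>g \<in> carrier G; y \<in> carrier B\<rbrakk> \<Longrightarrow> shift g y \<in> carrier B"
  by (auto simp: shift_def crossed_product_simps intro!: act_closed)

text \<open>With \<open>y\<close> also \<open>u\<^sub>g y\<close> is in the crossed product, although \<open>u\<^sub>g\<close> is in it only if \<open>A\<close> is unital.\<close>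

lemma shift_adj_shift:
  assumes g: "g \<in> carrier G" and y: "y \<in> carrier B"
  shows "alg_mult B (alg_adj B (shift g y)) (shift g y) = alg_mult B (alg_adj B y) y"
proof (rule cp_ext)
  fix s assume s: "s \<in> carrier G"
  have app: "y t \<in> carrier A" if "t \<in> carrier G" for t using y that by (rule cp_apply_closed)
  let ?F = "\<lambda>t. \<alpha> t (alg_adj A (y (inv\<^bsub>G\<^esub> t))) \<boxtimes> \<alpha> t (y (inv\<^bsub>G\<^esub> t \<otimes>\<^bsub>G\<^esub> s))"
  have F: "?F \<in> carrier G \<rightarrow> carrier A"
    using s app by (auto intro!: mult_closed act_closed adj_closed)
  have inj: "inj_on (\<lambda>t. t \<otimes>\<^bsub>G\<^esub> g) (carrier G)" using g by (auto simp: inj_on_def)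
  have img: "(\<lambda>t. t \<otimes>\<^bsub>G\<^esub> g) ` carrier G = carrier G"
  proof (intro equalityI subsetI)
    fix t assume "t \<in> carrier G"
    then have "t = (t \<otimes>\<^bsub>G\<^esub> inv\<^bsub>G\<^esub> g) \<otimes>\<^bsub>G\<^esub> g" "t \<otimes>\<^bsub>G\<^esub> inv\<^bsub>G\<^esub> g \<in> carrier G"
      using g by (auto simp: G.m_assoc)
    then show "t \<in> (\<lambda>t. t \<otimes>\<^bsub>G\<^esub> g) ` carrier G" by (rule image_eqI)
  qed (use g in auto)
  \<comment> \<open>The factors in the term at \<open>t\<close> for \<open>shift g y\<close> are
    those for \<open>y\<close> in the term at the product of \<open>t\<close> and \<open>g\<close>,
    and right translation permutes the group.\<close>
  have "alg_mult B (alg_adj B (shift g y)) (shift g y) s =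
      alg_sum A (\<lambda>t. ?F (t \<otimes>\<^bsub>G\<^esub> g)) (carrier G)"
    unfolding crossed_product_simps shift_def restrict_apply'[OF s]
  proof (rule ab.finsum_cong')
    fix t assume t: "t \<in> carrier G"
    have 1: "inv\<^bsub>G\<^esub> g \<otimes>\<^bsub>G\<^esub> inv\<^bsub>G\<^esub> t = inv\<^bsub>G\<^esub> (t \<otimes>\<^bsub>G\<^esub> g)"
      and 2: "inv\<^bsub>G\<^esub> g \<otimes>\<^bsub>G\<^esub> (inv\<^bsub>G\<^esub> t \<otimes>\<^bsub>G\<^esub> s) = inv\<^bsub>G\<^esub> (t \<otimes>\<^bsub>G\<^esub> g) \<otimes>\<^bsub>G\<^esub> s"
      using g t s by (simp_all add: G.inv_mult_group G.m_assoc)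
    show "(\<lambda>s\<in>carrier G. \<alpha> s (alg_adj A ((\<lambda>s\<in>carrier G. \<alpha> g (y (inv\<^bsub>G\<^esub> g \<otimes>\<^bsub>G\<^esub> s))) (inv\<^bsub>G\<^esub> s)))) t \<boxtimes>
        \<alpha> t ((\<lambda>s\<in>carrier G. \<alpha> g (y (inv\<^bsub>G\<^esub> g \<otimes>\<^bsub>G\<^esub> s))) (inv\<^bsub>G\<^esub> t \<otimes>\<^bsub>G\<^esub> s)) = ?F (t \<otimes>\<^bsub>G\<^esub> g)"
      using g t s app by (simp add: 1 2 act_adj[symmetric] act_comp[symmetric] adj_closed)
  qed (use F g in auto)
  also have "\<dots> = alg_sum A ?F (carrier G)"
    using ab.finsum_reindex[OF _ inj, of ?F] F by (simp only: img)
  also have "\<dots> = alg_mult B (alg_adj B y) y s"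
    unfolding crossed_product_simps restrict_apply'[OF s]
    using F by (intro ab.finsum_cong') auto
  finally show "alg_mult B (alg_adj B (shift g y)) (shift g y) s = alg_mult B (alg_adj B y) y s" .
qed (use assms cp_closed shift_closed in auto)

text \<open>The C*-identity holds for each single seminorm and reduces this to
  \<open>shift_adj_shift\<close>: \<open>u\<^sub>g\<close> acts as a unitary and cancels in the
  product of the adjoint of \<open>u\<^sub>g y\<close> with \<open>u\<^sub>g y\<close>.\<close>

lemma cp_norm_shift:
  assumes g: "g \<in> carrier G" and y: "y \<in> carrier B"
  shows "alg_norm B (shift g y) \<le> alg_norm B y"
proof (rule cp_norm_le)
  fix p assume p: "p \<in> seminorms"
  have "(p (shift g y))\<^sup>2 = (p y)\<^sup>2"
    using seminormD(5)[OF p] shift_adj_shift[OF assms] shift_closed[OF assms] y by metis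
  then have "p (shift g y) = p y"
    using seminormD(1)[OF p] shift_closed[OF assms] y by (simp add: power2_eq_iff_nonneg)
  then show "p (shift g y) \<le> alg_norm B y" using seminorm_le_cp_norm[OF p y] by simp
qed

subsection \<open>The unitization of the crossed product\<close>

lemma cp_unitization_norm_le:
  assumes f: "f \<in> carrier B"
  shows "alg_norm (unitization B) (f, c) \<le> alg_norm B f + cmod c"
proof -
  have "alg_norm B (alg_zero B) \<le> 0"
    using cp_norm_le_L1[OF cp_closed(5)] by (simp add: crossed_product_simps(3) norm_zero)
  then have "alg_zero B \<in> {x \<in> carrier B. alg_norm B x \<le> 1}"
    using cp_closed(5) by simp
  moreover have "alg_norm B (alg_add B (alg_mult B f x) (alg_scale B c x)) \<le> alg_norm B f + cmod c"
    if x: "x \<in> carrier B" "alg_norm B x \<le> 1" for x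
  proof -
    have "alg_norm B (alg_add B (alg_mult B f x) (alg_scale B c x)) \<le>
        alg_norm B f * alg_norm B x + cmod c * alg_norm B x"
      using cp_norm_triangle[OF cp_closed(2)[OF f x(1)] cp_closed(3)[OF x(1), of c]]
        cp_norm_mult[OF f x(1)] cp_norm_scale[OF x(1), of c] by linarith
    also have "\<dots> \<le> alg_norm B f * 1 + cmod c * 1"
      using f x cp_norm_nonneg by (intro add_mono mult_left_mono) auto
    finally show ?thesis by simp
  qed
  ultimately show ?thesis
    unfolding unitization_norm by (intro cSUP_least) auto
qed

lemma cp_unitization_dist_le:
  assumes "f \<in> carrier B" "h \<in> carrier B"
  shows "alg_dist (unitization B) (f, c) (h, d) \<le>
    alg_norm B (alg_add B f (alg_scale B (-1) h)) + cmod (c - d)"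
  using cp_unitization_norm_le[OF cp_closed(1)[OF assms(1) cp_closed(3)[OF assms(2)]], of "-1" "c - d"]
  by (simp add: alg_dist_def)

lemma cp_diff_norm_le:
  assumes "f \<in> carrier B" "h \<in> carrier B"
  shows "alg_norm B (alg_add B f (alg_scale B (-1) h)) \<le> (\<Sum>s\<in>carrier G. alg_dist A (f s) (h s))"
  using cp_norm_le_L1[OF cp_closed(1)[OF assms(1) cp_closed(3)[OF assms(2), of "-1"]]]
  by (simp add: crossed_product_simps alg_dist_def)

lemma cp_unitization_abelian_group: "abelian_group (alg_ring (unitization B) e)"
proof -
  interpret B: abelian_group "alg_ring B (alg_zero B)" by (rule cp_abelian_group)
  show ?thesis
  proof (rule abelian_groupI)
    fix x assume "x \<in> carrier (alg_ring (unitization B) e)"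
    then obtain f c where x: "x = (f, c)" "f \<in> carrier B" by auto
    have "alg_add B (a_inv (alg_ring B (alg_zero B)) f) f = alg_zero B"
      using B.l_neg[of f] x by simp
    then show "\<exists>h\<in>carrier (alg_ring (unitization B) e).
        h \<oplus>\<^bsub>alg_ring (unitization B) e\<^esub> x = \<zero>\<^bsub>alg_ring (unitization B) e\<^esub>"
      using B.a_inv_closed[of f] x
      by (intro bexI[of _ "(a_inv (alg_ring B (alg_zero B)) f, - c)"]) auto
  qed (use B.a_closed B.a_assoc B.a_comm B.l_zero B.zero_closed in auto)
qed

lemma cp_unitization_mult_closed:
  "\<lbrakk>x \<in> carrier (unitization B); y \<in> carrier (unitization B)\<rbrakk> \<Longrightarrow>
    alg_mult (unitization B) x y \<in> carrier (unitization B)"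
  by (auto intro!: cp_closed)

end

section \<open>The unital case\<close>

context cstar_action
begin

text \<open>The canonical copy of \<open>a\<close> in the crossed product, \<open>a\<close> times
  the group element at the identity.\<close>

definition delta :: "'a \<Rightarrow> 'g \<Rightarrow> 'a" where
  "delta a = (\<lambda>s\<in>carrier G. if s = \<one>\<^bsub>G\<^esub> then a else alg_zero A)"

lemma delta_closed: "a \<in> carrier A \<Longrightarrow> delta a \<in> carrier B"
  by (auto simp: delta_def crossed_product_simps)

lemma delta_mult_one:
  assumes a: "a \<in> carrier A" and f: "f \<in> carrier B"
  shows "alg_mult B (delta a) f \<one>\<^bsub>G\<^esub> = a \<boxtimes> f \<one>\<^bsub>G\<^esub>"
proof -
  have app: "f t \<in> carrier A" if "t \<in> carrier G" for t using f that by (rule cp_apply_closed)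
  have "alg_mult B (delta a) f \<one>\<^bsub>G\<^esub> =
      alg_sum A (\<lambda>t. delta a t \<boxtimes> \<alpha> t (f (inv\<^bsub>G\<^esub> t \<otimes>\<^bsub>G\<^esub> \<one>\<^bsub>G\<^esub>))) (carrier G)"
    by (simp add: crossed_product_simps)
  also have "\<dots> = delta a \<one>\<^bsub>G\<^esub> \<boxtimes> \<alpha> \<one>\<^bsub>G\<^esub> (f (inv\<^bsub>G\<^esub> \<one>\<^bsub>G\<^esub> \<otimes>\<^bsub>G\<^esub> \<one>\<^bsub>G\<^esub>))"
    using a app by (intro ab.finsum_eq_single finite_group)
      (auto simp: delta_def mult_zero_left act_closed mult_closed)
  also have "\<dots> = a \<boxtimes> f \<one>\<^bsub>G\<^esub>" using app by (simp add: delta_def act_id)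
  finally show ?thesis .
qed

lemma mult_delta_one:
  assumes a: "a \<in> carrier A" and f: "f \<in> carrier B"
  shows "alg_mult B f (delta a) \<one>\<^bsub>G\<^esub> = f \<one>\<^bsub>G\<^esub> \<boxtimes> a"
proof -
  have app: "f t \<in> carrier A" if "t \<in> carrier G" for t using f that by (rule cp_apply_closed)
  have "alg_mult B f (delta a) \<one>\<^bsub>G\<^esub> =
      alg_sum A (\<lambda>t. f t \<boxtimes> \<alpha> t (delta a (inv\<^bsub>G\<^esub> t \<otimes>\<^bsub>G\<^esub> \<one>\<^bsub>G\<^esub>))) (carrier G)"
    by (simp add: crossed_product_simps)
  also have "\<dots> = f \<one>\<^bsub>G\<^esub> \<boxtimes> \<alpha> \<one>\<^bsub>G\<^esub> (delta a (inv\<^bsub>G\<^esub> \<one>\<^bsub>G\<^esub> \<otimes>\<^bsub>G\<^esub> \<one>\<^bsub>G\<^esub>))"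
    using a app by (intro ab.finsum_eq_single finite_group)
      (auto simp: delta_def mult_zero_right act_closed mult_closed act_zero)
  also have "\<dots> = f \<one>\<^bsub>G\<^esub> \<boxtimes> a" using a by (simp add: delta_def act_id)
  finally show ?thesis .
qed

text \<open>The coefficient at the identity of a unit of B is a unit of A, as seen from the products
  with \<open>delta a\<close>. By contraposition, for nonunital A the stable rank of B, too, is
  computed in the unitization.\<close>

lemma unital_if_cp_unital:
  assumes "unital B"
  shows "unital A"
proof -
  obtain E where E: "E \<in> carrier B"
    and unit: "\<And>f. f \<in> carrier B \<Longrightarrow> alg_mult B E f = f \<and> alg_mult B f E = f"
    using assms by (auto simp: unital_def)
  have "E \<one>\<^bsub>G\<^esub> \<boxtimes> a = a \<and> a \<boxtimes> E \<one>\<^bsub>G\<^esub> = a" if a: "a \<in> carrier A" for a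
    using unit[OF delta_closed[OF a]] delta_mult_one[OF a E] mult_delta_one[OF a E]
    by (simp add: delta_def)
  then show ?thesis using cp_apply_closed[OF E] by (auto simp: unital_def)
qed

text \<open>By surjectivity \<open>e\<close> is itself an image \<open>\<alpha> g x\<close>, and
  then \<open>\<alpha> g e\<close> times \<open>e\<close> is \<open>\<alpha> g\<close> of
  \<open>e\<close> times \<open>x\<close>, which is \<open>e\<close> again.\<close>

lemma act_unit:
  assumes e: "e \<in> carrier A" "\<And>x. x \<in> carrier A \<Longrightarrow> e \<boxtimes> x = x \<and> x \<boxtimes> e = x"
    and g: "g \<in> carrier G"
  shows "\<alpha> g e = e"
proof -
  obtain x where x: "x \<in> carrier A" "e = \<alpha> g x" using act_surj[OF g e(1)] by blast
  have "\<alpha> g e = \<alpha> g e \<boxtimes> e" using e act_closed[OF g] by simp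
  also have "\<dots> = \<alpha> g (e \<boxtimes> x)" using act_mult[OF g e(1) x(1)] x by simp
  also have "\<dots> = e" using e x by simp
  finally show ?thesis .
qed

lemma skew_group_ring_unit:
  assumes e: "e \<in> carrier A" "\<And>x. x \<in> carrier A \<Longrightarrow> e \<boxtimes> x = x \<and> x \<boxtimes> e = x"
  shows "skew_group_ring (alg_ring A e) G \<alpha>"
proof -
  interpret ring "alg_ring A e" using e by (rule alg_ring_ring)
  show ?thesis
    by unfold_locales
      (auto simp: finite_group act_closed act_add act_mult act_comp act_id act_unit[OF e])
qed

text \<open>An equality of records, by which the unit and the unimodular tuples of the skew group
  ring become those of the crossed product.\<close>

lemma alg_ring_cp: "alg_ring B (delta e) = skew_ring (alg_ring A e) G \<alpha>"
  unfolding skew_ring_def alg_ring_simps finsum_alg_ring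
  by (simp add: alg_ring_def[of B] crossed_product_simps delta_def)

lemma cp_unital_if_unital:
  assumes "unital A"
  shows "unital B"
proof -
  obtain e where e: "e \<in> carrier A" "\<And>x. x \<in> carrier A \<Longrightarrow> e \<boxtimes> x = x \<and> x \<boxtimes> e = x"
    using assms by (auto simp: unital_def)
  interpret S: skew_group_ring "alg_ring A e" G \<alpha> using e by (rule skew_group_ring_unit)
  have "alg_mult B (delta e) f = f \<and> alg_mult B f (delta e) = f" if "f \<in> carrier B" for f
    using S.skew.l_one[of f] S.skew.r_one[of f] that unfolding alg_ring_cp[symmetric] by simp
  then show ?thesis using delta_closed[OF e(1)] by (auto simp: unital_def)
qed

lemma card_group_pos: "0 < card (carrier G)"
  using finite_group G.one_closed by (auto simp: card_gt_0_iff)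

proposition dense_left_generating_tuples_unital:
  assumes "unital A" and dense: "dense_tuples A t (left_generating_tuples A t)"
    and le: "t + card (carrier G) \<le> m + 1"
  shows "dense_tuples B m (left_generating_tuples B m)"
proof -
  obtain e where e: "e \<in> carrier A" "\<And>x. x \<in> carrier A \<Longrightarrow> e \<boxtimes> x = x \<and> x \<boxtimes> e = x"
    using assms by (auto simp: unital_def)
  let ?R = "alg_ring A e"
  interpret R: submult_normed_ring ?R "alg_norm A"
    using e by (rule submult_normed_ring_unit)
  interpret S: skew_group_ring ?R G \<alpha> using e by (rule skew_group_ring_unit)
  have ud: "R.unimodular_dense k" if "t \<le> k" for k
    using unimodular_dense_if_dense_tuples[OF R.submult_normed_ring_axioms dense that, of 1]
    by (simp add: a_minus_eq alg_dist_def)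
  show ?thesis
    unfolding dense_tuples_def
  proof (intro ballI allI impI)
    fix a and \<epsilon> :: real assume a: "a \<in> {..<m} \<rightarrow>\<^sub>E carrier B" and "\<epsilon> > 0"
    \<comment> \<open>There are \<open>card (carrier G)\<close> coefficients, and the enveloping
      norm is at most the sum of their norms.\<close>
    define \<delta> where "\<delta> = \<epsilon> / card (carrier G)"
    have \<delta>: "\<delta> > 0" using \<open>\<epsilon> > 0\<close> card_group_pos by (simp add: \<delta>_def)
    have "a \<in> {..<m} \<rightarrow> carrier G \<rightarrow> carrier ?R"
      using a by (auto intro!: cp_apply_closed)
    moreover have "carrier G \<noteq> {}" using G.one_closed by blast
    ultimately obtain Y where Y: "Y \<in> {..<m} \<rightarrow> carrier G \<rightarrow> carrier ?R"
      and close: "\<forall>i<m. \<forall>s\<in>carrier G. alg_norm A (a i s \<ominus>\<^bsub>?R\<^esub> Y i s) < \<delta>"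
      and span: "R.rows_span (carrier G) m Y"
      using R.rows_span_perturb[OF finite_group _ ud le _ \<delta>] by blast
    define z where "z = (\<lambda>i\<in>{..<m}. restrict (Y i) (carrier G))"
    have z: "z \<in> {..<m} \<rightarrow>\<^sub>E carrier B"
      using Y by (auto simp: z_def crossed_product_simps Pi_iff)
    have "S.skew.unimodular m (\<lambda>i. restrict (Y i) (carrier G))"
      using Y span by (rule S.unimodular_skew_if_rows_span)
    then have "S.skew.unimodular m z"
      using Y by (rule_tac S.skew.unimodular_cong) (auto simp: z_def Pi_iff skew_ring_simps(1))
    then have "z \<in> left_generating_tuples B m"
      using z S.skew.ring_axioms unfolding alg_ring_cp[symmetric]
      by (intro left_generating_tuple_if_unimodular)
    moreover have "alg_dist B (a i) (z i) < \<epsilon>" if i: "i < m" for i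
    proof -
      have ai: "a i \<in> carrier B" "z i \<in> carrier B" using a z i by auto
      have "alg_dist B (a i) (z i) \<le> (\<Sum>s\<in>carrier G. alg_dist A (a i s) (z i s))"
        using cp_diff_norm_le[OF ai] by (simp add: alg_dist_def[of B])
      also have "\<dots> < (\<Sum>s\<in>carrier G. \<delta>)"
      proof (rule sum_strict_mono)
        fix s assume s: "s \<in> carrier G"
        then show "alg_dist A (a i s) (z i s) < \<delta>"
          using close i Y by (auto simp: z_def alg_dist_def a_minus_eq Pi_iff)
      qed (use finite_group G.one_closed in blast)+
      also have "\<dots> = \<epsilon>" using card_group_pos by (simp add: \<delta>_def)
      finally show ?thesis .
    qed
    ultimately show "\<exists>b\<in>left_generating_tuples B m. \<forall>i<m. alg_dist B (a i) (b i) < \<epsilon>" by blast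
  qed
qed

end

section \<open>The skew group ring of the unitization\<close>

context cstar_action
begin

abbreviation "U \<equiv> alg_ring (unitization A) (alg_zero A, 1)"

definition act_unitization :: "'g \<Rightarrow> 'a \<times> complex \<Rightarrow> 'a \<times> complex" where
  "act_unitization g x = (\<alpha> g (fst x), snd x)"

lemma skew_group_ring_unitization: "skew_group_ring U G act_unitization"
proof -
  interpret ring U by (rule unitization_ring)
  show ?thesis
    by unfold_locales
      (auto simp: act_unitization_def finite_group act_closed act_add act_mult act_scale act_comp
        act_id act_zero mult_closed scale_closed)
qed

end

sublocale cstar_action \<subseteq> U: submult_normed_ring U NU
  by (rule unitization_normed_ring)

sublocale cstar_action \<subseteq> S: skew_group_ring U G act_unitization
  by (rule skew_group_ring_unitization)

context cstar_action
begin

section \<open>Components of the skew group ring in A and in the group algebra\<close>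

abbreviation skew_mult (infixl \<open>\<star>\<close> 70) where "P \<star> Q \<equiv> P \<otimes>\<^bsub>S.D\<^esub> Q"

lemma carrier_skew: "carrier S.D = carrier G \<rightarrow>\<^sub>E carrier A \<times> UNIV"
  by (simp add: skew_ring_simps)

lemma skew_fst_closed: "\<lbrakk>P \<in> carrier S.D; s \<in> carrier G\<rbrakk> \<Longrightarrow> fst (P s) \<in> carrier A"
  by (auto simp: carrier_skew PiE_iff mem_Times_iff)

lemma unitization_sum:
  "\<lbrakk>finite I; F \<in> I \<rightarrow> carrier A \<times> UNIV\<rbrakk> \<Longrightarrow>
    alg_sum (unitization A) F I = (alg_sum A (\<lambda>i. fst (F i)) I, \<Sum>i\<in>I. snd (F i))"
proof (induction I rule: finite_induct)
  case empty
  then show ?case using U.finsum_empty[of F] by simp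
next
  case (insert i I)
  then have cl: "F \<in> I \<rightarrow> carrier A \<times> UNIV" "F i \<in> carrier A \<times> UNIV" by auto
  have "alg_sum (unitization A) F (insert i I) = alg_add (unitization A) (F i) (alg_sum (unitization A) F I)"
    using insert.hyps cl U.finsum_insert[of I i F] by simp
  also have "\<dots> = alg_add (unitization A) (F i) (alg_sum A (\<lambda>i. fst (F i)) I, \<Sum>i\<in>I. snd (F i))"
    using insert.IH cl by simp
  also have "\<dots> = (fst (F i) \<boxplus> alg_sum A (\<lambda>i. fst (F i)) I, snd (F i) + (\<Sum>i\<in>I. snd (F i)))"
    by (cases "F i") simp
  also have "fst (F i) \<boxplus> alg_sum A (\<lambda>i. fst (F i)) I = alg_sum A (\<lambda>i. fst (F i)) (insert i I)"
    using insert.hyps cl by (intro sum_insert[symmetric]) (auto simp: Pi_iff mem_Times_iff)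
  finally show ?case using insert.hyps by simp
qed

text \<open>The scalar parts multiply by convolution, as in the group algebra, because the action
  fixes scalars.\<close>

lemma skew_mult_proj:
  assumes P: "P \<in> carrier S.D" and Q: "Q \<in> carrier S.D" and s: "s \<in> carrier G"
  shows "fst ((P \<star> Q) s) = alg_sum A (\<lambda>t. fst (P t) \<boxtimes> \<alpha> t (fst (Q (inv\<^bsub>G\<^esub> t \<otimes>\<^bsub>G\<^esub> s))) \<boxplus>
      (snd (P t) \<odot> \<alpha> t (fst (Q (inv\<^bsub>G\<^esub> t \<otimes>\<^bsub>G\<^esub> s))) \<boxplus> snd (Q (inv\<^bsub>G\<^esub> t \<otimes>\<^bsub>G\<^esub> s)) \<odot> fst (P t)))
      (carrier G)" (is "_ = ?F")
    and "snd ((P \<star> Q) s) = (\<Sum>t\<in>carrier G. snd (P t) * snd (Q (inv\<^bsub>G\<^esub> t \<otimes>\<^bsub>G\<^esub> s)))" (is "_ = ?S")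
proof -
  have "(P \<star> Q) s = alg_sum (unitization A)
      (\<lambda>t. alg_mult (unitization A) (P t) (act_unitization t (Q (inv\<^bsub>G\<^esub> t \<otimes>\<^bsub>G\<^esub> s)))) (carrier G)"
    using S.skew_mult_apply[OF s, of P Q] by simp
  also have "\<dots> = (?F, ?S)"
    using S.skew_term_closed[OF P Q s] finite_group
    by (subst unitization_sum) (auto simp: act_unitization_def)
  finally show "fst ((P \<star> Q) s) = ?F" "snd ((P \<star> Q) s) = ?S" by simp_all
qed

lemma skew_add_proj:
  assumes "s \<in> carrier G"
  shows "fst ((P \<oplus>\<^bsub>S.D\<^esub> Q) s) = fst (P s) \<boxplus> fst (Q s)" "snd ((P \<oplus>\<^bsub>S.D\<^esub> Q) s) = snd (P s) + snd (Q s)"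
  using assms by (simp_all add: skew_ring_simps)

text \<open>The unitization of B sits in the skew group ring as the elements whose scalar part is
  concentrated at the identity; in general the scalar part is any element of the group
  algebra.\<close>

definition embed :: "('g \<Rightarrow> 'a) \<times> complex \<Rightarrow> 'g \<Rightarrow> 'a \<times> complex" where
  "embed z = (\<lambda>s\<in>carrier G. (fst z s, if s = \<one>\<^bsub>G\<^esub> then snd z else 0))"

lemma embed_closed: "z \<in> carrier (unitization B) \<Longrightarrow> embed z \<in> carrier S.D"
  unfolding embed_def carrier_skew
  by (rule restrict_PiE_iff[THEN iffD2]) (auto simp: cp_apply_closed)

lemma skew_ext:
  assumes "P \<in> carrier S.D" "Q \<in> carrier S.D"
    and "\<And>s. s \<in> carrier G \<Longrightarrow> fst (P s) = fst (Q s) \<and> snd (P s) = snd (Q s)"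
  shows "P = Q"
proof (rule extensionalityI[of _ "carrier G"])
  show "P \<in> extensional (carrier G)" "Q \<in> extensional (carrier G)"
    using assms by (auto simp: carrier_skew PiE_iff)
  show "P s = Q s" if "s \<in> carrier G" for s using assms(3)[OF that] by (simp add: prod_eq_iff)
qed

lemma inv_mult_eq_one_iff:
  "\<lbrakk>t \<in> carrier G; s \<in> carrier G\<rbrakk> \<Longrightarrow> inv\<^bsub>G\<^esub> t \<otimes>\<^bsub>G\<^esub> s = \<one>\<^bsub>G\<^esub> \<longleftrightarrow> t = s"
  by (metis G.inv_closed G.inv_comm G.inv_equality G.inv_inv G.l_inv)

text \<open>The left factor comes from B, as do the multipliers with which left ideals are tested
  below. The scalar \<open>d\<close> enters through the single term \<open>t = s\<close>, as
  \<open>d \<odot> f s\<close>.\<close>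

lemma embed_mult:
  assumes f: "f \<in> carrier B" and h: "h \<in> carrier B"
  shows "embed (f, 0) \<star> embed (h, d) = embed (alg_mult (unitization B) (f, 0) (h, d))"
proof (rule skew_ext)
  show "embed (f, 0) \<star> embed (h, d) \<in> carrier S.D"
    using f h by (intro S.skew.m_closed embed_closed) auto
  show "embed (alg_mult (unitization B) (f, 0) (h, d)) \<in> carrier S.D"
    using f h by (intro embed_closed cp_unitization_mult_closed) auto
  fix s assume s: "s \<in> carrier G"
  have fc: "f t \<in> carrier A" and hc: "h t \<in> carrier A" if "t \<in> carrier G" for t
    using f h that by (auto intro: cp_apply_closed)
  have fhD: "embed (f, 0) \<in> carrier S.D" "embed (h, d) \<in> carrier S.D"
    using f h by (auto intro!: embed_closed)
  have "snd ((embed (f, 0) \<star> embed (h, d)) s) = 0"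
    unfolding skew_mult_proj[OF fhD s] using s by (auto simp: embed_def intro!: sum.neutral)
  moreover have "fst ((embed (f, 0) \<star> embed (h, d)) s) =
      alg_sum A (\<lambda>t. f t \<boxtimes> \<alpha> t (h (inv\<^bsub>G\<^esub> t \<otimes>\<^bsub>G\<^esub> s)) \<boxplus>
        (if t = s then d \<odot> f t else alg_zero A)) (carrier G)"
    unfolding skew_mult_proj[OF fhD s] using s fc hc
    by (intro ab.finsum_cong')
      (auto simp: embed_def inv_mult_eq_one_iff scale_zero_left act_closed scale_closed mult_closed)
  moreover have "\<dots> = alg_sum A (\<lambda>t. f t \<boxtimes> \<alpha> t (h (inv\<^bsub>G\<^esub> t \<otimes>\<^bsub>G\<^esub> s))) (carrier G) \<boxplus>
      alg_sum A (\<lambda>t. if t = s then d \<odot> f t else alg_zero A) (carrier G)"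
    using s fc hc by (intro ab.finsum_addf) (auto simp: act_closed scale_closed mult_closed)
  moreover have "alg_sum A (\<lambda>t. if t = s then d \<odot> f t else alg_zero A) (carrier G) = d \<odot> f s"
    using s fc finite_group by (subst ab.finsum_eq_single[of _ s]) (auto simp: scale_closed)
  ultimately show "fst ((embed (f, 0) \<star> embed (h, d)) s) =
      fst (embed (alg_mult (unitization B) (f, 0) (h, d)) s) \<and>
    snd ((embed (f, 0) \<star> embed (h, d)) s) =
      snd (embed (alg_mult (unitization B) (f, 0) (h, d)) s)"
    using s fc hc by (auto simp: embed_def crossed_product_simps scale_zero_left scale_closed)
qed

lemma embed_add:
  assumes "z \<in> carrier (unitization B)" "w \<in> carrier (unitization B)"
  shows "embed z \<oplus>\<^bsub>S.D\<^esub> embed w = embed (alg_add (unitization B) z w)"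
  using assms by (auto simp: embed_def skew_ring_simps crossed_product_simps restrict_def fun_eq_iff)

lemma embed_inj:
  assumes "z \<in> carrier (unitization B)" "w \<in> carrier (unitization B)" "embed z = embed w"
  shows "z = w"
proof -
  have eq: "fst z s = fst w s" "s = \<one>\<^bsub>G\<^esub> \<longrightarrow> snd z = snd w" if "s \<in> carrier G" for s
    using fun_cong[OF assms(3), of s] that by (auto simp: embed_def)
  then have "fst z = fst w" using assms by (intro cp_ext) auto
  moreover have "snd z = snd w" using eq(2)[of "\<one>\<^bsub>G\<^esub>"] by simp
  ultimately show ?thesis by (simp add: prod_eq_iff)
qed

lemma embed_if_scalar_part:
  assumes "P \<in> carrier S.D" "\<And>s. s \<in> carrier G \<Longrightarrow> snd (P s) = (if s = \<one>\<^bsub>G\<^esub> then c else 0)"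
  shows "embed (\<lambda>s\<in>carrier G. fst (P s), c) = P" "(\<lambda>s\<in>carrier G. fst (P s)) \<in> carrier B"
proof -
  show cl: "(\<lambda>s\<in>carrier G. fst (P s)) \<in> carrier B"
    using skew_fst_closed[OF assms(1)] by (auto simp: crossed_product_simps)
  show "embed (\<lambda>s\<in>carrier G. fst (P s), c) = P"
    using cl assms by (intro skew_ext embed_closed) (auto simp: embed_def)
qed

text \<open>The crossed product is a right ideal of the skew group ring of the unitization, hence
  the multipliers of a unimodular tuple may be moved into it.\<close>

lemma left_generating_if_embed_unimodular:
  assumes z: "z \<in> {..<m} \<rightarrow>\<^sub>E carrier (unitization B)"
    and uni: "S.skew.unimodular m (\<lambda>i. embed (z i))" and k: "k < m" "snd (z k) \<noteq> 0"
  shows "z \<in> left_generating_tuples (unitization B) m"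
proof (rule left_generating_tuplesI[OF cp_unitization_abelian_group cp_unitization_mult_closed z])
  fix I assume I: "left_ideal (unitization B) I" and zI: "\<And>i. i < m \<Longrightarrow> z i \<in> I"
  interpret B: abelian_group "alg_ring B (alg_zero B)" by (rule cp_abelian_group)
  have zc: "z i \<in> carrier (unitization B)" if "i < m" for i using z that by auto
  obtain r where r: "r \<in> {..<m} \<rightarrow> carrier S.D"
    and one: "(\<Oplus>\<^bsub>S.D\<^esub>i\<in>{..<m}. r i \<star> embed (z i)) = \<one>\<^bsub>S.D\<^esub>"
    using uni by (auto simp: S.skew.unimodular_def)
  have bI: "(b, 0) \<in> I" if b: "b \<in> carrier B" for b
  proof -
    have bD: "embed (b, 0) \<in> carrier S.D" using b by (intro embed_closed) auto
    define P where "P i = embed (b, 0) \<star> r i" for i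
    define f where "f i = (\<lambda>s\<in>carrier G. fst (P i s))" for i
    have P: "P i \<in> carrier S.D" "embed (f i, 0) = P i" "f i \<in> carrier B" if "i < m" for i
    proof -
      have ri: "r i \<in> carrier S.D" using r that by auto
      show PD: "P i \<in> carrier S.D" unfolding P_def using bD ri by (rule S.skew.m_closed)
      have "snd (P i s) = 0" if "s \<in> carrier G" for s
        unfolding P_def skew_mult_proj[OF bD ri that] by (auto simp: embed_def intro!: sum.neutral)
      then show "embed (f i, 0) = P i" "f i \<in> carrier B"
        unfolding f_def using embed_if_scalar_part[OF PD, of 0] by auto
    qed
    define w where "w i = alg_mult (unitization B) (f i, 0) (z i)" for i
    have w: "w i \<in> I" "w i \<in> carrier (unitization B)" "embed (w i) = P i \<star> embed (z i)"
      if "i < m" for i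
    proof -
      show "w i \<in> I" unfolding w_def using P that zI left_idealD(4)[OF I] by auto
      then show "w i \<in> carrier (unitization B)" using left_idealD(1)[OF I] by auto
      show "embed (w i) = P i \<star> embed (z i)"
        using embed_mult[of "f i" "fst (z i)" "snd (z i)"] P[OF that] zc[OF that]
        by (auto simp: w_def)
    qed
    have "embed (b, 0) = embed (b, 0) \<star> (\<Oplus>\<^bsub>S.D\<^esub>i\<in>{..<m}. r i \<star> embed (z i))"
      unfolding one using bD by simp
    also have "\<dots> = (\<Oplus>\<^bsub>S.D\<^esub>i\<in>{..<m}. embed (b, 0) \<star> (r i \<star> embed (z i)))"
      using r zc bD by (intro S.skew.finsum_rdistr) (auto intro!: S.skew.m_closed embed_closed)
    also have "\<dots> = (\<Oplus>\<^bsub>S.D\<^esub>i\<in>{..<m}. embed (w i))"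
      using r zc bD w by (intro S.skew.finsum_cong')
        (auto simp: P_def Pi_iff S.skew.m_assoc embed_closed simp del: unitization_simps)
    finally have sum: "embed (b, 0) = (\<Oplus>\<^bsub>S.D\<^esub>i\<in>{..<m}. embed (w i))" .
    \<comment> \<open>The sum is formed in the skew ring. Induction on its length pulls it back
      along \<open>embed\<close> to an element of \<open>I\<close>.\<close>
    have "\<exists>v\<in>I. (\<Oplus>\<^bsub>S.D\<^esub>i\<in>{..<k}. embed (w i)) = embed v" if "k \<le> m" for k
      using that
    proof (induction k)
      case 0
      have "embed (alg_zero (unitization B)) = \<zero>\<^bsub>S.D\<^esub>"
        by (auto simp: embed_def skew_ring_simps crossed_product_simps restrict_def fun_eq_iff)
      then show ?case using left_idealD(2)[OF I] S.skew.finsum_empty by (intro bexI) auto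
    next
      case (Suc k)
      then obtain v where v: "v \<in> I" "(\<Oplus>\<^bsub>S.D\<^esub>i\<in>{..<k}. embed (w i)) = embed v" by auto
      have vc: "v \<in> carrier (unitization B)" using v left_idealD(1)[OF I] by auto
      have "(\<Oplus>\<^bsub>S.D\<^esub>i\<in>{..<Suc k}. embed (w i)) = embed (w k) \<oplus>\<^bsub>S.D\<^esub> embed v"
        unfolding v(2)[symmetric] lessThan_Suc using Suc.prems w(2)
        by (intro S.skew.finsum_insert) (auto intro!: embed_closed simp del: unitization_simps)
      also have "\<dots> = embed (alg_add (unitization B) (w k) v)"
        using w(2)[of k] Suc.prems vc by (intro embed_add) auto
      finally show ?case using left_idealD(3)[OF I w(1)[of k] v(1)] Suc.prems by auto
    qed
    from this[OF order_refl] obtain v where v: "v \<in> I" "(\<Oplus>\<^bsub>S.D\<^esub>i\<in>{..<m}. embed (w i)) = embed v"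
      by auto
    have "(b, 0) = v"
      using sum b v left_idealD(1)[OF I] by (intro embed_inj) auto
    then show ?thesis using v by simp
  qed
  \<comment> \<open>At this point \<open>I\<close> contains B. Subtracting its part in B from an
    entry with nonzero scalar leaves the pure scalar \<open>c\<close> in \<open>I\<close>, and
    division by \<open>c\<close> yields all scalars.\<close>
  obtain y c where zk: "z k = (y, c)" "y \<in> carrier B" using zc[OF k(1)] by auto
  have "alg_add (unitization B) (a_inv (alg_ring B (alg_zero B)) y, 0) (z k) \<in> I"
    using zk B.a_inv_closed[of y] by (intro left_idealD(3)[OF I] bI zI k) auto
  then have c: "(alg_zero B, c) \<in> I" using zk B.l_neg[of y] by simp
  show "carrier (unitization B) \<subseteq> I"
  proof
    fix x assume "x \<in> carrier (unitization B)"
    then obtain b d where x: "x = (b, d)" "b \<in> carrier B" by auto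
    have "alg_mult B (alg_zero B) (alg_zero B) = alg_zero B"
    proof (rule cp_ext)
      fix s assume "s \<in> carrier G"
      then show "alg_mult B (alg_zero B) (alg_zero B) s = alg_zero B s"
        by (auto simp: crossed_product_simps mult_zero_left act_zero intro!: ab.add.finprod_one_eqI)
    qed (auto intro: cp_closed)
    moreover have "alg_scale B e (alg_zero B) = alg_zero B" for e
      by (auto simp: crossed_product_simps scale_zero_right restrict_def fun_eq_iff)
    ultimately have "alg_mult (unitization B) (alg_zero B, d / c) (alg_zero B, c) = (alg_zero B, d)"
      using k zk B.l_zero[of "alg_zero B"] cp_closed(5) by simp
    then have "(alg_zero B, d) \<in> I"
      using left_idealD(4)[OF I _ c, of "(alg_zero B, d / c)"] cp_closed(5) by simp
    then have "alg_add (unitization B) (b, 0) (alg_zero B, d) \<in> I"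
      by (intro left_idealD(3)[OF I] bI x)
    then show "x \<in> I" using x B.r_zero[of b] by simp
  qed
qed

text \<open>The numbers \<open>c\<close> are the scalar parts of the multipliers that produce the
  unit row; taking scalar parts is a ring homomorphism from the unitization to the complex numbers.
  They record a relation between the scalar parts of \<open>Y\<close>, which closeness in
  \<open>NU\<close> alone need not control.\<close>

lemma unimodular_rows_near:
  assumes dense: "dense_tuples (unitization A) t (left_generating_tuples (unitization A) t)"
    and le: "t + card (carrier G) \<le> m + 1"
    and X: "X \<in> {..<m} \<rightarrow> carrier S.D" and "\<delta> > 0"
  shows "\<exists>Y\<in>{..<m} \<rightarrow> carrier S.D.
    (\<forall>i<m. \<forall>s\<in>carrier G. NU (X i s \<ominus>\<^bsub>U\<^esub> Y i s) < \<delta>) \<and> S.skew.unimodular m Y \<and>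
    (\<exists>c. \<forall>s\<in>carrier G. (\<Sum>i<m. c i * snd (Y i s)) = (if s = \<one>\<^bsub>G\<^esub> then 1 else 0))"
proof -
  have ud: "U.unimodular_dense k" if "t \<le> k" for k
  proof (rule unimodular_dense_if_dense_tuples[OF U.submult_normed_ring_axioms dense that, of 1])
    fix x y assume "x \<in> carrier (unitization A)" "y \<in> carrier (unitization A)"
    then show "NU (x \<ominus>\<^bsub>U\<^esub> y) \<le> 1 * alg_dist (unitization A) x y"
      using unitization_a_minus by (simp add: alg_dist_def)
  qed simp
  have "X \<in> {..<m} \<rightarrow> carrier G \<rightarrow> carrier U" using X by (auto simp: carrier_skew Pi_iff PiE_iff)
  moreover have "carrier G \<noteq> {}" using G.one_closed by blast
  ultimately obtain Y where Y: "Y \<in> {..<m} \<rightarrow> carrier G \<rightarrow> carrier U"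
    and close: "\<forall>i<m. \<forall>s\<in>carrier G. NU (X i s \<ominus>\<^bsub>U\<^esub> Y i s) < \<delta>"
    and span: "U.rows_span (carrier G) m Y"
    using U.rows_span_perturb[OF finite_group _ ud le _ \<open>\<delta> > 0\<close>] by blast
  have Yc: "Y i s \<in> carrier A \<times> UNIV" if "i < m" "s \<in> carrier G" for i s using Y that by auto
  have "(\<lambda>s. if s = \<one>\<^bsub>G\<^esub> then \<one>\<^bsub>U\<^esub> else \<zero>\<^bsub>U\<^esub>) \<in> carrier G \<rightarrow> carrier U" by auto
  from span[unfolded U.rows_span_def, THEN bspec, OF this] obtain r where r: "r \<in> {..<m} \<rightarrow> carrier U"
    and one: "\<And>s. s \<in> carrier G \<Longrightarrow>
      (if s = \<one>\<^bsub>G\<^esub> then \<one>\<^bsub>U\<^esub> else \<zero>\<^bsub>U\<^esub>) = (\<Oplus>\<^bsub>U\<^esub>i\<in>{..<m}. r i \<otimes>\<^bsub>U\<^esub> Y i s)"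
    by blast
  have scalar: "(\<Sum>i<m. snd (r i) * snd (Y i s)) = (if s = \<one>\<^bsub>G\<^esub> then 1 else 0)" if s: "s \<in> carrier G" for s
  proof -
    have "(\<lambda>i. alg_mult (unitization A) (r i) (Y i s)) \<in> {..<m} \<rightarrow> carrier A \<times> UNIV"
      using r Yc s U.m_closed by (auto simp: Pi_iff)
    then have "snd (\<Oplus>\<^bsub>U\<^esub>i\<in>{..<m}. r i \<otimes>\<^bsub>U\<^esub> Y i s) = (\<Sum>i<m. snd (r i) * snd (Y i s))"
      by (simp add: unitization_sum)
    then show ?thesis unfolding one[OF s, symmetric] by auto
  qed
  define Z where "Z i = restrict (Y i) (carrier G)" for i
  have "S.skew.unimodular m Z"
    unfolding Z_def using Y span by (rule S.unimodular_skew_if_rows_span)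
  moreover have "Z \<in> {..<m} \<rightarrow> carrier S.D" using Yc by (auto simp: Z_def carrier_skew)
  moreover have "Z i s = Y i s" if "s \<in> carrier G" for i s using that by (simp add: Z_def)
  ultimately show ?thesis using close scalar
    by (intro bexI[of _ Z] conjI exI[of _ "\<lambda>i. snd (r i)"]) auto
qed

text \<open>Zero scalars are moved to \<open>\<epsilon> / 2\<close>, and the other half of
  \<open>\<epsilon>\<close> is left for the parts in B. From then on the scalars are prescribed and
  nonzero, so that they can serve as divisors in the corrections below.\<close>

lemma dense_if_scalars_fixed:
  assumes "0 < m" and approx: "\<And>x c \<epsilon>. \<lbrakk>x \<in> {..<m} \<rightarrow> carrier B; \<And>i. c i \<noteq> 0; \<epsilon> > 0\<rbrakk> \<Longrightarrow>
      \<exists>f\<in>{..<m} \<rightarrow> carrier B. (\<forall>i<m. alg_norm B (alg_add B (x i) (alg_scale B (-1) (f i))) < \<epsilon>) \<and>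
        S.skew.unimodular m (\<lambda>i. embed (f i, c i))"
  shows "dense_tuples (unitization B) m (left_generating_tuples (unitization B) m)"
  unfolding dense_tuples_def
proof (intro ballI allI impI)
  fix a and \<epsilon> :: real assume a: "a \<in> {..<m} \<rightarrow>\<^sub>E carrier (unitization B)" and "\<epsilon> > 0"
  have ac: "fst (a i) \<in> carrier B" if "i < m" for i using a that by (auto simp: PiE_iff mem_Times_iff)
  define c where "c i = (if snd (a i) = 0 then complex_of_real (\<epsilon> / 2) else snd (a i))" for i
  have c: "c i \<noteq> 0" "cmod (snd (a i) - c i) \<le> \<epsilon> / 2" for i
    using \<open>\<epsilon> > 0\<close> by (auto simp: c_def norm_divide)
  have "(\<lambda>i. fst (a i)) \<in> {..<m} \<rightarrow> carrier B" "\<epsilon> / 2 > 0" using ac \<open>\<epsilon> > 0\<close> by auto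
  from approx[of "\<lambda>i. fst (a i)" c, OF this(1) c(1) this(2)] obtain f where f: "f \<in> {..<m} \<rightarrow> carrier B"
    and close: "\<forall>i<m. alg_norm B (alg_add B (fst (a i)) (alg_scale B (-1) (f i))) < \<epsilon> / 2"
    and uni: "S.skew.unimodular m (\<lambda>i. embed (f i, c i))" by auto
  define z where "z = (\<lambda>i\<in>{..<m}. (f i, c i))"
  have z: "z \<in> {..<m} \<rightarrow>\<^sub>E carrier (unitization B)" using f by (auto simp: z_def)
  have "S.skew.unimodular m (\<lambda>i. embed (z i))"
    using f by (intro S.skew.unimodular_cong[OF uni]) (auto simp: z_def intro!: embed_closed)
  then have "z \<in> left_generating_tuples (unitization B) m"
    using left_generating_if_embed_unimodular[OF z, of 0] \<open>0 < m\<close> c(1) by (simp add: z_def)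
  moreover have "alg_dist (unitization B) (a i) (z i) < \<epsilon>" if i: "i < m" for i
  proof -
    have "alg_dist (unitization B) (fst (a i), snd (a i)) (f i, c i) \<le>
        alg_norm B (alg_add B (fst (a i)) (alg_scale B (-1) (f i))) + cmod (snd (a i) - c i)"
      using ac i f by (intro cp_unitization_dist_le) auto
    moreover have "alg_norm B (alg_add B (fst (a i)) (alg_scale B (-1) (f i))) < \<epsilon> / 2"
      using close i by simp
    ultimately show ?thesis using c(2)[of i] i by (simp add: z_def)
  qed
  ultimately show "\<exists>b\<in>left_generating_tuples (unitization B) m. \<forall>i<m. alg_dist (unitization B) (a i) (b i) < \<epsilon>"
    by blast
qed

end

section \<open>Unbounded scalars\<close>

context cstar_action
begin

lemma skew_apply_closed_U: "\<lbrakk>P \<in> carrier S.D; s \<in> carrier G\<rbrakk> \<Longrightarrow> P s \<in> carrier U"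
  by (rule S.skew_apply_closed)

lemma snd_skew_mult_const_left:
  assumes "P \<in> carrier S.D" "Q \<in> carrier S.D" "s \<in> carrier G"
    and "\<And>t. t \<in> carrier G \<Longrightarrow> snd (P t) = (if t = \<one>\<^bsub>G\<^esub> then c else 0)"
  shows "snd ((P \<star> Q) s) = c * snd (Q s)"
proof -
  have "snd ((P \<star> Q) s) = (\<Sum>t\<in>carrier G. if t = \<one>\<^bsub>G\<^esub> then c * snd (Q s) else 0)"
    unfolding skew_mult_proj[OF assms(1-3)] using assms by (intro sum.cong) auto
  then show ?thesis using finite_group by simp
qed

lemma snd_skew_mult_const_right:
  assumes "P \<in> carrier S.D" "Q \<in> carrier S.D" "s \<in> carrier G"
    and "\<And>t. t \<in> carrier G \<Longrightarrow> snd (Q t) = (if t = \<one>\<^bsub>G\<^esub> then c else 0)"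
  shows "snd ((P \<star> Q) s) = snd (P s) * c"
proof -
  have "snd ((P \<star> Q) s) = (\<Sum>t\<in>carrier G. if t = s then snd (P s) * c else 0)"
    unfolding skew_mult_proj[OF assms(1-3)] using assms
    by (intro sum.cong) (auto simp: inv_mult_eq_one_iff)
  then show ?thesis using finite_group assms(3) by simp
qed

text \<open>A lift of \<open>c\<close> is \<open>c\<close> times a lift of 1, so the demand on the
  latter is \<open>\<epsilon> / cmod c\<close>.\<close>

lemma small_lift:
  assumes small: "\<forall>\<epsilon>>0. \<exists>a\<in>carrier A. NU (a, 1) < \<epsilon>" and "\<epsilon> > 0"
  shows "\<exists>a\<in>carrier A. NU (a, c) < \<epsilon>"
proof (cases "c = 0")
  case True
  then show ?thesis using U.N_zero \<open>\<epsilon> > 0\<close> by (intro bexI[of _ "alg_zero A"]) auto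
next
  case False
  then have "\<epsilon> / cmod c > 0" using \<open>\<epsilon> > 0\<close> by simp
  from small[rule_format, OF this] obtain a where a: "a \<in> carrier A" "NU (a, 1) < \<epsilon> / cmod c" by auto
  have "NU (c \<odot> a, c) \<le> cmod c * NU (a, 1)"
    using unitization_norm_scale[OF a(1), of c 1] by simp
  also have "\<dots> < \<epsilon>" using a(2) False by (simp add: field_simps)
  finally show ?thesis using a(1) scale_closed by blast
qed

text \<open>The coefficients of \<open>\<tau>\<close> are chosen independently, as lifts of the
  prescribed scalars with norm below \<open>\<kappa>\<close>. With \<open>Q\<close> fixed, each
  coefficient of the product is then at most \<open>\<kappa> * M\<close>, where \<open>M\<close>
  adds up the norms of all coefficients of \<open>Q\<close> moved by the group.\<close>

lemma small_multiplier:
  assumes small: "\<forall>\<epsilon>>0. \<exists>a\<in>carrier A. NU (a, 1) < \<epsilon>"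
    and Q: "Q \<in> carrier S.D" and "\<eta> > 0"
  shows "\<exists>\<tau>\<in>carrier S.D. (\<forall>s\<in>carrier G. snd (\<tau> s) = \<sigma> s \<and> NU ((\<tau> \<star> Q) s) < \<eta>)"
proof -
  let ?b = "\<lambda>s t. act_unitization t (Q (inv\<^bsub>G\<^esub> t \<otimes>\<^bsub>G\<^esub> s))"
  have b: "?b s t \<in> carrier U" if "s \<in> carrier G" "t \<in> carrier G" for s t
    using that Q by (intro S.act_closed skew_apply_closed_U) auto
  define M where "M = (\<Sum>s\<in>carrier G. \<Sum>t\<in>carrier G. NU (?b s t))"
  have M_ge: "(\<Sum>t\<in>carrier G. NU (?b s t)) \<le> M" if "s \<in> carrier G" for s
    unfolding M_def using that b finite_group U.N_nonneg
    by (intro member_le_sum sum_nonneg) auto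
  have "M \<ge> 0" unfolding M_def using b U.N_nonneg by (intro sum_nonneg) auto
  define \<kappa> where "\<kappa> = \<eta> / (M + 1)"
  have \<kappa>: "\<kappa> > 0" "\<kappa> * M < \<eta>"
    using \<open>M \<ge> 0\<close> \<open>\<eta> > 0\<close> by (auto simp: \<kappa>_def field_simps)
  have "\<forall>t. \<exists>a. a \<in> carrier A \<and> NU (a, \<sigma> t) < \<kappa>"
    using small_lift[OF small \<kappa>(1)] by blast
  from choice[OF this] obtain a
    where a: "\<And>t. a t \<in> carrier A" "\<And>t. NU (a t, \<sigma> t) < \<kappa>" by blast
  define \<tau> where "\<tau> = (\<lambda>t\<in>carrier G. (a t, \<sigma> t))"
  have \<tau>: "\<tau> \<in> carrier S.D" using a by (auto simp: \<tau>_def carrier_skew)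
  have "NU ((\<tau> \<star> Q) s) < \<eta>" if s: "s \<in> carrier G" for s
  proof -
    have "NU ((\<tau> \<star> Q) s) \<le> (\<Sum>t\<in>carrier G. NU (\<tau> t \<otimes>\<^bsub>U\<^esub> ?b s t))"
      unfolding S.skew_mult_apply[OF s]
      by (intro U.N_finsum finite_group) (auto intro!: S.skew_term_closed[OF \<tau> Q s] simp del: alg_ring_simps)
    also have "\<dots> \<le> (\<Sum>t\<in>carrier G. \<kappa> * NU (?b s t))"
    proof (rule sum_mono)
      fix t assume t: "t \<in> carrier G"
      have "NU (\<tau> t \<otimes>\<^bsub>U\<^esub> ?b s t) \<le> NU (\<tau> t) * NU (?b s t)"
        using skew_apply_closed_U[OF \<tau> t] b[OF s t] by (rule U.N_mult)
      also have "\<dots> \<le> \<kappa> * NU (?b s t)"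
        using a(2)[of t] t U.N_nonneg[OF b[OF s t]]
        by (intro mult_right_mono) (auto simp: \<tau>_def)
      finally show "NU (\<tau> t \<otimes>\<^bsub>U\<^esub> ?b s t) \<le> \<kappa> * NU (?b s t)" .
    qed
    also have "\<dots> \<le> \<kappa> * M"
      unfolding sum_distrib_left[symmetric] using M_ge[OF s] \<kappa>(1) by (intro mult_left_mono) auto
    finally show ?thesis using \<kappa>(2) by simp
  qed
  then show ?thesis using \<tau> by (intro bexI[of _ \<tau>]) (auto simp: \<tau>_def)
qed

text \<open>When the scalar parts agree, the difference lies in A, where \<open>NU\<close> dominates
  the norm of A. In this way estimates in \<open>NU\<close> return to the crossed product.\<close>

lemma dist_le_NU:
  assumes "x \<in> carrier B" "Z \<in> carrier S.D" "s \<in> carrier G"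
    and "snd (Z s) = (if s = \<one>\<^bsub>G\<^esub> then c else 0)"
  shows "alg_dist A (x s) (fst (Z s)) \<le> NU (embed (x, c) s \<ominus>\<^bsub>U\<^esub> Z s)"
proof -
  have xs: "x s \<in> carrier A" and zs: "fst (Z s) \<in> carrier A"
    using assms by (auto intro: cp_apply_closed skew_fst_closed)
  have Zs: "Z s = (fst (Z s), if s = \<one>\<^bsub>G\<^esub> then c else 0)"
    using assms(4) by (simp add: prod_eq_iff)
  have "Z s \<in> carrier (unitization A)" using skew_apply_closed_U[OF assms(2,3)] by simp
  then have "embed (x, c) s \<ominus>\<^bsub>U\<^esub> Z s =
      alg_add (unitization A) (embed (x, c) s) (alg_scale (unitization A) (-1) (Z s))"
    by (rule unitization_a_minus)
  also have "\<dots> = (x s \<boxplus> (-1) \<odot> fst (Z s), 0)"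
    using assms(3) by (subst Zs) (simp add: embed_def)
  finally have "embed (x, c) s \<ominus>\<^bsub>U\<^esub> Z s = (x s \<boxplus> (-1) \<odot> fst (Z s), 0)" .
  then show ?thesis
    using norm_le_unitization_norm[of "x s \<boxplus> (-1) \<odot> fst (Z s)"] xs zs
    by (simp add: alg_dist_def scale_closed)
qed

text \<open>If the scalars are not bounded by the norm of the unitization, every scalar has lifts of
  arbitrarily small norm. So the scalar parts of a unimodular tuple can be changed by elementary row
  operations that hardly move the tuple.\<close>

lemma approx_if_scalars_unbounded:
  assumes small: "\<forall>\<epsilon>>0. \<exists>a\<in>carrier A. NU (a, 1) < \<epsilon>"
    and dense: "dense_tuples (unitization A) t (left_generating_tuples (unitization A) t)"
    and le: "t + card (carrier G) \<le> m + 1" and m: "2 \<le> m"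
    and x: "x \<in> {..<m} \<rightarrow> carrier B" and c: "\<And>i. c i \<noteq> 0" and "\<epsilon> > 0"
  shows "\<exists>f\<in>{..<m} \<rightarrow> carrier B. (\<forall>i<m. alg_norm B (alg_add B (x i) (alg_scale B (-1) (f i))) < \<epsilon>) \<and>
        S.skew.unimodular m (\<lambda>i. embed (f i, c i))"
proof -
  \<comment> \<open>An entry is moved at most three times, each time by less than
    \<open>\<delta>\<close>: in passing to \<open>Y\<close>, in preparing or using the pivot
    \<open>k\<close>, and in the final correction of entry \<open>k\<close>.\<close>
  define \<delta> where "\<delta> = \<epsilon> / card (carrier G) / 3"
  have \<delta>: "\<delta> > 0" using \<open>\<epsilon> > 0\<close> card_group_pos by (simp add: \<delta>_def)
  define X where "X i = embed (x i, c i)" for i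
  have X: "X i \<in> carrier S.D" if "i < m" for i
    unfolding X_def using x that by (intro embed_closed) auto
  then have "X \<in> {..<m} \<rightarrow> carrier S.D" by auto
  from unimodular_rows_near[OF dense le this \<delta>] obtain Y r where
    Y': "Y \<in> {..<m} \<rightarrow> carrier S.D"
    and XY: "\<And>i s. \<lbrakk>i < m; s \<in> carrier G\<rbrakk> \<Longrightarrow> NU (X i s \<ominus>\<^bsub>U\<^esub> Y i s) < \<delta>"
    and uniY: "S.skew.unimodular m Y"
    and r: "\<And>s. s \<in> carrier G \<Longrightarrow> (\<Sum>i<m. r i * snd (Y i s)) = (if s = \<one>\<^bsub>G\<^esub> then 1 else 0)"
    by blast
  have Y: "Y i \<in> carrier S.D" if "i < m" for i using Y' that by auto
  obtain k where k: "k < m" "r k \<noteq> 0"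
  proof -
    have "\<exists>k<m. r k \<noteq> 0"
    proof (rule ccontr)
      assume "\<not> (\<exists>k<m. r k \<noteq> 0)"
      then have "(\<Sum>i<m. r i * snd (Y i \<one>\<^bsub>G\<^esub>)) = 0" by (intro sum.neutral) auto
      then show False using r[of "\<one>\<^bsub>G\<^esub>"] by simp
    qed
    then show ?thesis using that by blast
  qed
  let ?K = "{..<m} - {k}"
  \<comment> \<open>With multipliers of scalar part \<open>r i / r k\<close>, entry \<open>k\<close>
    collects \<open>1 / r k\<close> times the relation between the scalar parts, so its own scalar
    part becomes \<open>1 / r k\<close> at the identity and 0 elsewhere. The bound
    \<open>\<delta> / m\<close> keeps the sum of \<open>m - 1\<close> terms below
    \<open>\<delta>\<close>.\<close>
  have "\<forall>i<m. \<exists>\<rho>\<in>carrier S.D. \<forall>s\<in>carrier G.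
      snd (\<rho> s) = (if s = \<one>\<^bsub>G\<^esub> then r i / r k else 0) \<and> NU ((\<rho> \<star> Y i) s) < \<delta> / m"
    using small_multiplier[OF small Y, of _ "\<delta> / m"] \<delta> m by auto
  then obtain \<rho> where \<rho>: "\<And>i. i < m \<Longrightarrow> \<rho> i \<in> carrier S.D"
    and \<rho>_snd: "\<And>i s. \<lbrakk>i < m; s \<in> carrier G\<rbrakk> \<Longrightarrow> snd (\<rho> i s) = (if s = \<one>\<^bsub>G\<^esub> then r i / r k else 0)"
    and \<rho>_norm: "\<And>i s. \<lbrakk>i < m; s \<in> carrier G\<rbrakk> \<Longrightarrow> NU ((\<rho> i \<star> Y i) s) < \<delta> / m"
    by metis
  define P where "P = (\<Oplus>\<^bsub>S.D\<^esub>i\<in>?K. \<rho> i \<star> Y i)"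
  have \<rho>Y: "(\<lambda>i. \<rho> i \<star> Y i) \<in> ?K \<rightarrow> carrier S.D" using \<rho> Y by (auto intro: S.skew.m_closed)
  have P: "P \<in> carrier S.D" unfolding P_def using \<rho>Y by (rule S.skew.finsum_closed)
  have P_apply: "P s = (\<Oplus>\<^bsub>U\<^esub>i\<in>?K. (\<rho> i \<star> Y i) s)" if "s \<in> carrier G" for s
    unfolding P_def using \<rho>Y that by (intro S.skew_finsum_apply) auto
  have \<rho>Ys: "(\<lambda>i. (\<rho> i \<star> Y i) s) \<in> ?K \<rightarrow> carrier U" if "s \<in> carrier G" for s
    using \<rho>Y that by (auto intro!: skew_apply_closed_U simp del: alg_ring_simps)
  have P_norm: "NU (P s) < \<delta>" if s: "s \<in> carrier G" for s
  proof -
    have "NU (P s) \<le> (\<Sum>i\<in>?K. NU ((\<rho> i \<star> Y i) s))"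
      unfolding P_apply[OF s] using \<rho>Ys[OF s] by (intro U.N_finsum) auto
    also have "\<dots> \<le> (\<Sum>i\<in>?K. \<delta> / m)"
      using \<rho>_norm s by (intro sum_mono) (auto simp: less_imp_le)
    also have "\<dots> < \<delta>" using k m \<delta> by (simp add: field_simps)
    finally show ?thesis .
  qed
  define W where "W i = (if i = k then Y k \<oplus>\<^bsub>S.D\<^esub> P else Y i)" for i
  have W: "W i \<in> carrier S.D" if "i < m" for i using that Y P k by (auto simp: W_def)
  have uniW: "S.skew.unimodular m W"
    unfolding W_def P_def using uniY Y k \<rho> by (intro S.skew.unimodular_collect) auto
  have W_snd: "snd (W k s) = (if s = \<one>\<^bsub>G\<^esub> then 1 / r k else 0)" if s: "s \<in> carrier G" for s
  proof -
    have "snd (P s) = (\<Sum>i\<in>?K. snd ((\<rho> i \<star> Y i) s))"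
      unfolding P_apply[OF s] using \<rho>Ys[OF s] by (simp add: unitization_sum)
    also have "\<dots> = (\<Sum>i\<in>?K. r i / r k * snd (Y i s))"
      using s \<rho>_snd \<rho> Y by (intro sum.cong snd_skew_mult_const_left) auto
    finally have "r k * snd (W k s) = r k * snd (Y k s) + (\<Sum>i\<in>?K. r i * snd (Y i s))"
      using k s by (simp add: W_def skew_add_proj sum_distrib_left distrib_left)
    also have "\<dots> = (\<Sum>i<m. r i * snd (Y i s))"
      using k by (simp add: sum.remove[of "{..<m}" k])
    finally show ?thesis using r[OF s] k by (auto simp: field_simps split: if_splits)
  qed
  \<comment> \<open>Since entry \<open>k\<close> now has the scalar \<open>1 / r k\<close>, a
    multiplier whose scalar part is \<open>r k\<close> times the missing one brings entry
    \<open>i\<close> to the scalar \<open>c i\<close>.\<close>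
  have "\<forall>i<m. \<exists>\<tau>\<in>carrier S.D. \<forall>s\<in>carrier G.
      snd (\<tau> s) = ((if s = \<one>\<^bsub>G\<^esub> then c i else 0) - snd (Y i s)) * r k \<and>
      NU ((\<tau> \<star> W k) s) < \<delta>"
    using small_multiplier[OF small W[OF k(1)] \<delta>] by auto
  then obtain \<tau> where \<tau>: "\<And>i. i < m \<Longrightarrow> \<tau> i \<in> carrier S.D"
    and \<tau>_snd: "\<And>i s. \<lbrakk>i < m; s \<in> carrier G\<rbrakk> \<Longrightarrow>
      snd (\<tau> i s) = ((if s = \<one>\<^bsub>G\<^esub> then c i else 0) - snd (Y i s)) * r k"
    and \<tau>_norm: "\<And>i s. \<lbrakk>i < m; s \<in> carrier G\<rbrakk> \<Longrightarrow> NU ((\<tau> i \<star> W k) s) < \<delta>"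
    by metis
  define V where "V i = (if i = k then W k else W i \<oplus>\<^bsub>S.D\<^esub> \<tau> i \<star> W k)" for i
  have V: "V i \<in> carrier S.D" if "i < m" for i
    using that W \<tau> k by (auto simp: V_def intro!: S.skew.a_closed S.skew.m_closed)
  have uniV: "S.skew.unimodular m V"
    unfolding V_def using uniW W k \<tau> by (intro S.skew.unimodular_pivot) auto
  have V_snd: "snd (V i s) = (if s = \<one>\<^bsub>G\<^esub> then c i else 0)" if "i < m" "i \<noteq> k" "s \<in> carrier G" for i s
  proof -
    have "snd ((\<tau> i \<star> W k) s) = snd (\<tau> i s) * (1 / r k)"
      using that \<tau> W k W_snd by (intro snd_skew_mult_const_right) auto
    then show ?thesis using that k \<tau>_snd[OF that(1,3)] by (auto simp: V_def W_def skew_add_proj)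
  qed
  \<comment> \<open>The pivot cannot correct itself, which is why two entries are required. Entry
    \<open>j\<close> already has the scalar \<open>c j\<close>, and since this is nonzero, a
    multiple of it makes up the defect \<open>c k - 1 / r k\<close>.\<close>
  obtain j where j: "j < m" "j \<noteq> k" using m by (metis One_nat_def less_2_cases_iff
      less_le_trans zero_neq_one pos2)
  obtain \<rho>' where \<rho>': "\<rho>' \<in> carrier S.D"
    and \<rho>'_snd: "\<And>s. s \<in> carrier G \<Longrightarrow> snd (\<rho>' s) = (if s = \<one>\<^bsub>G\<^esub> then (c k - 1 / r k) / c j else 0)"
    and \<rho>'_norm: "\<And>s. s \<in> carrier G \<Longrightarrow> NU ((\<rho>' \<star> V j) s) < \<delta>"
    using small_multiplier[OF small V[OF j(1)] \<delta>,
        of "\<lambda>s. if s = \<one>\<^bsub>G\<^esub> then (c k - 1 / r k) / c j else 0"] by auto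
  \<comment> \<open>With \<open>j\<close> as the pivot only entry \<open>k\<close> is to be changed;
    the multipliers of the remaining entries are zero.\<close>
  define \<tau>' where "\<tau>' i = (if i = k then \<rho>' else \<zero>\<^bsub>S.D\<^esub>)" for i
  define Z where "Z i = (if i = j then V j else V i \<oplus>\<^bsub>S.D\<^esub> \<tau>' i \<star> V j)" for i
  have uniZ: "S.skew.unimodular m Z"
    unfolding Z_def using uniV V j \<rho>' by (intro S.skew.unimodular_pivot) (auto simp: \<tau>'_def)
  have Z_eq: "Z i = (if i = k then V k \<oplus>\<^bsub>S.D\<^esub> \<rho>' \<star> V j else V i)" if "i < m" for i
    using that V j by (auto simp: Z_def \<tau>'_def)
  have Z: "Z i \<in> carrier S.D" if "i < m" for i
    unfolding Z_eq[OF that] using that V j k \<rho>' by (auto intro!: S.skew.a_closed S.skew.m_closed)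
  have Z_snd: "snd (Z i s) = (if s = \<one>\<^bsub>G\<^esub> then c i else 0)" if i: "i < m" and s: "s \<in> carrier G" for i s
  proof (cases "i = k")
    case True
    have "snd ((\<rho>' \<star> V j) s) = (c k - 1 / r k) / c j * snd (V j s)"
      using s \<rho>' V j \<rho>'_snd by (intro snd_skew_mult_const_left) auto
    then show ?thesis using True W_snd[OF s] V_snd[OF j s] c[of j] i s
      by (simp add: Z_eq skew_add_proj V_def)
  qed (use V_snd i s Z_eq in simp)
  have add_dist: "NU (X i s \<ominus>\<^bsub>U\<^esub> (P' \<oplus>\<^bsub>S.D\<^esub> Q') s) \<le> NU (X i s \<ominus>\<^bsub>U\<^esub> P' s) + NU (Q' s)"
    if "i < m" "s \<in> carrier G" "P' \<in> carrier S.D" "Q' \<in> carrier S.D" for i s P' Q'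
  proof -
    have "(P' \<oplus>\<^bsub>S.D\<^esub> Q') s = P' s \<oplus>\<^bsub>U\<^esub> Q' s" using that(2) by (simp add: skew_ring_simps)
    then show ?thesis
      using U.N_minus_add[OF skew_apply_closed_U[OF X] skew_apply_closed_U skew_apply_closed_U] that
      by simp
  qed
  have Z_norm: "NU (X i s \<ominus>\<^bsub>U\<^esub> Z i s) < 3 * \<delta>" if i: "i < m" and s: "s \<in> carrier G" for i s
  proof (cases "i = k")
    case True
    have "NU (X k s \<ominus>\<^bsub>U\<^esub> Z k s) \<le> NU (X k s \<ominus>\<^bsub>U\<^esub> V k s) + NU ((\<rho>' \<star> V j) s)"
      unfolding Z_eq[OF k(1)] using k s V j \<rho>' by (simp add: add_dist S.skew.m_closed)
    moreover have "NU (X k s \<ominus>\<^bsub>U\<^esub> V k s) \<le> NU (X k s \<ominus>\<^bsub>U\<^esub> Y k s) + NU (P s)"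
      unfolding V_def W_def using k s Y P by (simp add: add_dist)
    ultimately show ?thesis using True XY[OF k(1) s] P_norm[OF s] \<rho>'_norm[OF s] by simp
  next
    case False
    have "NU (X i s \<ominus>\<^bsub>U\<^esub> Z i s) \<le> NU (X i s \<ominus>\<^bsub>U\<^esub> Y i s) + NU ((\<tau> i \<star> W k) s)"
      unfolding Z_eq[OF i] using False i s Y \<tau> W k
      by (simp add: V_def W_def[of i] add_dist S.skew.m_closed)
    then show ?thesis using XY[OF i s] \<tau>_norm[OF i s] \<delta> by simp
  qed
  define f where "f i = (\<lambda>s\<in>carrier G. fst (Z i s))" for i
  have f: "f i \<in> carrier B" "embed (f i, c i) = Z i" if "i < m" for i
    unfolding f_def using embed_if_scalar_part[OF Z, of i "c i"] Z_snd that by auto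
  have "alg_norm B (alg_add B (x i) (alg_scale B (-1) (f i))) < \<epsilon>" if i: "i < m" for i
  proof -
    have xi: "x i \<in> carrier B" using x i by auto
    have "alg_norm B (alg_add B (x i) (alg_scale B (-1) (f i))) \<le> (\<Sum>s\<in>carrier G. alg_dist A (x i s) (f i s))"
      using xi f i by (intro cp_diff_norm_le) auto
    also have "\<dots> < (\<Sum>s\<in>carrier G. 3 * \<delta>)"
    proof (rule sum_strict_mono)
      fix s assume s: "s \<in> carrier G"
      have "alg_dist A (x i s) (f i s) \<le> NU (X i s \<ominus>\<^bsub>U\<^esub> Z i s)"
        using dist_le_NU[OF xi Z[OF i] s Z_snd[OF i s]] s by (simp add: X_def f_def)
      then show "alg_dist A (x i s) (f i s) < 3 * \<delta>" using Z_norm[OF i s] by simp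
    qed (use finite_group G.one_closed in blast)+
    also have "\<dots> = \<epsilon>" using card_group_pos by (simp add: \<delta>_def)
    finally show ?thesis .
  qed
  moreover have "S.skew.unimodular m (\<lambda>i. embed (f i, c i))"
    using uniZ Z f(2) by (rule S.skew.unimodular_cong)
  ultimately show ?thesis using f by (intro bexI[of _ f]) auto
qed

end

section \<open>Bounded scalars\<close>

text \<open>\<open>d\<close> is the deviation of an element of the group algebra from 1 in the
  \<open>L1\<close> norm, and \<open>w\<close> is a right inverse of that element: the geometric
  series of convolution by \<open>- d\<close>, which is the map \<open>T\<close>. Each coefficient
  is off by at most \<open>\<theta> / (1 - \<theta>)\<close>, hence by
  \<open>2 * \<theta>\<close>.\<close>

lemma (in group) neumann_inverse:
  fixes d :: "'a \<Rightarrow> complex"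
  assumes fin: "finite (carrier G)" and d: "(\<Sum>t\<in>carrier G. cmod (d t)) \<le> \<theta>" and "\<theta> \<le> 1 / 2"
  shows "\<exists>w. \<forall>s\<in>carrier G. w s + (\<Sum>t\<in>carrier G. d t * w (inv t \<otimes> s)) = (if s = \<one> then 1 else 0) \<and>
    cmod (w s - (if s = \<one> then 1 else 0)) \<le> 2 * \<theta>"
proof -
  define T where "T f s = - (\<Sum>t\<in>carrier G. d t * f (inv t \<otimes> s))" for f :: "'a \<Rightarrow> complex" and s
  define e :: "'a \<Rightarrow> complex" where "e s = (if s = \<one> then 1 else 0)" for s
  define u where "u n = (T ^^ n) e" for n
  have u_Suc: "u (Suc n) s = - (\<Sum>t\<in>carrier G. d t * u n (inv t \<otimes> s))" for n s
    by (simp add: u_def T_def)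
  have \<theta>: "0 \<le> \<theta>" using d by (rule order_trans[rotated]) (simp add: sum_nonneg)
  have u_le: "cmod (u n s) \<le> \<theta> ^ n" if "s \<in> carrier G" for n s
    using that
  proof (induction n arbitrary: s)
    case 0
    then show ?case by (simp add: u_def e_def)
  next
    case (Suc n)
    have "cmod (u (Suc n) s) \<le> (\<Sum>t\<in>carrier G. cmod (d t) * cmod (u n (inv t \<otimes> s)))"
      unfolding u_Suc norm_minus_cancel by (rule sum_norm_le) (simp add: norm_mult)
    also have "\<dots> \<le> (\<Sum>t\<in>carrier G. cmod (d t) * \<theta> ^ n)"
      using Suc by (intro sum_mono mult_left_mono) auto
    also have "\<dots> \<le> \<theta> * \<theta> ^ n"
      unfolding sum_distrib_right[symmetric] using d \<theta> by (intro mult_right_mono) auto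
    finally show ?case by simp
  qed
  have sum_\<theta>: "summable (\<lambda>n. \<theta> ^ n)" using \<theta> \<open>\<theta> \<le> 1 / 2\<close> by (intro summable_geometric) auto
  have summ: "summable (\<lambda>n. u n s)" if "s \<in> carrier G" for s
    by (rule summable_comparison_test'[OF sum_\<theta>, of 0]) (rule u_le[OF that])
  define w where "w s = (\<Sum>n. u n s)" for s
  have tail: "(\<Sum>n. u (Suc n) s) = w s - e s" if "s \<in> carrier G" for s
    using suminf_split_head[OF summ[OF that]] by (simp add: w_def u_def)
  have "w s + (\<Sum>t\<in>carrier G. d t * w (inv t \<otimes> s)) = e s" if s: "s \<in> carrier G" for s
  proof -
    have "(\<Sum>t\<in>carrier G. d t * w (inv t \<otimes> s)) = (\<Sum>t\<in>carrier G. \<Sum>n. d t * u n (inv t \<otimes> s))"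
      unfolding w_def using s summ by (intro sum.cong suminf_mult[symmetric]) auto
    also have "\<dots> = (\<Sum>n. \<Sum>t\<in>carrier G. d t * u n (inv t \<otimes> s))"
      using s summ by (intro suminf_sum[symmetric] summable_mult) auto
    also have "\<dots> = (\<Sum>n. - u (Suc n) s)" by (simp add: u_Suc)
    also have "\<dots> = - (\<Sum>n. u (Suc n) s)"
      using summ[OF s] summable_Suc_iff[of "\<lambda>n. u n s"] by (intro suminf_minus) simp
    finally show ?thesis using tail[OF s] by simp
  qed
  moreover have "cmod (w s - e s) \<le> 2 * \<theta>" if s: "s \<in> carrier G" for s
  proof -
    have "cmod (w s - e s) \<le> (\<Sum>n. \<theta> ^ Suc n)"
      unfolding tail[OF s, symmetric]
    proof (rule norm_suminf_le)
      show "cmod (u (Suc n) s) \<le> \<theta> ^ Suc n" for n by (rule u_le[OF s])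
      show "summable (\<lambda>n. \<theta> ^ Suc n)" using sum_\<theta> summable_Suc_iff[of "\<lambda>n. \<theta> ^ n"] by blast
    qed
    also have "\<dots> = \<theta> * (1 / (1 - \<theta>))"
      using \<theta> \<open>\<theta> \<le> 1 / 2\<close> sum_\<theta> by (simp add: suminf_mult suminf_geometric)
    also have "\<dots> \<le> \<theta> * 2"
      using \<theta> \<open>\<theta> \<le> 1 / 2\<close> by (intro mult_left_mono) (auto simp: field_simps)
    finally show ?thesis by simp
  qed
  ultimately show ?thesis unfolding e_def by blast
qed

section \<open>Norm estimates for corrections by elements of the group algebra\<close>

context cstar_action
begin

lemma dist_left_add:
  assumes "x \<in> carrier A" "y \<in> carrier A" "z \<in> carrier A"
  shows "alg_dist A x (y \<boxplus> z) \<le> alg_dist A x y + alg_norm A z"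
proof -
  have "x \<boxplus> (-1) \<odot> (y \<boxplus> z) = (x \<boxplus> (-1) \<odot> y) \<boxplus> (-1) \<odot> z"
    using assms by (simp add: scale_add_right ab.a_assoc scale_closed)
  then show ?thesis
    using norm_triangle[of "x \<boxplus> (-1) \<odot> y" "(-1) \<odot> z"] assms
    by (simp add: alg_dist_def norm_scale scale_closed)
qed

lemma norm_le_norm_add_dist:
  assumes "x \<in> carrier A" "y \<in> carrier A"
  shows "alg_norm A y \<le> alg_norm A x + alg_dist A x y"
proof -
  define z where "z = x \<boxplus> (-1) \<odot> y"
  have z: "z \<in> carrier A" using assms by (simp add: z_def scale_closed)
  have "y = x \<boxplus> (-1) \<odot> z"
    using assms add_neg[of x]
    by (simp add: z_def scale_add_right scale_scale scale_one scale_closed flip: ab.a_assoc)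
  then have "alg_norm A y \<le> alg_norm A x + alg_norm A ((-1) \<odot> z)"
    using norm_triangle[of x "(-1) \<odot> z"] assms z by (simp add: scale_closed)
  then show ?thesis using z by (simp add: norm_scale) (simp add: z_def alg_dist_def)
qed

text \<open>This is meant for \<open>y t = u\<^sub>t p\<close>: left multiplication of
  \<open>p\<close> by an element of the group algebra gives such a combination, which lies in B even
  where the left factor does not.\<close>

lemma cp_norm_combination:
  assumes "finite T" "\<And>t. t \<in> T \<Longrightarrow> y t \<in> carrier B"
  shows "alg_norm B (\<lambda>s\<in>carrier G. alg_sum A (\<lambda>t. c t \<odot> y t s) T) \<le> (\<Sum>t\<in>T. cmod (c t) * alg_norm B (y t))"
  using assms
proof (induction T rule: finite_induct)
  case empty
  have "alg_norm B (alg_zero B) \<le> 0"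
    using cp_norm_le_L1[OF cp_closed(5)] by (simp add: crossed_product_simps(3) norm_zero)
  then show ?case by (simp add: crossed_product_simps(3) restrict_def)
next
  case (insert i T)
  let ?f = "\<lambda>T. \<lambda>s\<in>carrier G. alg_sum A (\<lambda>t. c t \<odot> y t s) T"
  have cl: "c t \<odot> y t s \<in> carrier A" if "t \<in> insert i T" "s \<in> carrier G" for t s
    using insert.prems that by (auto intro!: scale_closed cp_apply_closed)
  have fB: "?f T \<in> carrier B" using cl by (auto simp: crossed_product_simps intro!: sum_closed)
  have yi: "y i \<in> carrier B" using insert.prems by simp
  have "?f (insert i T) = alg_add B (alg_scale B (c i) (y i)) (?f T)"
  proof
    fix s
    show "?f (insert i T) s = alg_add B (alg_scale B (c i) (y i)) (?f T) s"
      using insert.hyps cl by (cases "s \<in> carrier G") (auto simp: crossed_product_simps sum_insert)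
  qed
  then have "alg_norm B (?f (insert i T)) \<le> alg_norm B (alg_scale B (c i) (y i)) + alg_norm B (?f T)"
    using cp_norm_triangle[OF cp_closed(3)[OF yi] fB] by simp
  also have "\<dots> \<le> cmod (c i) * alg_norm B (y i) + (\<Sum>t\<in>T. cmod (c t) * alg_norm B (y t))"
  proof (rule add_mono)
    show "alg_norm B (alg_scale B (c i) (y i)) \<le> cmod (c i) * alg_norm B (y i)"
      using yi by (rule cp_norm_scale)
    show "alg_norm B (?f T) \<le> (\<Sum>t\<in>T. cmod (c t) * alg_norm B (y t))"
      by (rule insert.IH) (use insert.prems in auto)
  qed
  finally show ?case using insert.hyps by (simp add: restrict_def)
qed

text \<open>Scalars are fixed by the action, so an element of the group algebra on the right mixes
  the coefficients of \<open>P\<close> without applying \<alpha> to them.\<close>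

lemma skew_right_scalar_apply:
  assumes P: "P \<in> carrier S.D" and s: "s \<in> carrier G" and W: "W = (\<lambda>t\<in>carrier G. (alg_zero A, w t))"
  shows "fst ((P \<star> W) s) = alg_sum A (\<lambda>t. w (inv\<^bsub>G\<^esub> t \<otimes>\<^bsub>G\<^esub> s) \<odot> fst (P t)) (carrier G)"
proof -
  have WD: "W \<in> carrier S.D" by (auto simp: W carrier_skew)
  show ?thesis
    unfolding skew_mult_proj[OF P WD s] using s skew_fst_closed[OF P]
    by (intro ab.finsum_cong')
      (auto simp: W act_zero mult_zero_right scale_zero_right scale_closed)
qed

text \<open>On the left, by contrast, the coefficient at \<open>t\<close> of the scalar factor acts
  through \<open>u\<^sub>t\<close>, that is, through \<open>shift\<close>.\<close>

lemma skew_left_scalar_apply: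
  assumes P: "P \<in> carrier S.D" and s: "s \<in> carrier G" and T: "T = (\<lambda>t\<in>carrier G. (alg_zero A, \<tau> t))"
    and p: "p = (\<lambda>s\<in>carrier G. fst (P s))"
  shows "fst ((T \<star> P) s) = alg_sum A (\<lambda>t. \<tau> t \<odot> shift t p s) (carrier G)"
proof -
  have TD: "T \<in> carrier S.D" by (auto simp: T carrier_skew)
  show ?thesis
    unfolding skew_mult_proj[OF TD P s] using s skew_fst_closed[OF P]
    by (intro ab.finsum_cong')
      (auto simp: T p shift_def mult_zero_left scale_zero_right scale_closed act_closed)
qed

text \<open>The bound on scalars controls the scalar part \<open>\<kappa>\<close> of the difference.
  Removing it leaves an element of A, at the cost of another \<open>K * \<delta>\<close>.\<close>

lemma near_if_scalars_bounded:
  assumes K: "K > 0" "\<And>a c. a \<in> carrier A \<Longrightarrow> cmod c \<le> K * NU (a, c)"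
    and x: "x \<in> carrier B" and Y: "Y \<in> carrier S.D" and s: "s \<in> carrier G"
    and near: "NU (embed (x, c) s \<ominus>\<^bsub>U\<^esub> Y s) < \<delta>"
  shows "cmod ((if s = \<one>\<^bsub>G\<^esub> then c else 0) - snd (Y s)) \<le> K * \<delta>"
    and "alg_dist A (x s) (fst (Y s)) \<le> (1 + K) * \<delta>"
proof -
  define a where "a = x s \<boxplus> (-1) \<odot> fst (Y s)"
  define \<kappa> where "\<kappa> = (if s = \<one>\<^bsub>G\<^esub> then c else 0) - snd (Y s)"
  have a: "a \<in> carrier A"
    using cp_apply_closed[OF x s] skew_fst_closed[OF Y s] by (simp add: a_def scale_closed)
  have Ys: "Y s \<in> carrier (unitization A)" using skew_apply_closed_U[OF Y s] by simp
  have "embed (x, c) s \<ominus>\<^bsub>U\<^esub> Y s = alg_add (unitization A) (embed (x, c) s) (alg_scale (unitization A) (-1) (Y s))"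
    using Ys by (rule unitization_a_minus)
  also have "\<dots> = (a, \<kappa>)" using s by (cases "Y s") (auto simp: embed_def a_def \<kappa>_def)
  finally have N: "NU (a, \<kappa>) < \<delta>" using near by simp
  have "cmod \<kappa> \<le> K * NU (a, \<kappa>)" using K(2) a .
  also have "\<dots> \<le> K * \<delta>" using N K(1) by simp
  finally have k: "cmod \<kappa> \<le> K * \<delta>" .
  then show "cmod ((if s = \<one>\<^bsub>G\<^esub> then c else 0) - snd (Y s)) \<le> K * \<delta>" by (simp add: \<kappa>_def)
  have "alg_norm A a \<le> NU (a, 0)" using a by (rule norm_le_unitization_norm)
  also have "\<dots> \<le> NU (a, \<kappa>) + NU (alg_zero A, - \<kappa>)"
    using U.N_add[of "(a, \<kappa>)" "(alg_zero A, - \<kappa>)"] a by simp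
  also have "NU (alg_zero A, - \<kappa>) \<le> cmod \<kappa>"
    using unitization_norm_bdd(2)[OF zero_closed, of "- \<kappa>"] by (simp add: norm_zero)
  finally show "alg_dist A (x s) (fst (Y s)) \<le> (1 + K) * \<delta>"
    using N k by (simp add: a_def alg_dist_def algebra_simps)
qed

text \<open>If the scalars are bounded by the norm of the unitization, the scalar part of the first entry of
  a nearby unimodular tuple is invertible in the group algebra, by a Neumann series. Right
  multiplication by the inverse makes it a scalar, and it becomes a pivot for the other entries.\<close>

lemma approx_if_scalars_bounded:
  assumes K: "K > 0" "\<And>a c. a \<in> carrier A \<Longrightarrow> cmod c \<le> K * NU (a, c)"
    and dense: "dense_tuples (unitization A) t (left_generating_tuples (unitization A) t)"
    and le: "t + card (carrier G) \<le> m + 1" and m: "0 < m"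
    and x: "x \<in> {..<m} \<rightarrow> carrier B" and c: "\<And>i. c i \<noteq> 0" and "\<epsilon> > 0"
  shows "\<exists>f\<in>{..<m} \<rightarrow> carrier B. (\<forall>i<m. alg_norm B (alg_add B (x i) (alg_scale B (-1) (f i))) < \<epsilon>) \<and>
        S.skew.unimodular m (\<lambda>i. embed (f i, c i))"
proof -
  define n where "n = real (card (carrier G))"
  define M where "M = (\<Sum>i<m. \<Sum>s\<in>carrier G. alg_norm A (x i s))"
  define C where "C = (\<Sum>i<m. cmod (c i))"
  define c0 where "c0 = cmod (c 0)"
  \<comment> \<open>All errors are bounded in terms of the initial error \<open>\<delta>\<close>.
    Relative to \<open>c 0\<close>, the scalar part of entry 0 is off by \<open>\<theta>\<close> in
    the \<open>L1\<close> norm. After right multiplication by its inverse, \<open>e1\<close> bounds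
    the error of a coefficient in A and \<open>e2\<close> that of a scalar part. Finally
    \<open>total\<close> includes the correction by the pivot.\<close>
  define \<theta> where "\<theta> \<delta> = n * K * \<delta> / c0" for \<delta>
  define e1 where "e1 \<delta> = (1 + K) * \<delta> + 2 * \<theta> \<delta> * (M + n * ((1 + K) * \<delta>))" for \<delta>
  define e2 where "e2 \<delta> = K * \<delta> + 2 * \<theta> \<delta> * (C + n * (K * \<delta>))" for \<delta>
  define total where "total \<delta> = n * e1 \<delta> + n * (e2 \<delta> / c0) * (M + n * e1 \<delta>)" for \<delta>
  have c0: "c0 > 0" using c by (simp add: c0_def)
  have n: "n \<ge> 0" by (simp add: n_def)
  have xs: "x i s \<in> carrier A" if "i < m" "s \<in> carrier G" for i s
    using x that by (auto intro: cp_apply_closed)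
  have M_ge: "(\<Sum>s\<in>carrier G. alg_norm A (x i s)) \<le> M" if "i < m" for i
    unfolding M_def using that xs norm_nonneg by (intro member_le_sum sum_nonneg) auto
  have C_ge: "cmod (c i) \<le> C" if "i < m" for i
    unfolding C_def using that by (intro member_le_sum) auto
  \<comment> \<open>The bounds are continuous at 0 and \<open>\<theta>\<close> and
    \<open>total\<close> vanish there, so every sufficiently small positive \<open>\<delta>\<close>
    will do.\<close>
  have "(\<theta> \<longlongrightarrow> \<theta> 0) (at_right 0)" "(total \<longlongrightarrow> total 0) (at_right 0)"
    unfolding \<theta>_def total_def e1_def e2_def using c0 by (auto intro!: tendsto_eq_intros)
  moreover have "\<theta> 0 < 1 / 2" "total 0 < \<epsilon>"
    using \<open>\<epsilon> > 0\<close> by (simp_all add: \<theta>_def total_def e1_def e2_def)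
  ultimately have "\<forall>\<^sub>F \<delta> in at_right 0. \<theta> \<delta> < 1 / 2 \<and> total \<delta> < \<epsilon> \<and> 0 < \<delta>"
    by (intro eventually_conj order_tendstoD(2)) (auto intro: eventually_at_right_less)
  then obtain \<delta> where \<delta>: "\<theta> \<delta> < 1 / 2" "total \<delta> < \<epsilon>" "\<delta> > 0"
    by (metis (mono_tags, lifting) eventually_happens' trivial_limit_at_right_real)
  have \<theta>0: "\<theta> \<delta> \<ge> 0" using n K c0 \<delta> by (simp add: \<theta>_def)
  define X where "X i = embed (x i, c i)" for i
  have "X \<in> {..<m} \<rightarrow> carrier S.D" unfolding X_def using x by (auto intro!: embed_closed)
  from unimodular_rows_near[OF dense le this \<delta>(3)] obtain Y where
    Y': "Y \<in> {..<m} \<rightarrow> carrier S.D"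
    and XY: "\<And>i s. \<lbrakk>i < m; s \<in> carrier G\<rbrakk> \<Longrightarrow> NU (X i s \<ominus>\<^bsub>U\<^esub> Y i s) < \<delta>"
    and uniY: "S.skew.unimodular m Y"
    by blast
  have Y: "Y i \<in> carrier S.D" if "i < m" for i using Y' that by auto
  have Ys: "fst (Y i s) \<in> carrier A" if "i < m" "s \<in> carrier G" for i s
    using skew_fst_closed[OF Y] that .
  have Y_snd: "cmod ((if s = \<one>\<^bsub>G\<^esub> then c i else 0) - snd (Y i s)) \<le> K * \<delta>"
    and Y_fst: "alg_dist A (x i s) (fst (Y i s)) \<le> (1 + K) * \<delta>" if "i < m" "s \<in> carrier G" for i s
  proof -
    have xi: "x i \<in> carrier B" using x that by auto
    note near = near_if_scalars_bounded[OF K xi Y[OF that(1)] that(2) XY[OF that, unfolded X_def]]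
    show "cmod ((if s = \<one>\<^bsub>G\<^esub> then c i else 0) - snd (Y i s)) \<le> K * \<delta>" by (rule near(1))
    show "alg_dist A (x i s) (fst (Y i s)) \<le> (1 + K) * \<delta>" by (rule near(2))
  qed
  have Y_sum: "(\<Sum>t\<in>carrier G. alg_norm A (fst (Y i t))) \<le> M + n * ((1 + K) * \<delta>)" if i: "i < m" for i
  proof -
    have "(\<Sum>t\<in>carrier G. alg_norm A (fst (Y i t))) \<le>
        (\<Sum>t\<in>carrier G. alg_norm A (x i t) + (1 + K) * \<delta>)"
    proof (rule sum_mono)
      fix t assume t: "t \<in> carrier G"
      show "alg_norm A (fst (Y i t)) \<le> alg_norm A (x i t) + (1 + K) * \<delta>"
        using norm_le_norm_add_dist[OF xs[OF i t] Ys[OF i t]] Y_fst[OF i t] by simp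
    qed
    also have "\<dots> \<le> M + n * ((1 + K) * \<delta>)"
      using M_ge[OF i] by (simp add: sum.distrib n_def)
    finally show ?thesis .
  qed
  have Y_snd_sum: "(\<Sum>t\<in>carrier G. cmod (snd (Y i t))) \<le> C + n * (K * \<delta>)" if i: "i < m" for i
  proof -
    have "(\<Sum>t\<in>carrier G. cmod (snd (Y i t))) \<le>
        (\<Sum>t\<in>carrier G. (if t = \<one>\<^bsub>G\<^esub> then cmod (c i) else 0) + K * \<delta>)"
    proof (rule sum_mono)
      fix t assume "t \<in> carrier G"
      then show "cmod (snd (Y i t)) \<le> (if t = \<one>\<^bsub>G\<^esub> then cmod (c i) else 0) + K * \<delta>"
        using Y_snd[OF i, of t] norm_triangle_ineq2[of "snd (Y i t)" "if t = \<one>\<^bsub>G\<^esub> then c i else 0"]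
        by (auto simp: norm_minus_commute split: if_splits)
    qed
    also have "\<dots> \<le> C + n * (K * \<delta>)"
      using C_ge[OF i] finite_group by (simp add: sum.distrib n_def)
    finally show ?thesis .
  qed
  \<comment> \<open>The scalar part of entry 0 is \<open>c 0\<close> times \<open>1 + d\<close> in
    the group algebra. Dividing by \<open>c 0\<close> is what makes the Neumann series
    applicable.\<close>
  define d where "d s = snd (Y 0 s) / c 0 - (if s = \<one>\<^bsub>G\<^esub> then 1 else 0)" for s
  have "(\<Sum>s\<in>carrier G. cmod (d s)) \<le> (\<Sum>s\<in>carrier G. K * \<delta> / c0)"
  proof (rule sum_mono)
    fix s assume "s \<in> carrier G"
    moreover have "d s = - ((if s = \<one>\<^bsub>G\<^esub> then c 0 else 0) - snd (Y 0 s)) / c 0"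
      using c[of 0] by (simp add: d_def field_simps)
    ultimately show "cmod (d s) \<le> K * \<delta> / c0"
      using Y_snd[OF m, of s] c0
      by (simp only: norm_divide norm_minus_cancel c0_def[symmetric]) (simp add: divide_right_mono)
  qed
  also have "\<dots> = \<theta> \<delta>" by (simp add: \<theta>_def n_def)
  finally have d_sum: "(\<Sum>s\<in>carrier G. cmod (d s)) \<le> \<theta> \<delta>" .
  obtain w where w: "\<And>s. s \<in> carrier G \<Longrightarrow>
      w s + (\<Sum>t\<in>carrier G. d t * w (inv\<^bsub>G\<^esub> t \<otimes>\<^bsub>G\<^esub> s)) = (if s = \<one>\<^bsub>G\<^esub> then 1 else 0)"
    and w_near: "\<And>s. s \<in> carrier G \<Longrightarrow> cmod (w s - (if s = \<one>\<^bsub>G\<^esub> then 1 else 0)) \<le> 2 * \<theta> \<delta>"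
    using G.neumann_inverse[OF finite_group d_sum] \<delta>(1) by force
  have vw: "(\<Sum>t\<in>carrier G. snd (Y 0 t) * w (inv\<^bsub>G\<^esub> t \<otimes>\<^bsub>G\<^esub> s)) = (if s = \<one>\<^bsub>G\<^esub> then c 0 else 0)"
    if s: "s \<in> carrier G" for s
  proof -
    have "(\<Sum>t\<in>carrier G. snd (Y 0 t) * w (inv\<^bsub>G\<^esub> t \<otimes>\<^bsub>G\<^esub> s)) =
        (\<Sum>t\<in>carrier G. c 0 * ((if t = \<one>\<^bsub>G\<^esub> then w s else 0) + d t * w (inv\<^bsub>G\<^esub> t \<otimes>\<^bsub>G\<^esub> s)))"
      using s c[of 0] by (intro sum.cong) (auto simp: d_def field_simps)
    also have "\<dots> = c 0 * (w s + (\<Sum>t\<in>carrier G. d t * w (inv\<^bsub>G\<^esub> t \<otimes>\<^bsub>G\<^esub> s)))"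
      using finite_group by (simp add: sum_distrib_left[symmetric] sum.distrib)
    finally show ?thesis using w[OF s] by simp
  qed
  \<comment> \<open>\<open>V\<close> is \<open>1 + d\<close> and \<open>W\<close> its right inverse,
    both regarded as elements of the skew ring with no part in A. That \<open>V\<close> is a left
    inverse of \<open>W\<close> is the form in which right multiplication preserves
    unimodularity.\<close>
  define W where "W = (\<lambda>t\<in>carrier G. (alg_zero A, w t))"
  define V where "V = (\<lambda>t\<in>carrier G. (alg_zero A, snd (Y 0 t) / c 0))"
  have WD: "W \<in> carrier S.D" and VD: "V \<in> carrier S.D" by (auto simp: W_def V_def carrier_skew)
  have "V \<star> W = \<one>\<^bsub>S.D\<^esub>"
  proof (rule skew_ext)
    fix s assume s: "s \<in> carrier G"
    have "fst ((V \<star> W) s) = alg_zero A"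
      unfolding skew_right_scalar_apply[OF VD s W_def] using s
      by (intro ab.add.finprod_one_eqI) (auto simp: V_def scale_zero_right)
    moreover have "snd ((V \<star> W) s) = (\<Sum>t\<in>carrier G. snd (Y 0 t) * w (inv\<^bsub>G\<^esub> t \<otimes>\<^bsub>G\<^esub> s)) / c 0"
      unfolding skew_mult_proj[OF VD WD s] sum_divide_distrib using s
      by (intro sum.cong) (auto simp: V_def W_def)
    ultimately show "fst ((V \<star> W) s) = fst (\<one>\<^bsub>S.D\<^esub> s) \<and> snd ((V \<star> W) s) = snd (\<one>\<^bsub>S.D\<^esub> s)"
      using s c[of 0] by (simp add: vw skew_ring_simps)
  qed (use WD VD in auto)
  define P where "P i = Y i \<star> W" for i
  have P: "P i \<in> carrier S.D" if "i < m" for i using Y[OF that] WD by (simp add: P_def)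
  have uniP: "S.skew.unimodular m P"
    unfolding P_def using uniY Y' VD WD \<open>V \<star> W = \<one>\<^bsub>S.D\<^esub>\<close> by (rule S.skew.unimodular_right_mult)
  have Ps: "fst (P i s) \<in> carrier A" if "i < m" "s \<in> carrier G" for i s
    using skew_fst_closed[OF P] that .
  have q: "cmod (w (inv\<^bsub>G\<^esub> t \<otimes>\<^bsub>G\<^esub> s) - (if t = s then 1 else 0)) \<le> 2 * \<theta> \<delta>"
    if "t \<in> carrier G" "s \<in> carrier G" for t s
    using w_near[of "inv\<^bsub>G\<^esub> t \<otimes>\<^bsub>G\<^esub> s"] that by (simp add: inv_mult_eq_one_iff)
  \<comment> \<open>The coefficients of \<open>W\<close> differ from those of 1 by at most
    \<open>2 * \<theta> \<delta>\<close>, and they multiply coefficients of \<open>Y i\<close> whose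
    norms add up to at most \<open>M + n * ((1 + K) * \<delta>)\<close>.\<close>
  have P_fst: "alg_dist A (x i s) (fst (P i s)) \<le> e1 \<delta>" if i: "i < m" and s: "s \<in> carrier G" for i s
  proof -
    let ?q = "\<lambda>t. w (inv\<^bsub>G\<^esub> t \<otimes>\<^bsub>G\<^esub> s) - (if t = s then 1 else 0)"
    let ?r = "alg_sum A (\<lambda>t. ?q t \<odot> fst (Y i t)) (carrier G)"
    have r: "?r \<in> carrier A" using i Ys by (auto intro!: sum_closed scale_closed)
    have "fst (P i s) = alg_sum A (\<lambda>t. (if t = s then fst (Y i s) else alg_zero A) \<boxplus> ?q t \<odot> fst (Y i t)) (carrier G)"
      unfolding P_def skew_right_scalar_apply[OF Y[OF i] s W_def]
    proof (rule ab.finsum_cong')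
      fix t assume t: "t \<in> carrier G"
      define b :: complex where "b = (if t = s then 1 else 0)"
      have "w (inv\<^bsub>G\<^esub> t \<otimes>\<^bsub>G\<^esub> s) \<odot> fst (Y i t) = (b + ?q t) \<odot> fst (Y i t)"
        unfolding b_def by simp
      also have "\<dots> = b \<odot> fst (Y i t) \<boxplus> ?q t \<odot> fst (Y i t)"
        by (rule scale_add_left[OF Ys[OF i t]])
      also have "b \<odot> fst (Y i t) = (if t = s then fst (Y i s) else alg_zero A)"
        using Ys[OF i t] by (auto simp: b_def scale_one scale_zero_left)
      finally show "w (inv\<^bsub>G\<^esub> t \<otimes>\<^bsub>G\<^esub> s) \<odot> fst (Y i t) =
          (if t = s then fst (Y i s) else alg_zero A) \<boxplus> ?q t \<odot> fst (Y i t)" .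
    qed (use i s Ys in \<open>auto intro!: add_closed scale_closed\<close>)
    also have "\<dots> = alg_sum A (\<lambda>t. if t = s then fst (Y i s) else alg_zero A) (carrier G) \<boxplus> ?r"
      using i s Ys by (intro ab.finsum_addf) (auto intro!: scale_closed)
    also have "\<dots> = fst (Y i s) \<boxplus> ?r" using s Ys[OF i s] finite_group by (subst ab.finsum_eq_single[of _ s]) auto
    finally have "alg_dist A (x i s) (fst (P i s)) \<le> (1 + K) * \<delta> + alg_norm A ?r"
      using dist_left_add[OF xs[OF i s] Ys[OF i s] r] Y_fst[OF i s] by simp
    also have "alg_norm A ?r \<le> (\<Sum>t\<in>carrier G. alg_norm A (?q t \<odot> fst (Y i t)))"
      using i Ys by (intro norm_sum finite_group) (auto intro!: scale_closed)
    also have "\<dots> \<le> (\<Sum>t\<in>carrier G. 2 * \<theta> \<delta> * alg_norm A (fst (Y i t)))"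
    proof (rule sum_mono)
      fix t assume t: "t \<in> carrier G"
      show "alg_norm A (?q t \<odot> fst (Y i t)) \<le> 2 * \<theta> \<delta> * alg_norm A (fst (Y i t))"
        unfolding norm_scale[OF Ys[OF i t]]
        using q[OF t s] norm_nonneg[OF Ys[OF i t]] by (rule mult_right_mono)
    qed
    also have "\<dots> \<le> 2 * \<theta> \<delta> * (M + n * ((1 + K) * \<delta>))"
      unfolding sum_distrib_left[symmetric] using \<theta>0 Y_sum[OF i] by (intro mult_left_mono) auto
    finally show ?thesis by (simp add: e1_def)
  qed
  have P_snd_eq: "snd (P i s) = (\<Sum>t\<in>carrier G. snd (Y i t) * w (inv\<^bsub>G\<^esub> t \<otimes>\<^bsub>G\<^esub> s))"
    if "i < m" "s \<in> carrier G" for i s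
    unfolding P_def skew_mult_proj[OF Y[OF that(1)] WD that(2)] using that
    by (intro sum.cong) (auto simp: W_def)
  have P0_snd: "snd (P 0 s) = (if s = \<one>\<^bsub>G\<^esub> then c 0 else 0)" if "s \<in> carrier G" for s
    using P_snd_eq[OF m that] vw[OF that] by simp
  have P_snd: "cmod (snd (P i s) - (if s = \<one>\<^bsub>G\<^esub> then c i else 0)) \<le> e2 \<delta>"
    if i: "i < m" and s: "s \<in> carrier G" for i s
  proof -
    let ?q = "\<lambda>t. w (inv\<^bsub>G\<^esub> t \<otimes>\<^bsub>G\<^esub> s) - (if t = s then 1 else 0)"
    have "snd (P i s) = (\<Sum>t\<in>carrier G. (if t = s then snd (Y i s) else 0) + snd (Y i t) * ?q t)"
      unfolding P_snd_eq[OF i s] by (intro sum.cong) (auto simp: algebra_simps)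
    also have "\<dots> = snd (Y i s) + (\<Sum>t\<in>carrier G. snd (Y i t) * ?q t)"
      using s finite_group by (simp add: sum.distrib)
    finally have eq: "snd (P i s) - (if s = \<one>\<^bsub>G\<^esub> then c i else 0) =
        - ((if s = \<one>\<^bsub>G\<^esub> then c i else 0) - snd (Y i s)) + (\<Sum>t\<in>carrier G. snd (Y i t) * ?q t)" by simp
    have "cmod (snd (P i s) - (if s = \<one>\<^bsub>G\<^esub> then c i else 0)) \<le>
        cmod (- ((if s = \<one>\<^bsub>G\<^esub> then c i else 0) - snd (Y i s))) + cmod (\<Sum>t\<in>carrier G. snd (Y i t) * ?q t)"
      unfolding eq by (rule norm_triangle_ineq)
    also have "cmod (- ((if s = \<one>\<^bsub>G\<^esub> then c i else 0) - snd (Y i s))) \<le> K * \<delta>"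
      unfolding norm_minus_cancel by (rule Y_snd[OF i s])
    also have "cmod (\<Sum>t\<in>carrier G. snd (Y i t) * ?q t) \<le> (\<Sum>t\<in>carrier G. 2 * \<theta> \<delta> * cmod (snd (Y i t)))"
    proof (rule sum_norm_le)
      fix t assume "t \<in> carrier G"
      then have "cmod (?q t) * cmod (snd (Y i t)) \<le> 2 * \<theta> \<delta> * cmod (snd (Y i t))"
        using q s by (intro mult_right_mono) auto
      then show "cmod (snd (Y i t) * ?q t) \<le> 2 * \<theta> \<delta> * cmod (snd (Y i t))"
        by (simp only: Real_Vector_Spaces.norm_mult mult.commute)
    qed
    also have "\<dots> \<le> 2 * \<theta> \<delta> * (C + n * (K * \<delta>))"
      unfolding sum_distrib_left[symmetric] using \<theta>0 Y_snd_sum[OF i] by (intro mult_left_mono) auto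
    finally show ?thesis by (simp add: e2_def)
  qed
  define p where "p i = (\<lambda>s\<in>carrier G. fst (P i s))" for i
  have p: "p i \<in> carrier B" if "i < m" for i
    using Ps that by (auto simp: p_def crossed_product_simps)
  have p_dist: "(\<Sum>s\<in>carrier G. alg_dist A (x i s) (p i s)) \<le> n * e1 \<delta>" if i: "i < m" for i
  proof -
    have "(\<Sum>s\<in>carrier G. alg_dist A (x i s) (p i s)) \<le> (\<Sum>s\<in>carrier G. e1 \<delta>)"
      using P_fst[OF i] by (intro sum_mono) (simp add: p_def)
    then show ?thesis by (simp add: n_def)
  qed
  have p0_norm: "alg_norm B (p 0) \<le> M + n * e1 \<delta>"
  proof -
    have "alg_norm B (p 0) \<le> (\<Sum>s\<in>carrier G. alg_norm A (p 0 s))" by (rule cp_norm_le_L1[OF p[OF m]])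
    also have "\<dots> \<le> (\<Sum>s\<in>carrier G. alg_norm A (x 0 s) + alg_dist A (x 0 s) (p 0 s))"
      using m xs cp_apply_closed[OF p[OF m]] by (intro sum_mono norm_le_norm_add_dist) auto
    also have "\<dots> \<le> M + n * e1 \<delta>" using M_ge[OF m] p_dist[OF m] by (simp add: sum.distrib)
    finally show ?thesis .
  qed
  \<comment> \<open>Entry 0 now has the scalar \<open>c 0\<close> at the identity and nothing else,
    so the defect of entry \<open>i\<close>, divided by \<open>c 0\<close>, is the multiplier that
    removes it. Here the multipliers are pure scalars, and they are small because the defects
    are.\<close>
  define \<tau> where "\<tau> i s = - (snd (P i s) - (if s = \<one>\<^bsub>G\<^esub> then c i else 0)) / c 0" for i s
  define T where "T i = (\<lambda>t\<in>carrier G. (alg_zero A, \<tau> i t))" for i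
  have T: "T i \<in> carrier S.D" for i by (auto simp: T_def carrier_skew)
  define Z where "Z i = (if i = 0 then P 0 else P i \<oplus>\<^bsub>S.D\<^esub> T i \<star> P 0)" for i
  have Z: "Z i \<in> carrier S.D" if "i < m" for i
    using that P T m by (auto simp: Z_def intro!: S.skew.a_closed S.skew.m_closed)
  have uniZ: "S.skew.unimodular m Z"
    unfolding Z_def using uniP P T m by (intro S.skew.unimodular_pivot) auto
  have Z_snd: "snd (Z i s) = (if s = \<one>\<^bsub>G\<^esub> then c i else 0)" if i: "i < m" and s: "s \<in> carrier G" for i s
  proof (cases "i = 0")
    case True
    then show ?thesis using P0_snd[OF s] by (simp add: Z_def)
  next
    case False
    have "snd ((T i \<star> P 0) s) = snd (T i s) * c 0"
      using T P m s P0_snd by (intro snd_skew_mult_const_right) auto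
    then show ?thesis using False s c[of 0] by (simp add: Z_def skew_add_proj T_def \<tau>_def)
  qed
  define f where "f i = (\<lambda>s\<in>carrier G. fst (Z i s))" for i
  have f: "f i \<in> carrier B" "embed (f i, c i) = Z i" if "i < m" for i
    unfolding f_def using embed_if_scalar_part[OF Z, of i "c i"] Z_snd that by auto
  have "alg_norm B (alg_add B (x i) (alg_scale B (-1) (f i))) < \<epsilon>" if i: "i < m" for i
  proof -
    have xi: "x i \<in> carrier B" using x i by auto
    have D: "alg_norm B (alg_add B (x i) (alg_scale B (-1) (p i))) \<le> n * e1 \<delta>"
      using cp_diff_norm_le[OF xi p[OF i]] p_dist[OF i] by simp
    have e1: "0 \<le> n * e1 \<delta>"
      using D cp_norm_nonneg[OF cp_closed(1)[OF xi cp_closed(3)[OF p[OF i]]]] by (rule order_trans[rotated])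
    have e2: "0 \<le> e2 \<delta>" using P_snd[OF i G.one_closed] norm_ge_zero by (rule order_trans[rotated])
    have pn: "0 \<le> M + n * e1 \<delta>" using p0_norm cp_norm_nonneg[OF p[OF m]] by simp
    show ?thesis
    proof (cases "i = 0")
      case True
      then have "f i = p i" by (simp add: f_def p_def Z_def)
      moreover have "n * e1 \<delta> \<le> total \<delta>"
        using e2 pn n c0 by (simp add: total_def)
      ultimately show ?thesis using D \<delta>(2) by simp
    next
      case False
      \<comment> \<open>The change of entry \<open>i\<close> is a combination of the translates
        \<open>u\<^sub>t p\<close> of \<open>p = p 0\<close>, each of norm at most that of
        \<open>p 0\<close>.\<close>
      define h where "h = (\<lambda>s\<in>carrier G. alg_sum A (\<lambda>t. \<tau> i t \<odot> shift t (p 0) s) (carrier G))"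
      have sh: "shift t (p 0) \<in> carrier B" if "t \<in> carrier G" for t
        using shift_closed[OF that p[OF m]] .
      have h: "h \<in> carrier B"
        using cp_apply_closed[OF sh] by (auto simp: h_def crossed_product_simps intro!: sum_closed scale_closed)
      have "fst ((T i \<star> P 0) s) = h s" if "s \<in> carrier G" for s
        using skew_left_scalar_apply[OF P[OF m] that T_def p_def] that by (simp add: h_def)
      then have fi: "f i = alg_add B (p i) h"
        using False by (auto simp: f_def Z_def skew_add_proj crossed_product_simps p_def restrict_def fun_eq_iff)
      have "alg_add B (x i) (alg_scale B (-1) (f i)) =
          alg_add B (alg_add B (x i) (alg_scale B (-1) (p i))) (alg_scale B (-1) h)"
        unfolding fi using cp_apply_closed[OF xi] cp_apply_closed[OF p[OF i]] cp_apply_closed[OF h]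
        by (auto simp: crossed_product_simps scale_add_right ab.a_assoc scale_closed restrict_def fun_eq_iff)
      then have "alg_norm B (alg_add B (x i) (alg_scale B (-1) (f i))) \<le> n * e1 \<delta> + alg_norm B h"
        using cp_norm_triangle[OF cp_closed(1)[OF xi cp_closed(3)[OF p[OF i]]] cp_closed(3)[OF h], of "-1" "-1"]
          D cp_norm_scale[OF h, of "-1"] by simp
      also have "alg_norm B h \<le> (\<Sum>t\<in>carrier G. cmod (\<tau> i t) * alg_norm B (shift t (p 0)))"
        unfolding h_def using finite_group sh by (rule cp_norm_combination)
      also have "\<dots> \<le> (\<Sum>t\<in>carrier G. e2 \<delta> / c0 * (M + n * e1 \<delta>))"
      proof (intro sum_mono mult_mono)
        fix t assume t: "t \<in> carrier G"
        show "cmod (\<tau> i t) \<le> e2 \<delta> / c0"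
          using P_snd[OF i t] c0 unfolding \<tau>_def norm_divide norm_minus_cancel c0_def[symmetric]
          by (simp add: divide_right_mono)
        show "alg_norm B (shift t (p 0)) \<le> M + n * e1 \<delta>"
          using cp_norm_shift[OF t p[OF m]] p0_norm by simp
        show "0 \<le> alg_norm B (shift t (p 0))" using cp_norm_nonneg[OF sh[OF t]] .
        show "0 \<le> e2 \<delta> / c0" using e2 c0 by simp
      qed
      also have "n * e1 \<delta> + \<dots> = total \<delta>" by (simp add: total_def n_def)
      finally show ?thesis using \<delta>(2) by simp
    qed
  qed
  moreover have "S.skew.unimodular m (\<lambda>i. embed (f i, c i))"
    using uniZ Z f(2) by (rule S.skew.unimodular_cong)
  ultimately show ?thesis using f by (intro bexI[of _ f]) auto
qed

end

section \<open>Stable rank of the crossed product\<close>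

context cstar_action
begin

text \<open>Evaluation at the only group element identifies B with A isometrically: it is one of the
  seminorms, and the \<open>L1\<close> norm has this single term. So an approximation in the
  unitization of A is copied to that of B, with its scalars as they are.\<close>

lemma dense_left_generating_tuples_trivial_group:
  assumes trivial: "card (carrier G) = 1"
    and dense: "dense_tuples (unitization A) 1 (left_generating_tuples (unitization A) 1)"
  shows "dense_tuples (unitization B) 1 (left_generating_tuples (unitization B) 1)"
  unfolding dense_tuples_def
proof (intro ballI allI impI)
  have G: "carrier G = {\<one>\<^bsub>G\<^esub>}"
    using trivial G.one_closed by (metis card_1_singletonE singletonD)
  have mult_one: "alg_mult B f h \<one>\<^bsub>G\<^esub> = f \<one>\<^bsub>G\<^esub> \<boxtimes> h \<one>\<^bsub>G\<^esub>" if "f \<in> carrier B" "h \<in> carrier B" for f h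
    using that ab.finsum_eq_single[of "{\<one>\<^bsub>G\<^esub>}" "\<one>\<^bsub>G\<^esub>" "\<lambda>t. f t \<boxtimes> \<alpha> t (h (inv\<^bsub>G\<^esub> t \<otimes>\<^bsub>G\<^esub> \<one>\<^bsub>G\<^esub>))"]
      cp_apply_closed[of f] cp_apply_closed[of h]
    by (simp add: crossed_product_simps(4) G act_id mult_closed)
  have "cstar_seminorm (L1_algebra G A \<alpha>) (\<lambda>h. alg_norm A (h \<one>\<^bsub>G\<^esub>))"
    unfolding cstar_seminorm_def L1_algebra_simps
    using cp_apply_closed cp_closed
    by (auto simp: mult_one norm_nonneg norm_mult norm_star)
      (auto simp: crossed_product_simps norm_triangle norm_scale act_id adj_closed norm_star)
  then have seminorm: "(\<lambda>h. alg_norm A (h \<one>\<^bsub>G\<^esub>)) \<in> seminorms" by (simp add: G)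
  fix a and \<epsilon> :: real assume a: "a \<in> {..<1::nat} \<rightarrow>\<^sub>E carrier (unitization B)" and "\<epsilon> > 0"
  have "a 0 \<in> carrier (unitization B)" using a by auto
  then obtain y c where a0: "a 0 = (y, c)" and y: "y \<in> carrier B" by auto
  have y1: "y \<one>\<^bsub>G\<^esub> \<in> carrier A" using y by (intro cp_apply_closed) auto
  have "(\<lambda>i\<in>{..<1::nat}. (y \<one>\<^bsub>G\<^esub>, c)) \<in> {..<1::nat} \<rightarrow>\<^sub>E carrier (unitization A)" using y1 by auto
  with dense \<open>\<epsilon> > 0\<close> obtain b where b: "b \<in> left_generating_tuples (unitization A) 1"
    and close: "\<forall>i<1::nat. alg_dist (unitization A) ((\<lambda>i\<in>{..<1::nat}. (y \<one>\<^bsub>G\<^esub>, c)) i) (b i) < \<epsilon>"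
    unfolding dense_tuples_def by blast
  have "b 0 \<in> carrier (unitization A)" using b by (auto simp: left_generating_tuples_def)
  then obtain x d where b0: "b 0 = (x, d)" and x: "x \<in> carrier A" by auto
  obtain l where l: "l \<in> {..<1::nat} \<rightarrow> carrier U"
    and one: "(\<Oplus>\<^bsub>U\<^esub>i\<in>{..<1::nat}. l i \<otimes>\<^bsub>U\<^esub> b i) = \<one>\<^bsub>U\<^esub>"
    using left_generating_tuple_unimodular[OF U.ring_axioms b] by auto
  have l0: "l 0 \<in> carrier U" and bU: "b 0 \<in> carrier U" using l b0 x by auto
  have lb: "l 0 \<otimes>\<^bsub>U\<^esub> b 0 = \<one>\<^bsub>U\<^esub>"
    using one U.finsum_lessThan_one[of "\<lambda>i. l i \<otimes>\<^bsub>U\<^esub> b i"] U.m_closed[OF l0 bU] by simp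
  \<comment> \<open>The scalar part of the product is the product of the scalar parts, which is 1.
    The nonzero scalar \<open>d\<close> is what the criterion for left generation asks of one
    entry.\<close>
  then have d: "d \<noteq> 0" using b0 by (auto simp: prod_eq_iff)
  define z where "z = (\<lambda>i\<in>{..<1::nat}. (\<lambda>s\<in>carrier G. x, d))"
  have z: "z \<in> {..<1::nat} \<rightarrow>\<^sub>E carrier (unitization B)" using x by (auto simp: z_def crossed_product_simps)
  have "S.skew.unimodular 1 (\<lambda>i. embed (z i))"
  proof -
    let ?l = "\<lambda>t\<in>carrier G. l 0"
    have lD: "?l \<in> carrier S.D" using l0 by (auto simp: carrier_skew)
    have zD: "embed (z 0) \<in> carrier S.D" using z by (intro embed_closed) auto
    have z1: "embed (z 0) \<one>\<^bsub>G\<^esub> = b 0" using b0 by (simp add: embed_def z_def)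
    have "?l \<star> embed (z 0) = \<one>\<^bsub>S.D\<^esub>"
    proof (rule skew_ext)
      fix s assume "s \<in> carrier G"
      then have s: "s = \<one>\<^bsub>G\<^esub>" using G by blast
      have l_eq: "?l = (\<lambda>t\<in>carrier G. if t = \<one>\<^bsub>G\<^esub> then l 0 else \<zero>\<^bsub>U\<^esub>)"
        by (rule restrict_ext) (use G in auto)
      have "(?l \<star> embed (z 0)) \<one>\<^bsub>G\<^esub> = l 0 \<otimes>\<^bsub>U\<^esub> embed (z 0) \<one>\<^bsub>G\<^esub>"
        unfolding l_eq using S.skew_const_mult[OF l0 zD G.one_closed] .
      then have "(?l \<star> embed (z 0)) \<one>\<^bsub>G\<^esub> = \<one>\<^bsub>S.D\<^esub> \<one>\<^bsub>G\<^esub>"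
        unfolding z1 lb by (simp add: skew_ring_simps)
      then show "fst ((?l \<star> embed (z 0)) s) = fst (\<one>\<^bsub>S.D\<^esub> s) \<and>
          snd ((?l \<star> embed (z 0)) s) = snd (\<one>\<^bsub>S.D\<^esub> s)" using s by simp
    qed (use lD zD in auto)
    moreover have "(\<Oplus>\<^bsub>S.D\<^esub>i\<in>{..<1::nat}. ?l \<star> embed (z i)) = ?l \<star> embed (z 0)"
      using S.skew.m_closed[OF lD zD] by (rule S.skew.finsum_lessThan_one)
    ultimately show ?thesis
      unfolding S.skew.unimodular_def using lD by (intro bexI[of _ "\<lambda>_. ?l"]) auto
  qed
  then have "z \<in> left_generating_tuples (unitization B) 1"
    using left_generating_if_embed_unimodular[OF z, of 0] d by (simp add: z_def)
  moreover have "alg_dist (unitization B) (a 0) (z 0) < \<epsilon>"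
  proof -
    define g where "g = alg_add B y (alg_scale B (-1) (\<lambda>s\<in>carrier G. x))"
    have xB: "(\<lambda>s\<in>carrier G. x) \<in> carrier B" using x by (auto simp: crossed_product_simps)
    have g: "g \<in> carrier B" unfolding g_def using y xB by (intro cp_closed)
    have g1: "g \<one>\<^bsub>G\<^esub> = y \<one>\<^bsub>G\<^esub> \<boxplus> (-1) \<odot> x" by (simp add: g_def crossed_product_simps)
    have g1A: "g \<one>\<^bsub>G\<^esub> \<in> carrier A" using g by (intro cp_apply_closed) auto
    have "alg_norm (unitization B) (g, c - d) \<le> NU (g \<one>\<^bsub>G\<^esub>, c - d)"
      unfolding unitization_norm[of B]
    proof (rule cSUP_least)
      have "alg_norm B (alg_zero B) \<le> 0"
        using cp_norm_le_L1[OF cp_closed(5)] by (simp add: crossed_product_simps(3) norm_zero)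
      then show "{h \<in> carrier B. alg_norm B h \<le> 1} \<noteq> {}" using cp_closed(5) by force
      fix h assume "h \<in> {h \<in> carrier B. alg_norm B h \<le> 1}"
      then have h: "h \<in> carrier B" "alg_norm B h \<le> 1" by auto
      have h1: "h \<one>\<^bsub>G\<^esub> \<in> carrier A" using h by (intro cp_apply_closed) auto
      have "alg_norm A (h \<one>\<^bsub>G\<^esub>) \<le> 1" using seminorm_le_cp_norm[OF seminorm h(1)] h(2) by simp
      then have "alg_norm A (g \<one>\<^bsub>G\<^esub> \<boxtimes> h \<one>\<^bsub>G\<^esub> \<boxplus> (c - d) \<odot> h \<one>\<^bsub>G\<^esub>) \<le> NU (g \<one>\<^bsub>G\<^esub>, c - d)"
        using g1A h1 by (intro unitization_norm_upper)
      moreover have "alg_add B (alg_mult B g h) (alg_scale B (c - d) h) \<one>\<^bsub>G\<^esub> =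
          g \<one>\<^bsub>G\<^esub> \<boxtimes> h \<one>\<^bsub>G\<^esub> \<boxplus> (c - d) \<odot> h \<one>\<^bsub>G\<^esub>"
        using mult_one[OF g h(1)] by (simp add: crossed_product_simps(2,5))
      moreover have "alg_norm B (alg_add B (alg_mult B g h) (alg_scale B (c - d) h)) \<le>
          alg_norm A (alg_add B (alg_mult B g h) (alg_scale B (c - d) h) \<one>\<^bsub>G\<^esub>)"
        using cp_norm_le_L1[OF cp_closed(1)[OF cp_closed(2)[OF g h(1)] cp_closed(3)[OF h(1)]]]
        by (simp add: G)
      ultimately show "alg_norm B (alg_add B (alg_mult B g h) (alg_scale B (c - d) h)) \<le> NU (g \<one>\<^bsub>G\<^esub>, c - d)"
        by simp
    qed
    also have "\<dots> = alg_dist (unitization A) (y \<one>\<^bsub>G\<^esub>, c) (b 0)"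
      by (simp add: alg_dist_def g1 b0)
    also have "\<dots> < \<epsilon>" using close by simp
    finally show ?thesis by (simp add: alg_dist_def a0 z_def g_def)
  qed
  ultimately show "\<exists>b\<in>left_generating_tuples (unitization B) 1. \<forall>i<1::nat. alg_dist (unitization B) (a i) (b i) < \<epsilon>"
    by auto
qed

text \<open>The cases are whether \<open>NU (a, 1)\<close> stays away from zero. If it does,
  homogeneity turns the lower bound \<open>\<epsilon>\<close> into
  \<open>K = 1 / \<epsilon>\<close>. If not, two entries are called for; with only one, the equation
  for \<open>m\<close> forces \<open>t = 1\<close> and a trivial group.\<close>

proposition dense_left_generating_tuples_nonunital:
  assumes dense: "dense_tuples (unitization A) t (left_generating_tuples (unitization A) t)"
    and t: "1 \<le> t" and m: "m + 1 = t + card (carrier G)"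
  shows "dense_tuples (unitization B) m (left_generating_tuples (unitization B) m)"
proof -
  have m0: "0 < m" and le: "t + card (carrier G) \<le> m + 1" using t m card_group_pos by auto
  consider "\<exists>K>0. \<forall>a\<in>carrier A. \<forall>c. cmod c \<le> K * NU (a, c)"
    | "\<forall>\<epsilon>>0. \<exists>a\<in>carrier A. NU (a, 1) < \<epsilon>" "m = 1"
    | "\<forall>\<epsilon>>0. \<exists>a\<in>carrier A. NU (a, 1) < \<epsilon>" "2 \<le> m"
  proof -
    have "\<exists>K>0. \<forall>a\<in>carrier A. \<forall>c. cmod c \<le> K * NU (a, c)"
      if \<epsilon>: "\<epsilon> > 0" "\<And>a. a \<in> carrier A \<Longrightarrow> \<epsilon> \<le> NU (a, 1)" for \<epsilon>
    proof (intro exI[of _ "1 / \<epsilon>"] conjI ballI allI)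
      fix a c assume a: "a \<in> carrier A"
      show "cmod c \<le> 1 / \<epsilon> * NU (a, c)"
      proof (cases "c = 0")
        case False
        have "\<epsilon> \<le> NU ((1 / c) \<odot> a, 1 / c * c)" using \<epsilon>(2) a False by (simp add: scale_closed)
        also have "\<dots> \<le> cmod (1 / c) * NU (a, c)" using a by (rule unitization_norm_scale)
        finally show ?thesis using False \<epsilon>(1) by (simp add: norm_divide field_simps)
      qed (use a \<epsilon>(1) unitization_norm_nonneg in simp)
    qed (use \<epsilon> in simp)
    then show ?thesis using that m0 by (metis not_le One_nat_def less_2_cases_iff linorder_not_less nat_neq_iff)
  qed
  then show ?thesis
  proof cases
    case 1
    then show ?thesis
      using approx_if_scalars_bounded[OF _ _ dense le m0] m0 by (intro dense_if_scalars_fixed) blast+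
  next
    case 2
    then have "t = 1" "card (carrier G) = 1" using t m card_group_pos by auto
    then show ?thesis using dense_left_generating_tuples_trivial_group dense 2 by simp
  next
    case 3
    then show ?thesis
      using approx_if_scalars_unbounded[OF 3(1) dense le 3(2)] m0 by (intro dense_if_scalars_fixed) blast+
  qed
qed

end

theorem theorem2p4:
  fixes A :: "'a normed_star_alg"
    and G :: "('g, 'm) monoid_scheme"
    and \<alpha> :: "'g \<Rightarrow> 'a \<Rightarrow> 'a"
  assumes "cstar_algebra A"
    and "group G" and "finite (carrier G)"
    and "\<alpha> \<in> hom G (star_Aut A)"
  shows "tsr (crossed_product G A \<alpha>) \<le> tsr A + enat (card (carrier G)) - 1"
proof -
  interpret cstar_action A G \<alpha>
    using assms by (intro cstar_action.intro cstar_action_axioms.intro plain_cstar_algebra.intro)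
  show ?thesis
  proof (cases "tsr A")
    case (enat t)
    \<comment> \<open>The subtraction is not truncated: the rank and the order of the group are at
      least 1.\<close>
    define m where "m = t + card (carrier G) - 1"
    have "tsr B \<le> enat m"
    proof (cases "unital A")
      case True
      then have "tsr_unital A = enat t" using enat by (simp add: tsr_def)
      note t = tsr_unital_attained[OF this]
      have "dense_tuples B m (left_generating_tuples B m)"
        using True t by (intro dense_left_generating_tuples_unital[of t]) (auto simp: m_def)
      then have "tsr_unital B \<le> enat m"
        using t card_group_pos by (intro tsr_unital_le) (auto simp: m_def)
      then show ?thesis using cp_unital_if_unital[OF True] by (simp add: tsr_def)
    next
      case False
      then have "tsr_unital (unitization A) = enat t" using enat by (simp add: tsr_def)
      note t = tsr_unital_attained[OF this]
      have "dense_tuples (unitization B) m (left_generating_tuples (unitization B) m)"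
        using t by (intro dense_left_generating_tuples_nonunital[of t]) (auto simp: m_def)
      then have "tsr_unital (unitization B) \<le> enat m"
        using t card_group_pos by (intro tsr_unital_le) (auto simp: m_def)
      then show ?thesis using False unital_if_cp_unital by (auto simp: tsr_def)
    qed
    also have "enat m = tsr A + enat (card (carrier G)) - 1"
      by (simp add: enat m_def one_enat_def)
    finally show ?thesis .
  \<comment> \<open>If the stable rank of A is infinite, then so is the right-hand side.\<close>
  qed simp
qed

end
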